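(* Let $n\ge 3$, let $a_0,\dots,a_{n-1}\in\mathbb{C}$, $a_n=1$, let $r_0,\dots,r_{n-1}\in\mathcal{AP}(\mathbb{R},\mathbb{C})$, $r_n\equiv 0$, and consider $$ (E)\qquad y^{(n)}(t)+\sum_{i=0}^{n-1}(a_i+r_i(t))\,y^{(i)}(t)=0,\qquad t\in\mathbb{R}.$$ Let $\lambda$ be a fixed root of $P(a;x)=x^n+\sum_{i=0}^{n-1}a_ix^i$, and assume that the roots $\gamma_1,\dots,\gamma_{n-1}$ of the characteristic polynomial of the operator $\mathcal{D}$ (equivalently $\gamma_j=\lambda_j-\lambda$, where $\lambda_1,\dots,\lambda_{n-1}$ are the other roots of $P(a;x)$) are pairwise different and satisfy $\alpha_j:=\Re\gamma_j\neq 0$ for $j=1,\dots,n-1$. With the notation of the context, assume that $$L_0<1\quad\text{and}\quad H\le \max\{[1-L_0-m(\delta)Q_0]\,\delta \ :\ \delta\in(0,\delta_\lambda)\},\qquad H:=\Big\|\sum_{i=0}^{n-2}\big|G[P(r;\lambda)]^{(i)}\big|\Big\|_\infty .$$ Then there exists a solution $y_\lambda:\mathbb{R}\to\mathbb{C}$ of $(E)$ such that $$\begin{aligned} y_\lambda(t)=\ & e^{\lambda t}\exp\bigg((-1)^n\prod_{j=1}^{n-1}\gamma_j^{-1}\int_0^t\big[P(r(s);\lambda)+\mathcal{L}(s,z(s))+\mathcal{F}(s,Z(s))\big]\,ds\bigg)\\ &\times\exp\bigg(-\sum_{j=1}^{n-1}\frac{1}{\Gamma_j\gamma_j}G_{\gamma_j}\big[P(r;\lambda)+\mathcal{L}(\cdot,z)+\mathcal{F}(\cdot,Z)\big](t)\bigg),\end{aligned}$$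 where $Z=(z,z',\dots,z^{(n-2)})$ and $z\in\mathcal{AP}^{n-2}(\mathbb{R})$ satisfies both the differential equation $$\mathcal{D}z(t)+P(r(t);\lambda)+\mathcal{L}(t,z)+\mathcal{F}(t,z,\dots,z^{(n-2)})=0\quad\text{in }\mathbb{R}$$ and the integral equation $$z=-G\big[P(r;\lambda)+\mathcal{L}(\cdot,z)+\mathcal{F}(\cdot,Z)\big].$$ In addition, if there exists a constant $0<\beta<\min\{|\alpha_j| : 1\le j\le n-1\}$ such that $L_\beta<\frac12$, then $z^{(i)}=O\big((I_\beta+I_{-\beta})[P(r;\lambda)]\big)$ for $i=0,1,\dots,n-2$, and moreover $$\frac{y_\lambda^{(i)}(t)}{y_\lambda(t)}=\lambda^i+O\big((I_\beta+I_{-\beta})[P(r;\lambda)]\big),\qquad i=1,\dots,n-1.$$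
   Context: $\mathcal{AP}(\mathbb{R},\mathbb{C})$: continuous $r:\mathbb{R}\to\mathbb{C}$ such that every real sequence $\{b_k\}$ has a subsequence $\{\tilde b_m\}$ for which $\lim_{m}r(t+\tilde b_m)$ exists uniformly in $t\in\mathbb{R}$. $\mathcal{AP}^{n-2}(\mathbb{R})$: functions $z:\mathbb{R}\to\mathbb{C}$ with $z^{(i)}\in\mathcal{AP}(\mathbb{R},\mathbb{C})$ for $i=0,\dots,n-2$. $\|\cdot\|_\infty$ is the supremum norm on $\mathbb{R}$; $f=O(h)$ (with $h\ge 0$) means $|f(t)|\le C\,h(t)$ for all $t\in\mathbb{R}$, for some constant $C$. Green operators: for $\omega\in\mathbb{C}$, $\Re\omega\ne0$, put $g_\omega(t,s)=-\mathrm{sgn}(\Re\omega)e^{\omega(t-s)}$ if $\mathrm{sgn}(\Re\omega)(t-s)<0$ and $g_\omega(t,s)=0$ otherwise; $G_\omega[f](t)=\int_{-\infty}^\infty g_\omega(t,s)f(s)\,ds$ and $I_\omega[f](t)=\int_{-\infty}^\infty|g_\omega(t,s)f(s)|\,ds$. Put $\Gamma_j=\prod_{k\ne j,\,1\le k\le n-1}(\gamma_j-\gamma_k)$, $\tilde\alpha_j=\sum_{i=0}^{n-2}|\gamma_j|^i$, and $G[f]=\sum_{j=1}^{n-1}\frac1{\Gamma_j}G_{\gamma_j}[f]$. $G[f]^{(i)}$ is the $i$-th derivative of $G[f]$. For $c=(c_0,\dots,c_n)$, $P(c;x)=\sum_{i=0}^nc_ix^i$; $a=(a_0,\dots,a_{n-1},1)$,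 $r=(r_0,\dots,r_{n-1},0)$. $\frac{\partial^k}{\partial x^k}P(a;\lambda)$ and $\frac{\partial^k}{\partial x^k}P(r;\lambda)$ denote the $k$-th derivatives in $x$ evaluated at $x=\lambda$. Set $\mathcal{D}z=\sum_{j=1}^n\frac1{j!}\frac{\partial^j}{\partial x^j}P(a;\lambda)\,z^{(j-1)}$ (a linear operator of order $n-1$ whose characteristic polynomial is $\sum_{k=1}^n\frac1{k!}\frac{\partial^k}{\partial x^k}P(a;\lambda)x^{k-1}$), $P(r(t);\lambda)=\sum_{k=0}^{n-1}\lambda^kr_k(t)$, $\mathcal{L}(t,z)=\sum_{k=1}^{n-1}\frac1{k!}\frac{\partial^k}{\partial x^k}P(r(t);\lambda)\,z^{(k-1)}(t)$, $$\mathcal{F}(t,z,\dots,z^{(n-2)})=\sum_{i=2}^n\sum_{j=0}^{n-i}\binom{i+j}{j}(a_{i+j}+r_{i+j}(t))\lambda^jf_{i-1}(z,z',\dots,z^{(i-2)}),$$ with $\lambda^0=1$ also if $\lambda=0$. Here $B_0=1$, $B_{i+1}(x_1,\dots,x_{i+1})=\sum_{j=0}^i\binom ijB_{i-j}(x_1,\dots,x_{i-j})x_{j+1}$ are the complete Bell polynomials and $f_i(x_1,\dots,x_i)=B_{i+1}(x_1,\dots,x_{i+1})-x_{i+1}$ (a polynomial in $x_1,\dots,x_i$ only). The function $m$: with $\|X\|=\sum_k|x_k|$ and $B(0;\delta)$ the ball of radius $\delta$ centred at $0$ in $\mathbb{C}^i$, $m_i(\delta)=\sup\{|f_i(X)-f_i(Y)|/\|X-Y\|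 : X\ne Y,\ X,Y\in B(0;\delta)\}$, and $m(\delta)=\max_{i=2,\dots,n}m_i(\delta)$, $m(0)=0$; it is continuous on $[0,\infty)$, positive for $\delta>0$, and tends to $+\infty$ as $\delta\to+\infty$. For $0\le\beta<\min_{1\le j\le n-1}|\alpha_j|$, $$L_\beta=\sum_{j=1}^{n-1}\sum_{k=1}^{n-1}\Big|\frac{\tilde\alpha_j}{\Gamma_jk!}\Big|\,\Big\|I_{\alpha_j-\mathrm{sgn}(\alpha_j)\beta}\Big[\frac{\partial^k}{\partial x^k}P(r(\cdot);\lambda)\Big]\Big\|_\infty,$$ $$Q_\beta=\sum_{j=1}^{n-1}\sum_{i=2}^n\sum_{k=0}^{i-2}\frac{\tilde\alpha_j}{|\Gamma_j|}\binom ik|\lambda|^k\Big(\frac{|a_i|}{|\alpha_j-\mathrm{sgn}(\alpha_j)\beta|}+\big\|I_{\alpha_j-\mathrm{sgn}(\alpha_j)\beta}[|r_i|]\big\|_\infty\Big).$$ When $L_0<1$, $\delta_\lambda>0$ is the number such that $0<m(\delta)<\frac{1-L_0}{Q_0}$ for all $\delta\in(0,\delta_\lambda)$ and $m(\delta_\lambda)=\frac{1-L_0}{Q_0}$. *)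

theory Defs
  imports
    "HOL-Analysis.Analysis"
    "HOL-Computational_Algebra.Polynomial"
begin

text \<open>Derivatives of functions of a real variable. Since vector_derivative is total, existence is
  always required separately, through times_differentiable.\<close>

definition nderiv :: "nat \<Rightarrow> (real \<Rightarrow> complex) \<Rightarrow> real \<Rightarrow> complex" where
  "nderiv k z = ((\<lambda>u t. vector_derivative u (at t)) ^^ k) z"

definition times_differentiable :: "nat \<Rightarrow> (real \<Rightarrow> complex) \<Rightarrow> bool" where
  "times_differentiable N z \<longleftrightarrow> (\<forall>k<N. \<forall>t. nderiv k z differentiable at t)"

text \<open>The supremum norm on the real line; a real supremum, so meaningful for bounded functions
  only.\<close>

definition supnorm :: "(real \<Rightarrow> 'a::real_normed_vector) \<Rightarrow> real" where
  "supnorm f = (SUP t. norm (f t))"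

definition is_bigO :: "(real \<Rightarrow> complex) \<Rightarrow> (real \<Rightarrow> real) \<Rightarrow> bool" where
  "is_bigO f h \<longleftrightarrow> (\<exists>C. \<forall>t. cmod (f t) \<le> C * h t)"

definition AP :: "(real \<Rightarrow> complex) set" where
  "AP = {u. continuous_on UNIV u \<and>
     (\<forall>b :: nat \<Rightarrow> real. \<exists>\<phi> :: nat \<Rightarrow> nat. strict_mono \<phi> \<and>
        (\<exists>l. uniform_limit UNIV (\<lambda>m t. u (t + b (\<phi> m))) l sequentially))}"

definition AP_diff :: "nat \<Rightarrow> (real \<Rightarrow> complex) set" where
  "AP_diff N = {z. times_differentiable N z \<and> (\<forall>i\<le>N. nderiv i z \<in> AP)}"

definition green :: "complex \<Rightarrow> real \<Rightarrow> real \<Rightarrow> complex" where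
  "green \<omega> t s =
     (if sgn (Re \<omega>) * (t - s) < 0
      then - of_real (sgn (Re \<omega>)) * exp (\<omega> * of_real (t - s)) else 0)"

definition G_op :: "complex \<Rightarrow> (real \<Rightarrow> complex) \<Rightarrow> real \<Rightarrow> complex" where
  "G_op \<omega> f t = (\<integral>s. green \<omega> t s * f s \<partial>lborel)"

definition I_op :: "complex \<Rightarrow> (real \<Rightarrow> complex) \<Rightarrow> real \<Rightarrow> real" where
  "I_op \<omega> f t = (\<integral>s. cmod (green \<omega> t s * f s) \<partial>lborel)"

text \<open>In the remaining definitions, n, a, r, lam, \<open>\<gamma>\<close> are the order of the equation, the constant
  coefficients a 0, ..., a n (with a n = 1), the perturbations r 0, ..., r n (with r n = 0), the
  selected root and the roots \<open>\<gamma> 1, ..., \<gamma> (n - 1)\<close>.\<close>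

definition Gam :: "nat \<Rightarrow> (nat \<Rightarrow> complex) \<Rightarrow> nat \<Rightarrow> complex" where
  "Gam n \<gamma> j = (\<Prod>k\<in>{1..n-1} - {j}. \<gamma> j - \<gamma> k)"

definition alpha_tilde :: "nat \<Rightarrow> (nat \<Rightarrow> complex) \<Rightarrow> nat \<Rightarrow> real" where
  "alpha_tilde n \<gamma> j = (\<Sum>i=0..n-2. cmod (\<gamma> j) ^ i)"

definition G_tot :: "nat \<Rightarrow> (nat \<Rightarrow> complex) \<Rightarrow> (real \<Rightarrow> complex) \<Rightarrow> real \<Rightarrow> complex" where
  "G_tot n \<gamma> f t = (\<Sum>j=1..n-1. 1 / Gam n \<gamma> j * G_op (\<gamma> j) f t)"

definition Ppoly :: "nat \<Rightarrow> (nat \<Rightarrow> complex) \<Rightarrow> complex poly" where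
  "Ppoly n c = (\<Sum>i=0..n. monom (c i) i)"

definition dP :: "nat \<Rightarrow> nat \<Rightarrow> (nat \<Rightarrow> complex) \<Rightarrow> complex \<Rightarrow> complex" where
  "dP k n c x = poly ((pderiv ^^ k) (Ppoly n c)) x"

definition dPr :: "nat \<Rightarrow> nat \<Rightarrow> (nat \<Rightarrow> real \<Rightarrow> complex) \<Rightarrow> complex \<Rightarrow> real \<Rightarrow> complex" where
  "dPr k n r lam t = dP k n (\<lambda>i. r i t) lam"

abbreviation Pr :: "nat \<Rightarrow> (nat \<Rightarrow> real \<Rightarrow> complex) \<Rightarrow> complex \<Rightarrow> real \<Rightarrow> complex" where
  "Pr \<equiv> dPr 0"

definition D_op :: "nat \<Rightarrow> (nat \<Rightarrow> complex) \<Rightarrow> complex \<Rightarrow> (real \<Rightarrow> complex) \<Rightarrow> real \<Rightarrow> complex" where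
  "D_op n a lam z t = (\<Sum>j=1..n. 1 / fact j * dP j n a lam * nderiv (j - 1) z t)"

definition D_charpoly :: "nat \<Rightarrow> (nat \<Rightarrow> complex) \<Rightarrow> complex \<Rightarrow> complex poly" where
  "D_charpoly n a lam = (\<Sum>k=1..n. monom (1 / fact k * dP k n a lam) (k - 1))"

definition L_op ::
    "nat \<Rightarrow> (nat \<Rightarrow> real \<Rightarrow> complex) \<Rightarrow> complex \<Rightarrow> (real \<Rightarrow> complex) \<Rightarrow> real \<Rightarrow> complex" where
  "L_op n r lam z t = (\<Sum>k=1..n-1. 1 / fact k * dPr k n r lam t * nderiv (k - 1) z t)"

text \<open>Complete Bell polynomials. The variables x_1, x_2, ... are the values x 1, x 2, ... of a
  sequence; x 0 is never used.\<close>

fun bell :: "nat \<Rightarrow> (nat \<Rightarrow> complex) \<Rightarrow> complex" where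
  "bell 0 x = 1"
| "bell (Suc i) x = (\<Sum>j\<le>i. of_nat (i choose j) * bell (i - j) x * x (j + 1))"

text \<open>The term x (i + 1) cancels, so the following depends on x 1, ..., x i only.\<close>

definition f_bell :: "nat \<Rightarrow> (nat \<Rightarrow> complex) \<Rightarrow> complex" where
  "f_bell i x = bell (i + 1) x - x (i + 1)"

text \<open>The k-th variable of the polynomials above is the derivative of order k - 1.\<close>

definition F_op ::
    "nat \<Rightarrow> (nat \<Rightarrow> complex) \<Rightarrow> (nat \<Rightarrow> real \<Rightarrow> complex) \<Rightarrow> complex \<Rightarrow> (real \<Rightarrow> complex) \<Rightarrow> real \<Rightarrow> complex"
  where
  "F_op n a r lam z t =
     (\<Sum>i=2..n. \<Sum>j=0..n-i. of_nat ((i + j) choose j) * (a (i + j) + r (i + j) t) * lam ^ j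
        * f_bell (i - 1) (\<lambda>k. nderiv (k - 1) z t))"

definition forcing ::
    "nat \<Rightarrow> (nat \<Rightarrow> complex) \<Rightarrow> (nat \<Rightarrow> real \<Rightarrow> complex) \<Rightarrow> complex \<Rightarrow> (real \<Rightarrow> complex) \<Rightarrow> real \<Rightarrow> complex"
  where
  "forcing n a r lam z t = Pr n r lam t + L_op n r lam z t + F_op n a r lam z t"

text \<open>Points of complex i-space are sequences vanishing outside the indices 1, ..., i.\<close>

definition l1_ball :: "nat \<Rightarrow> real \<Rightarrow> (nat \<Rightarrow> complex) set" where
  "l1_ball i \<delta> = {X. (\<forall>k. k \<notin> {1..i} \<longrightarrow> X k = 0) \<and> (\<Sum>k=1..i. cmod (X k)) < \<delta>}"

definition m_idx :: "nat \<Rightarrow> real \<Rightarrow> real" where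
  "m_idx i \<delta> = Sup {cmod (f_bell i X - f_bell i Y) / (\<Sum>k=1..i. cmod (X k - Y k)) | X Y.
                     X \<in> l1_ball i \<delta> \<and> Y \<in> l1_ball i \<delta> \<and> X \<noteq> Y}"

definition m_fun :: "nat \<Rightarrow> real \<Rightarrow> real" where
  "m_fun n \<delta> = (if \<delta> = 0 then 0 else Max ((\<lambda>i. m_idx i \<delta>) ` {2..n}))"

definition shifted :: "(nat \<Rightarrow> complex) \<Rightarrow> real \<Rightarrow> nat \<Rightarrow> real" where
  "shifted \<gamma> \<beta> j = Re (\<gamma> j) - sgn (Re (\<gamma> j)) * \<beta>"

definition L_const ::
    "nat \<Rightarrow> (nat \<Rightarrow> real \<Rightarrow> complex) \<Rightarrow> complex \<Rightarrow> (nat \<Rightarrow> complex) \<Rightarrow> real \<Rightarrow> real" where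
  "L_const n r lam \<gamma> \<beta> =
     (\<Sum>j=1..n-1. \<Sum>k=1..n-1.
        cmod (of_real (alpha_tilde n \<gamma> j) / (Gam n \<gamma> j * fact k))
        * supnorm (I_op (of_real (shifted \<gamma> \<beta> j)) (dPr k n r lam)))"

definition Q_const ::
    "nat \<Rightarrow> (nat \<Rightarrow> complex) \<Rightarrow> (nat \<Rightarrow> real \<Rightarrow> complex) \<Rightarrow> complex \<Rightarrow> (nat \<Rightarrow> complex) \<Rightarrow> real \<Rightarrow> real"
  where
  "Q_const n a r lam \<gamma> \<beta> =
     (\<Sum>j=1..n-1. \<Sum>i=2..n. \<Sum>k=0..i-2.
        alpha_tilde n \<gamma> j / cmod (Gam n \<gamma> j) * of_nat (i choose k) * cmod lam ^ k
        * (cmod (a i) / \<bar>shifted \<gamma> \<beta> j\<bar>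
           + supnorm (I_op (of_real (shifted \<gamma> \<beta> j)) (\<lambda>s. of_real (cmod (r i s))))))"

definition delta_crit ::
    "nat \<Rightarrow> (nat \<Rightarrow> complex) \<Rightarrow> (nat \<Rightarrow> real \<Rightarrow> complex) \<Rightarrow> complex \<Rightarrow> (nat \<Rightarrow> complex) \<Rightarrow> real"
  where
  "delta_crit n a r lam \<gamma> =
     (THE \<delta>. 0 < \<delta>
        \<and> (\<forall>d\<in>{0<..<\<delta>}. 0 < m_fun n d
              \<and> m_fun n d < (1 - L_const n r lam \<gamma> 0) / Q_const n a r lam \<gamma> 0)
        \<and> m_fun n \<delta> = (1 - L_const n r lam \<gamma> 0) / Q_const n a r lam \<gamma> 0)"

definition H_const ::
    "nat \<Rightarrow> (nat \<Rightarrow> real \<Rightarrow> complex) \<Rightarrow> complex \<Rightarrow> (nat \<Rightarrow> complex) \<Rightarrow> real" where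
  "H_const n r lam \<gamma> = supnorm (\<lambda>t. \<Sum>i=0..n-2. cmod (nderiv i (G_tot n \<gamma> (Pr n r lam)) t))"

text \<open>The maximum over the open interval is rendered as a supremum (Max is only meaningful for finite
  sets). It is attained: the function is continuous, positive inside the interval and vanishes at
  both end points.\<close>

definition H_bound ::
    "nat \<Rightarrow> (nat \<Rightarrow> complex) \<Rightarrow> (nat \<Rightarrow> real \<Rightarrow> complex) \<Rightarrow> complex \<Rightarrow> (nat \<Rightarrow> complex) \<Rightarrow> real"
  where
  "H_bound n a r lam \<gamma> =
     (SUP \<delta>\<in>{0<..<delta_crit n a r lam \<gamma>}.
        (1 - L_const n r lam \<gamma> 0 - m_fun n \<delta> * Q_const n a r lam \<gamma> 0) * \<delta>)"

definition solves_E ::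
    "nat \<Rightarrow> (nat \<Rightarrow> complex) \<Rightarrow> (nat \<Rightarrow> real \<Rightarrow> complex) \<Rightarrow> (real \<Rightarrow> complex) \<Rightarrow> bool" where
  "solves_E n a r y \<longleftrightarrow> times_differentiable n y \<and>
     (\<forall>t. nderiv n y t + (\<Sum>i=0..n-1. (a i + r i t) * nderiv i y t) = 0)"

end

theory Submission
  imports Defs "HOL-Library.Diagonal_Subsequence"
begin

text \<open>The substitution y'/y = lam + z turns the linear equation into the Riccati-type equation
  D z = - f(z), where f(z) denotes the full right-hand side. The roots of D being simple and off the
  imaginary axis, the Green operators invert D on bounded functions, and Lagrange interpolation at
  the roots shows that the derivatives of order i \<le> n - 2 of the result are the combinations of the
  functions G_j f with coefficients \<open>\<gamma> j\<close>^i / \<open>\<Gamma> j\<close>. On tuples (z, z', ...) of almost periodic functions the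
  resulting operator is a contraction with constant L_0 + m(\<open>\<delta>\<close>) Q_0 of the ball of radius \<open>\<delta>\<close> in
  the supremum of the l1-norm, where \<open>\<delta>\<close> maximizes (1 - L_0 - m(\<open>\<delta>\<close>) Q_0) \<open>\<delta>\<close>; the ball is invariant because
  the image of 0 has norm at most H. For the asymptotic estimates, a two-sided exponential average
  of the modulus of an almost periodic function is bounded away from 0 unless the function vanishes
  identically. Hence they follow from the boundedness of z and its derivatives, or else z = 0.\<close>

subsection \<open>Lagrange interpolation and Taylor coefficients\<close>

text \<open>Two obstacles shape the proof. First, the hypothesis on H involves a supremum over
  radii, and it yields a radius for the contraction only if that supremum is attained. This needs
  continuity of m, a function defined by difference quotients over open balls; it comes from
  comparing a ball with its dilations, under which the quotients of a polynomial change little.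
  Continuity also carries the Lipschitz bound over to closed balls, which contain the limits of the
  iterates. Second, the right-hand sides of the asymptotic estimates vanish identically when P(r;
  lam) does, so in that case the fixed point has to be the zero one. Bell polynomials enter because
  they express w^(i)/w in terms of z, z', ... when w' = z w; their linear parts B_i - f_(i-1) = x_i
  produce D and L, the remaining parts produce F.\<close>

lemma lagrange_interpolation:
  fixes \<gamma> :: "'i \<Rightarrow> 'a::field"
  assumes fin: "finite S" and inj: "inj_on \<gamma> S" and deg: "degree p < card S"
  shows "p = (\<Sum>j\<in>S. smult (poly p (\<gamma> j) / (\<Prod>k\<in>S-{j}. \<gamma> j - \<gamma> k)) (\<Prod>k\<in>S-{j}. [:- \<gamma> k, 1:]))"
    (is "p = ?q")
proof (rule ccontr)
  assume neq: "p \<noteq> ?q"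
  let ?d = "p - ?q"
  have S1: "card S \<ge> 1" using deg by linarith
  have degprod: "degree (\<Prod>k\<in>S-{j}. [:- \<gamma> k, 1:]) \<le> card S - 1" if "j \<in> S" for j
    using degree_prod_sum_le[of "S-{j}" "\<lambda>k. [:- \<gamma> k, 1:]"] fin that by (simp add: card_Diff_singleton)
  have "degree ?q \<le> card S - 1"
    by (intro degree_sum_le fin order_trans[OF degree_smult_le] degprod)
  then have dd: "degree ?d < card S"
    using deg S1 by (intro degree_diff_less) auto
  have root: "poly ?d (\<gamma> j) = 0" if j: "j \<in> S" for j
  proof -
    have "poly ?q (\<gamma> j) = (\<Sum>i\<in>S. poly p (\<gamma> i) / (\<Prod>k\<in>S-{i}. \<gamma> i - \<gamma> k) * (\<Prod>k\<in>S-{i}. \<gamma> j - \<gamma> k))"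
      by (simp add: poly_sum poly_prod algebra_simps)
    also have "\<dots> = (\<Sum>i\<in>S. if i = j then poly p (\<gamma> j) else 0)"
    proof (rule sum.cong[OF refl])
      fix i assume i: "i \<in> S"
      have "(\<Prod>k\<in>S-{j}. \<gamma> j - \<gamma> k) \<noteq> 0"
        using fin inj j by (auto simp: inj_on_def)
      moreover have "i \<noteq> j \<Longrightarrow> (\<Prod>k\<in>S-{i}. \<gamma> j - \<gamma> k) = 0"
        using fin j by auto
      ultimately show "poly p (\<gamma> i) / (\<Prod>k\<in>S-{i}. \<gamma> i - \<gamma> k) * (\<Prod>k\<in>S-{i}. \<gamma> j - \<gamma> k)
          = (if i = j then poly p (\<gamma> j) else 0)" by auto
    qed
    also have "\<dots> = poly p (\<gamma> j)" using fin j by simp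
    finally show ?thesis by simp
  qed
  have nz: "?d \<noteq> 0" using neq by simp
  have "card (\<gamma> ` S) \<le> card {x. poly ?d x = 0}"
    using root by (intro card_mono poly_roots_finite nz) blast
  also have "\<dots> \<le> degree ?d" by (rule card_poly_roots_bound[OF nz])
  finally show False using dd by (simp add: card_image[OF inj])
qed

text \<open>Compare the coefficients of degree \<open>card S - 1\<close> in the interpolation
  formula for x^i. This identity keeps the forcing term out of the derivatives of G[f] below order n
  - 1.\<close>

lemma sum_power_over_lagrange:
  fixes \<gamma> :: "'i \<Rightarrow> 'a::field"
  assumes fin: "finite S" and inj: "inj_on \<gamma> S" and i: "i < card S"
  shows "(\<Sum>j\<in>S. \<gamma> j ^ i / (\<Prod>k\<in>S-{j}. \<gamma> j - \<gamma> k)) = (if Suc i = card S then 1 else 0)"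
proof -
  have deg: "degree (monom (1::'a) i) < card S" using i by (simp add: degree_monom_eq)
  have c: "coeff (\<Prod>k\<in>S-{j}. [:- \<gamma> k, 1:]) (card S - 1) = 1" if "j \<in> S" for j
  proof -
    have d: "degree (\<Prod>k\<in>S-{j}. [:- \<gamma> k, 1:]) = card S - 1"
      using fin that by (subst degree_prod_eq_sum_degree) auto
    show ?thesis
      using lead_coeff_prod[of "\<lambda>k. [:- \<gamma> k, 1:]" "S-{j}"] unfolding d by simp
  qed
  have "coeff (monom (1::'a) i) (card S - 1)
      = (\<Sum>j\<in>S. \<gamma> j ^ i / (\<Prod>k\<in>S-{j}. \<gamma> j - \<gamma> k))"
    by (subst lagrange_interpolation[OF fin inj deg]) (auto simp: coeff_sum poly_monom c[simplified] intro!: sum.cong)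
  then show ?thesis using i by (auto split: if_splits)
qed

text \<open>The interpolation formula for the constant polynomial 1, evaluated at 0. For the n - 1
  roots of D it gives the factor in front of the integral in the formula for y.\<close>

lemma sum_inverse_over_lagrange:
  fixes \<gamma> :: "'i \<Rightarrow> 'a::field"
  assumes fin: "finite S" and inj: "inj_on \<gamma> S" and ne: "S \<noteq> {}" and nz: "\<And>j. j \<in> S \<Longrightarrow> \<gamma> j \<noteq> 0"
  shows "(\<Sum>j\<in>S. 1 / ((\<Prod>k\<in>S-{j}. \<gamma> j - \<gamma> k) * \<gamma> j)) = (-1) ^ Suc (card S) * (\<Prod>j\<in>S. inverse (\<gamma> j))"
proof -
  let ?P = "\<Prod>k\<in>S. - \<gamma> k"
  have deg: "degree (1::'a poly) < card S" using fin ne by (simp add: card_gt_0_iff)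
  have P: "(\<Prod>k\<in>S-{j}. - \<gamma> k) = - ?P / \<gamma> j" if "j \<in> S" for j
    using prod.remove[OF fin that, of "\<lambda>k. - \<gamma> k"] nz[OF that] by (simp add: field_simps)
  have "1 = poly 1 (0::'a)" by simp
  also have "\<dots> = (\<Sum>j\<in>S. (\<Prod>k\<in>S-{j}. - \<gamma> k) / (\<Prod>k\<in>S-{j}. \<gamma> j - \<gamma> k))"
    by (subst lagrange_interpolation[OF fin inj deg]) (simp add: poly_sum poly_prod)
  also have "\<dots> = (\<Sum>j\<in>S. - ?P * (1 / ((\<Prod>k\<in>S-{j}. \<gamma> j - \<gamma> k) * \<gamma> j)))"
    by (intro sum.cong refl) (simp add: P)
  finally have A: "- ?P * (\<Sum>j\<in>S. 1 / ((\<Prod>k\<in>S-{j}. \<gamma> j - \<gamma> k) * \<gamma> j)) = 1"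
    by (simp add: sum_distrib_left)
  have B: "- ?P * ((-1) ^ Suc (card S) * (\<Prod>j\<in>S. inverse (\<gamma> j))) = 1"
  proof -
    have "?P = (-1) ^ card S * (\<Prod>k\<in>S. \<gamma> k)"
      using prod.distrib[of "\<lambda>_. -1" \<gamma> S] by simp
    moreover have "(\<Prod>k\<in>S. \<gamma> k) * (\<Prod>j\<in>S. inverse (\<gamma> j)) = 1"
      using nz by (simp flip: prod.distrib)
    moreover have "((-1::'a) ^ card S) * (-1) ^ card S = 1"
      by (metis power_add power_minus1_even mult_2)
    ultimately show ?thesis
      by (simp add: algebra_simps) 
  qed
  have "- ?P \<noteq> 0" using nz fin by simp
  moreover note trans[OF A B[symmetric]]
  ultimately show ?thesis by (rule mult_left_cancel[THEN iffD1])
qed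

text \<open>These are the Taylor coefficients of P(c; .) at x. The same binomial sums arise when the
  derivatives of exp (lam t) w are collected, which is how D, L and F are recognized there.\<close>

lemma dP_over_fact:
  assumes "k \<le> n"
  shows "1 / fact k * dP k n c x = (\<Sum>j=0..n-k. of_nat ((k + j) choose j) * c (k + j) * x ^ j)"
proof -
  have co: "coeff (Ppoly n c) i = (if i \<le> n then c i else 0)" for i
    unfolding Ppoly_def by (simp add: coeff_sum)
  have deg: "degree ((pderiv ^^ k) (Ppoly n c)) \<le> n - k"
  proof (rule degree_le, intro allI impI)
    fix i assume "n - k < i"
    then show "coeff ((pderiv ^^ k) (Ppoly n c)) i = 0"
      by (simp add: coeff_higher_pderiv co)
  qed
  \<comment> \<open>Repeated differentiation of a polynomial produces rising factorials;
    (j+1)...(j+k) is k! times a binomial coefficient.\<close>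
  have fk: "pochhammer (of_nat (Suc j)) k = (fact k * of_nat ((k + j) choose j) :: complex)" for j
  proof -
    have "pochhammer (of_nat (Suc j)) k * (fact j :: complex) = fact (k + j)"
      using pochhammer_product[of j "j + k" "1::complex"]
      by (simp add: pochhammer_fact add.commute mult.commute)
    then show ?thesis
      by (simp add: binomial_fact field_simps)
  qed
  have "dP k n c x = (\<Sum>j\<le>n-k. coeff ((pderiv ^^ k) (Ppoly n c)) j * x ^ j)"
    unfolding dP_def unfolding poly_altdef using deg
    by (intro sum.mono_neutral_left) (auto simp: coeff_eq_0)
  also have "\<dots> = fact k * (\<Sum>j=0..n-k. of_nat ((k + j) choose j) * c (k + j) * x ^ j)"
    unfolding sum_distrib_left atMost_atLeast0 using assms
    by (intro sum.cong refl) (auto simp: coeff_higher_pderiv co fk add.commute simp del: of_nat_Suc)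
  finally show ?thesis by simp
qed

lemma D_charpoly_root:
  assumes "n \<ge> 1" "D_charpoly n a lam = (\<Prod>j=1..n-1. [:- \<gamma> j, 1:])" "j \<in> {1..n-1}"
  shows "(\<Sum>k=1..n. 1 / fact k * dP k n a lam * \<gamma> j ^ (k - 1)) = 0"
proof -
  have "poly (D_charpoly n a lam) (\<gamma> j) = 0"
    unfolding assms(2) using assms(3) by (auto simp: poly_prod)
  then show ?thesis by (simp add: D_charpoly_def poly_sum poly_monom)
qed

subsection \<open>Bell polynomials and the function m\<close>

lemma bell_cong: "(\<And>k. k \<in> {1..i} \<Longrightarrow> x k = y k) \<Longrightarrow> bell i x = bell i y"
proof (induction i rule: less_induct)
  case (less i)
  show ?case
  proof (cases i)
    case (Suc m)
    have "bell (m - j) x * x (j + 1) = bell (m - j) y * y (j + 1)" if "j \<le> m" for j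
      using less.IH[of "m - j"] less.prems Suc that by simp
    then show ?thesis unfolding Suc bell.simps
      by (intro sum.cong refl) (simp add: mult.assoc)
  qed simp
qed

text \<open>The cancelled summand is j = i. In all others the Bell factor has positive index and
  vanishes at 0, so f has neither a constant nor a linear part.\<close>

lemma f_bell_eq: "f_bell i x = (\<Sum>j<i. of_nat (i choose j) * bell (i - j) x * x (Suc j))"
  by (simp add: f_bell_def flip: lessThan_Suc_atMost)

lemma f_bell_cong: "(\<And>k. k \<in> {1..i} \<Longrightarrow> x k = y k) \<Longrightarrow> f_bell i x = f_bell i y"
  unfolding f_bell_eq
  by (intro sum.cong refl arg_cong2[where f="(*)"] bell_cong) auto

lemma bell_zero: "0 < i \<Longrightarrow> bell i (\<lambda>_. 0) = 0"
  by (cases i) auto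

lemma f_bell_zero: "f_bell i (\<lambda>_. 0) = 0"
  by (simp add: f_bell_eq)

text \<open>Being Lipschitz on the ball of radius R together with its dilations by s, with a Lipschitz
  constant of the increment under dilation that is of order s - 1. The latter is what makes the
  function m continuous.\<close>

definition dil_lipschitz :: "nat \<Rightarrow> real \<Rightarrow> real \<Rightarrow> ((nat \<Rightarrow> complex) \<Rightarrow> complex) \<Rightarrow> bool" where
  "dil_lipschitz N R K p \<longleftrightarrow> 0 \<le> K \<and> (\<forall>s X Y. 1 \<le> s \<and> s \<le> 2 \<and>
      (\<Sum>k=1..N. cmod (X k)) \<le> R \<and> (\<Sum>k=1..N. cmod (Y k)) \<le> R \<longrightarrow>
      cmod (p (\<lambda>k. of_real s * X k)) \<le> K \<and>
      cmod (p (\<lambda>k. of_real s * X k) - p (\<lambda>k. of_real s * Y k)) \<le> K * (\<Sum>k=1..N. cmod (X k - Y k)) \<and>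
      cmod (p (\<lambda>k. of_real s * X k) - p X) \<le> K * (s - 1) \<and>
      cmod (p (\<lambda>k. of_real s * X k) - p X - (p (\<lambda>k. of_real s * Y k) - p Y))
        \<le> K * ((s - 1) * (\<Sum>k=1..N. cmod (X k - Y k))))"

lemma dil_lipschitzD:
  assumes "dil_lipschitz N R K p" "1 \<le> s" "s \<le> 2"
    "(\<Sum>k=1..N. cmod (X k)) \<le> R" "(\<Sum>k=1..N. cmod (Y k)) \<le> R"
  shows "cmod (p (\<lambda>k. of_real s * X k)) \<le> K"
    "cmod (p (\<lambda>k. of_real s * X k) - p (\<lambda>k. of_real s * Y k)) \<le> K * (\<Sum>k=1..N. cmod (X k - Y k))"
    "cmod (p (\<lambda>k. of_real s * X k) - p X) \<le> K * (s - 1)"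
    "cmod (p (\<lambda>k. of_real s * X k) - p X - (p (\<lambda>k. of_real s * Y k) - p Y))
        \<le> K * ((s - 1) * (\<Sum>k=1..N. cmod (X k - Y k)))"
  using assms unfolding dil_lipschitz_def by blast+

lemma dil_lipschitzD1:
  assumes "dil_lipschitz N R K p"
    "(\<Sum>k=1..N. cmod (X k)) \<le> R" "(\<Sum>k=1..N. cmod (Y k)) \<le> R"
  shows "cmod (p X) \<le> K" "cmod (p X - p Y) \<le> K * (\<Sum>k=1..N. cmod (X k - Y k))"
  using dil_lipschitzD(1,2)[OF assms(1) _ _ assms(2,3), of 1] by auto

lemma dil_lipschitz_const: "dil_lipschitz N R (cmod c) (\<lambda>_. c)"
  by (auto simp: dil_lipschitz_def sum_nonneg)

text \<open>The constant 2R + 2 dominates four bounds at once: 2R for the value, s \<le> 2 for the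
  slope, R and 1 for the two increments under dilation.\<close>

lemma dil_lipschitz_coord:
  assumes k: "k \<in> {1..N}" and R: "0 \<le> R"
  shows "dil_lipschitz N R (2 * R + 2) (\<lambda>X. X k)"
  unfolding dil_lipschitz_def
proof (intro conjI allI impI; (elim conjE)?)
  fix s :: real and X Y :: "nat \<Rightarrow> complex"
  assume s: "1 \<le> s" "s \<le> 2" and X: "(\<Sum>k=1..N. cmod (X k)) \<le> R"
  let ?d = "\<Sum>k=1..N. cmod (X k - Y k)"
  have Xk: "cmod (X k) \<le> R" using member_le_sum[OF k, of "\<lambda>k. cmod (X k)"] X by simp
  have d: "cmod (X k - Y k) \<le> ?d" using member_le_sum[OF k, of "\<lambda>k. cmod (X k - Y k)"] by simp
  have d0: "0 \<le> ?d" by (simp add: sum_nonneg)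
  have "s * cmod (X k) \<le> 2 * R" using s Xk by (intro mult_mono) auto
  then show "cmod (of_real s * X k) \<le> 2 * R + 2" using s by (simp add: norm_mult)
  have "s * cmod (X k - Y k) \<le> (2 * R + 2) * ?d" using s R d d0 by (intro mult_mono) auto
  then show "cmod (of_real s * X k - of_real s * Y k) \<le> (2 * R + 2) * ?d"
    using s by (simp add: norm_mult flip: right_diff_distrib)
  have "(s - 1) * cmod (X k) \<le> (s - 1) * (2 * R + 2)" using s R Xk by (intro mult_left_mono) auto
  moreover have "of_real s * X k - X k = of_real (s - 1) * X k" by (simp add: algebra_simps)
  ultimately show "cmod (of_real s * X k - X k) \<le> (2 * R + 2) * (s - 1)"
    using s by (simp only: norm_mult norm_of_real) (simp add: mult.commute)
  have "1 * ((s - 1) * cmod (X k - Y k)) \<le> (2 * R + 2) * ((s - 1) * ?d)"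
    using s R d d0 by (intro mult_mono mult_left_mono) auto
  moreover have "of_real s * X k - X k - (of_real s * Y k - Y k) = of_real (s - 1) * (X k - Y k)"
    by (simp add: algebra_simps)
  ultimately show "cmod (of_real s * X k - X k - (of_real s * Y k - Y k)) \<le> (2 * R + 2) * ((s - 1) * ?d)"
    using s by (simp only: norm_mult norm_of_real)
qed (use R in auto)

lemma dil_lipschitz_add:
  assumes "dil_lipschitz N R K p" "dil_lipschitz N R K' q"
  shows "dil_lipschitz N R (K + K') (\<lambda>X. p X + q X)"
  unfolding dil_lipschitz_def
proof (intro conjI allI impI; (elim conjE)?)
  show "0 \<le> K + K'" using assms by (auto simp: dil_lipschitz_def)
next
  fix s :: real and X Y :: "nat \<Rightarrow> complex"
  assume s: "1 \<le> s" "s \<le> 2" and X: "(\<Sum>k=1..N. cmod (X k)) \<le> R" "(\<Sum>k=1..N. cmod (Y k)) \<le> R"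
  note p = dil_lipschitzD[OF assms(1) s X] and q = dil_lipschitzD[OF assms(2) s X]
  show "cmod (p (\<lambda>k. of_real s * X k) + q (\<lambda>k. of_real s * X k)) \<le> K + K'"
    using norm_triangle_mono[OF p(1) q(1)] .
  show "cmod (p (\<lambda>k. of_real s * X k) + q (\<lambda>k. of_real s * X k) -
          (p (\<lambda>k. of_real s * Y k) + q (\<lambda>k. of_real s * Y k))) \<le> (K + K') * (\<Sum>k=1..N. cmod (X k - Y k))"
    using norm_triangle_mono[OF p(2) q(2)] by (simp add: algebra_simps)
  show "cmod (p (\<lambda>k. of_real s * X k) + q (\<lambda>k. of_real s * X k) - (p X + q X)) \<le> (K + K') * (s - 1)"
    using norm_triangle_mono[OF p(3) q(3)] by (simp add: algebra_simps)
  show "cmod (p (\<lambda>k. of_real s * X k) + q (\<lambda>k. of_real s * X k) - (p X + q X)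
      - (p (\<lambda>k. of_real s * Y k) + q (\<lambda>k. of_real s * Y k) - (p Y + q Y)))
      \<le> (K + K') * ((s - 1) * (\<Sum>k=1..N. cmod (X k - Y k)))"
    using norm_triangle_mono[OF p(4) q(4)] by (simp add: algebra_simps)
qed

text \<open>The increment of a product in both directions, from Y to X and under dilation, splits
  into four products of increments of the factors. Each is at most K K' times (s - 1) times the
  distance; hence the 4.\<close>

lemma dil_lipschitz_mult:
  assumes "dil_lipschitz N R K p" "dil_lipschitz N R K' q"
  shows "dil_lipschitz N R (4 * K * K') (\<lambda>X. p X * q X)"
  unfolding dil_lipschitz_def
proof (intro conjI allI impI; (elim conjE)?)
  show "0 \<le> 4 * K * K'" using assms by (auto simp: dil_lipschitz_def)
next
  fix s :: real and X Y :: "nat \<Rightarrow> complex"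
  assume s: "1 \<le> s" "s \<le> 2" and X: "(\<Sum>k=1..N. cmod (X k)) \<le> R" "(\<Sum>k=1..N. cmod (Y k)) \<le> R"
  have K: "0 \<le> K" "0 \<le> K'" using assms by (auto simp: dil_lipschitz_def)
  define d where "d = (\<Sum>k=1..N. cmod (X k - Y k))"
  have d0: "0 \<le> d" by (simp add: d_def sum_nonneg)
  note p = dil_lipschitzD[OF assms(1) s X, folded d_def]
    and q = dil_lipschitzD[OF assms(2) s X, folded d_def]
    and p1 = dil_lipschitzD1[OF assms(1) X, folded d_def]
    and q1 = dil_lipschitzD1[OF assms(2) X, folded d_def]
    and p' = dil_lipschitzD[OF assms(1) s X(2,1)] and q' = dil_lipschitzD[OF assms(2) s X(2,1)]
    and q2 = dil_lipschitzD1[OF assms(2) X(2,1)]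
  let ?p = "p (\<lambda>k. of_real s * X k)" and ?q = "q (\<lambda>k. of_real s * X k)"
    and ?p' = "p (\<lambda>k. of_real s * Y k)" and ?q' = "q (\<lambda>k. of_real s * Y k)"
  have M: "cmod (u * v) \<le> A * B" if "cmod u \<le> A" "cmod v \<le> B" for u v A B
    unfolding norm_mult using that by (intro mult_mono order_trans[OF norm_ge_zero that(1)]) auto
  have KK: "0 \<le> K * K'" using K by simp
  show "cmod (?p * ?q) \<le> 4 * K * K'"
    using M[OF p(1) q(1)] KK by simp
  have KKd: "0 \<le> K * K' * d" using KK d0 by simp
  have "?p * ?q - ?p' * ?q' = ?p * (?q - ?q') + (?p - ?p') * ?q'" by (simp add: algebra_simps)
  also have "cmod \<dots> \<le> K * (K' * d) + K * d * K'"
    by (rule norm_triangle_mono[OF M[OF p(1) q(2)] M[OF p(2) q'(1)]])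
  also have "\<dots> \<le> 4 * K * K' * d" using KKd by (simp add: algebra_simps)
  finally show "cmod (?p * ?q - ?p' * ?q') \<le> 4 * K * K' * (\<Sum>k=1..N. cmod (X k - Y k))"
    unfolding d_def .
  have KKs: "0 \<le> K * K' * (s - 1)" using KK s by simp
  have "?p * ?q - p X * q X = ?p * (?q - q X) + (?p - p X) * q X" by (simp add: algebra_simps)
  also have "cmod \<dots> \<le> K * (K' * (s - 1)) + K * (s - 1) * K'"
    by (rule norm_triangle_mono[OF M[OF p(1) q(3)] M[OF p(3) q1(1)]])
  also have "\<dots> \<le> 4 * K * K' * (s - 1)" using KKs by (simp only: mult_ac)
  finally show "cmod (?p * ?q - p X * q X) \<le> 4 * K * K' * (s - 1)" .
  have "?p * ?q - p X * q X - (?p' * ?q' - p Y * q Y)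
    = (?p * (?q - q X - (?q' - q Y)) + (?p - ?p') * (?q' - q Y))
    + ((?p - p X) * (q X - q Y) + (?p - p X - (?p' - p Y)) * q Y)"
    by (simp add: algebra_simps)
  also have "cmod \<dots> \<le> K * (K' * ((s - 1) * d)) + K * d * (K' * (s - 1))
      + (K * (s - 1) * (K' * d) + K * ((s - 1) * d) * K')"
    by (rule norm_triangle_mono[OF norm_triangle_mono[OF M[OF p(1) q(4)] M[OF p(2) q'(3)]]
      norm_triangle_mono[OF M[OF p(3) q1(2)] M[OF p(4) q2(1)]]])
  also have "\<dots> = 4 * K * K' * ((s - 1) * d)" by (simp add: algebra_simps)
  finally show "cmod (?p * ?q - p X * q X - (?p' * ?q' - p Y * q Y))
      \<le> 4 * K * K' * ((s - 1) * (\<Sum>k=1..N. cmod (X k - Y k)))"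
    unfolding d_def .
qed

lemma dil_lipschitz_sum:
  assumes "finite A" "\<And>j. j \<in> A \<Longrightarrow> \<exists>K. dil_lipschitz N R K (p j)"
  shows "\<exists>K. dil_lipschitz N R K (\<lambda>X. \<Sum>j\<in>A. p j X)"
  using assms
proof (induction A)
  case empty
  then show ?case using dil_lipschitz_const[of N R 0] by auto
next
  case (insert x F)
  then have "\<exists>K. dil_lipschitz N R K (p x)" "\<exists>K. dil_lipschitz N R K (\<lambda>X. \<Sum>j\<in>F. p j X)"
    by blast+
  then obtain K K' where "dil_lipschitz N R K (p x)" "dil_lipschitz N R K' (\<lambda>X. \<Sum>j\<in>F. p j X)"
    by blast
  from dil_lipschitz_add[OF this] insert show ?case by auto
qed

lemma dil_lipschitz_mult_ex:
  "\<exists>K. dil_lipschitz N R K p \<Longrightarrow> \<exists>K. dil_lipschitz N R K q \<Longrightarrow> \<exists>K. dil_lipschitz N R K (\<lambda>X. p X * q X)"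
  using dil_lipschitz_mult by blast

lemma dil_lipschitz_const_ex: "\<exists>K. dil_lipschitz N R K (\<lambda>_. c)"
  using dil_lipschitz_const by blast

lemma dil_lipschitz_coord_ex: "k \<in> {1..N} \<Longrightarrow> 0 \<le> R \<Longrightarrow> \<exists>K. dil_lipschitz N R K (\<lambda>X. X k)"
  using dil_lipschitz_coord by blast

lemma dil_lipschitz_bell:
  assumes "0 \<le> R" shows "i \<le> N \<Longrightarrow> \<exists>K. dil_lipschitz N R K (bell i)"
proof (induction i rule: less_induct)
  case (less i)
  show ?case
  proof (cases i)
    case 0
    then show ?thesis using dil_lipschitz_const[of N R 1] by (auto simp: fun_eq_iff)
  next
    case (Suc m)
    have eq: "bell i = (\<lambda>x. \<Sum>j\<le>m. of_nat (m choose j) * bell (m - j) x * x (j + 1))"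
      unfolding Suc by (simp add: fun_eq_iff)
    show ?thesis unfolding eq
      using less Suc
      by (intro dil_lipschitz_sum dil_lipschitz_mult_ex dil_lipschitz_const_ex
          dil_lipschitz_coord_ex assms) auto
  qed
qed

lemma dil_lipschitz_f_bell:
  assumes "0 \<le> R" shows "\<exists>K. dil_lipschitz i R K (f_bell i)"
proof -
  have eq: "f_bell i = (\<lambda>x. \<Sum>j<i. of_nat (i choose j) * bell (i - j) x * x (Suc j))"
    by (simp add: fun_eq_iff f_bell_eq)
  show ?thesis unfolding eq
    by (intro dil_lipschitz_sum dil_lipschitz_mult_ex dil_lipschitz_const_ex
        dil_lipschitz_coord_ex assms dil_lipschitz_bell[OF assms]) auto
qed

text \<open>Each summand of \<open>f_bell_eq\<close> is a Bell factor vanishing at 0 times a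
  coordinate. Both are O(\<delta>) on the ball, so the difference gains a factor \<delta>. This
  gives the continuity of m at 0.\<close>

lemma f_bell_lipschitz_small:
  "\<exists>K\<ge>0. \<forall>\<delta>\<le>1. \<forall>X Y. (\<Sum>k=1..i. cmod (X k)) \<le> \<delta> \<and> (\<Sum>k=1..i. cmod (Y k)) \<le> \<delta> \<longrightarrow>
     cmod (f_bell i X - f_bell i Y) \<le> K * \<delta> * (\<Sum>k=1..i. cmod (X k - Y k))"
proof -
  have "\<forall>k. \<exists>K. k \<le> i \<longrightarrow> dil_lipschitz i 1 K (bell k)" using dil_lipschitz_bell[of 1] by auto
  then obtain K where K: "\<And>k. k \<le> i \<Longrightarrow> dil_lipschitz i 1 (K k) (bell k)" by metis
  then have K0: "0 \<le> K k" if "k \<le> i" for k using that by (auto simp: dil_lipschitz_def)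
  let ?C = "\<Sum>j<i. real (i choose j) * (2 * K (i - j))"
  have C0: "0 \<le> ?C" using K0 by (intro sum_nonneg) auto
  have "cmod (f_bell i X - f_bell i Y) \<le> ?C * \<delta> * (\<Sum>k=1..i. cmod (X k - Y k))"
    if \<delta>: "\<delta> \<le> 1" and X: "(\<Sum>k=1..i. cmod (X k)) \<le> \<delta>" and Y: "(\<Sum>k=1..i. cmod (Y k)) \<le> \<delta>" for \<delta> X Y
  proof -
    define d where "d = (\<Sum>k=1..i. cmod (X k - Y k))"
    have d0: "0 \<le> d" by (simp add: d_def sum_nonneg)
    have \<delta>0: "0 \<le> \<delta>" by (rule order_trans[OF _ X]) (simp add: sum_nonneg)
    have "f_bell i X - f_bell i Y = (\<Sum>j<i. of_nat (i choose j) *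
        (bell (i - j) X * (X (Suc j) - Y (Suc j)) + (bell (i - j) X - bell (i - j) Y) * Y (Suc j)))"
      unfolding f_bell_eq sum_subtractf[symmetric] by (intro sum.cong refl) (simp add: algebra_simps)
    also have "cmod \<dots> \<le> (\<Sum>j<i. real (i choose j) * (2 * K (i - j) * \<delta> * d))"
    proof (rule sum_norm_le)
      fix j assume "j \<in> {..<i}"
      then have j: "Suc j \<in> {1..i}" "i - j \<le> i" "0 < i - j" by auto
      note k = K[OF j(2)] and k0 = K0[OF j(2)]
      have Xj: "cmod (X (Suc j) - Y (Suc j)) \<le> d"
        using member_le_sum[OF j(1), of "\<lambda>k. cmod (X k - Y k)"] by (simp add: d_def)
      have Yj: "cmod (Y (Suc j)) \<le> \<delta>"
        using member_le_sum[OF j(1), of "\<lambda>k. cmod (Y k)"] Y by simp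
      \<comment> \<open>Comparison with the origin, where a Bell polynomial of positive index
        vanishes.\<close>
      have "cmod (bell (i - j) X) \<le> K (i - j) * (\<Sum>k=1..i. cmod (X k))"
        using dil_lipschitzD1(2)[OF k, of X "\<lambda>_. 0"] X \<delta> bell_zero[OF j(3)] by simp
      also have "\<dots> \<le> K (i - j) * \<delta>" using X k0 by (rule mult_left_mono)
      finally have b: "cmod (bell (i - j) X) \<le> K (i - j) * \<delta>" .
      have "cmod (bell (i - j) X - bell (i - j) Y) \<le> K (i - j) * d"
        using dil_lipschitzD1(2)[OF k, of X Y] X Y \<delta> by (simp add: d_def)
      then have "cmod ((bell (i - j) X - bell (i - j) Y) * Y (Suc j)) \<le> (K (i - j) * d) * \<delta>"
        using Yj d0 k0 unfolding norm_mult by (intro mult_mono) auto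
      moreover have "cmod (bell (i - j) X * (X (Suc j) - Y (Suc j))) \<le> (K (i - j) * \<delta>) * d"
        using b Xj \<delta>0 k0 unfolding norm_mult by (intro mult_mono) auto
      moreover have "K (i - j) * \<delta> * d + K (i - j) * d * \<delta> = 2 * K (i - j) * \<delta> * d"
        by (simp add: algebra_simps)
      ultimately have "cmod (bell (i - j) X * (X (Suc j) - Y (Suc j)) + (bell (i - j) X - bell (i - j) Y) * Y (Suc j))
          \<le> 2 * K (i - j) * \<delta> * d"
        by (metis add_mono norm_triangle_le)
      then show "cmod (of_nat (i choose j) *
        (bell (i - j) X * (X (Suc j) - Y (Suc j)) + (bell (i - j) X - bell (i - j) Y) * Y (Suc j)))
        \<le> real (i choose j) * (2 * K (i - j) * \<delta> * d)"
        by (simp only: norm_mult norm_of_nat mult_left_mono of_nat_0_le_iff)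
    qed
    finally show ?thesis by (simp add: d_def sum_distrib_right mult.assoc)
  qed
  with C0 show ?thesis by blast
qed

section \<open>The Lipschitz modulus m: bounds, monotonicity, continuity\<close>

lemma l1_ball_dist_pos:
  assumes "X \<in> l1_ball i \<delta>" "Y \<in> l1_ball i \<delta>" "X \<noteq> Y"
  shows "0 < (\<Sum>k=1..i. cmod (X k - Y k))"
proof -
  obtain k where k: "X k \<noteq> Y k" using assms(3) by auto
  have "k \<in> {1..i}"
  proof (rule ccontr)
    assume "k \<notin> {1..i}"
    then have "X k = 0" "Y k = 0" using assms(1,2) unfolding l1_ball_def by blast+
    with k show False by simp
  qed
  then show ?thesis using k by (intro sum_pos2[where i=k]) auto
qed

lemma f_bell_le_m_idx:
  assumes "X \<in> l1_ball i \<delta>" "Y \<in> l1_ball i \<delta>"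
  shows "cmod (f_bell i X - f_bell i Y) \<le> m_idx i \<delta> * (\<Sum>k=1..i. cmod (X k - Y k))"
proof (cases "X = Y")
  case False
  let ?S = "{cmod (f_bell i X - f_bell i Y) / (\<Sum>k=1..i. cmod (X k - Y k)) | X Y.
                     X \<in> l1_ball i \<delta> \<and> Y \<in> l1_ball i \<delta> \<and> X \<noteq> Y}"
  have "0 < \<delta>" using assms(1) le_less_trans[of 0 "\<Sum>k=1..i. cmod (X k)" \<delta>]
    by (auto simp: l1_ball_def sum_nonneg)
  then obtain K where K: "dil_lipschitz i \<delta> K (f_bell i)"
    using dil_lipschitz_f_bell[of \<delta>] by auto
  \<comment> \<open>Without boundedness the real supremum in \<open>m_idx\<close> would carry no
    information.\<close>
  have "bdd_above ?S"
  proof (rule bdd_aboveI[of _ K])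
    fix x assume "x \<in> ?S"
    then obtain X Y where x: "x = cmod (f_bell i X - f_bell i Y) / (\<Sum>k=1..i. cmod (X k - Y k))"
      and XY: "X \<in> l1_ball i \<delta>" "Y \<in> l1_ball i \<delta>" "X \<noteq> Y" by blast
    have "cmod (f_bell i X - f_bell i Y) \<le> K * (\<Sum>k=1..i. cmod (X k - Y k))"
      using XY by (intro dil_lipschitzD1(2)[OF K]) (auto simp: l1_ball_def)
    with l1_ball_dist_pos[OF XY] show "x \<le> K" unfolding x by (simp add: divide_le_eq)
  qed
  then have "cmod (f_bell i X - f_bell i Y) / (\<Sum>k=1..i. cmod (X k - Y k)) \<le> m_idx i \<delta>"
    unfolding m_idx_def using assms False by (intro cSup_upper) blast+
  then show ?thesis using l1_ball_dist_pos[OF assms False] by (simp add: divide_le_eq)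
qed simp

lemma m_idx_le:
  assumes "0 < \<delta>" "1 \<le> i"
    "\<And>X Y. X \<in> l1_ball i \<delta> \<Longrightarrow> Y \<in> l1_ball i \<delta> \<Longrightarrow>
        cmod (f_bell i X - f_bell i Y) \<le> C * (\<Sum>k=1..i. cmod (X k - Y k))"
  shows "m_idx i \<delta> \<le> C"
  unfolding m_idx_def
proof (rule cSup_least)
  \<comment> \<open>Two distinct points of the ball, so that the set of quotients is nonempty;
    coordinate 1 exists because \<open>1 \<le> i\<close>.\<close>
  have "(\<lambda>k. if k = 1 then of_real (\<delta> / 2) else 0) \<in> l1_ball i \<delta>" "(\<lambda>_. 0) \<in> l1_ball i \<delta>"
    using assms(1,2) by (auto simp: l1_ball_def if_distrib[of cmod] cong: if_cong)
  moreover have "(\<lambda>k::nat. if k = 1 then of_real (\<delta> / 2) else 0) \<noteq> (\<lambda>_. 0 :: complex)"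
    using assms(1) by (auto simp: fun_eq_iff)
  ultimately show "{cmod (f_bell i X - f_bell i Y) / (\<Sum>k=1..i. cmod (X k - Y k)) | X Y.
                     X \<in> l1_ball i \<delta> \<and> Y \<in> l1_ball i \<delta> \<and> X \<noteq> Y} \<noteq> {}" by blast
qed (use assms(3) l1_ball_dist_pos in \<open>auto simp: divide_le_eq\<close>)

text \<open>The polynomial f_2 = x_1^3 + 3 x_1 x_2 has slope 3 x_1 in its second variable, and x_1
  may approach \<delta>. The bound makes m positive, makes it reach every positive level, and
  dominates the slope of f_1.\<close>

lemma m_idx_2_ge: assumes "0 < \<delta>" shows "3 * \<delta> \<le> m_idx 2 \<delta>"
proof (rule dense_le_bounded[of 0])
  fix v assume v: "0 < v" "v < 3 * \<delta>"
  \<comment> \<open>The quotient for the points (u, w) and (u, 0) is 3u = v; w is half of the room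
    that the ball leaves.\<close>
  define u where "u = v / 3"
  define w where "w = (\<delta> - u) / 2"
  have uw: "0 < u" "u < \<delta>" "0 < w" "u + w < \<delta>" using v by (auto simp: u_def w_def field_simps)
  define X :: "nat \<Rightarrow> complex" where "X = (\<lambda>k. if k = 1 then of_real u else if k = 2 then of_real w else 0)"
  define Y :: "nat \<Rightarrow> complex" where "Y = (\<lambda>k. if k = 1 then of_real u else 0)"
  have two: "{1..2::nat} = {1,2}" by auto
  have "X \<in> l1_ball 2 \<delta>" "Y \<in> l1_ball 2 \<delta>"
    using uw unfolding l1_ball_def two by (auto simp: X_def Y_def)
  from f_bell_le_m_idx[OF this]
  have "cmod (f_bell 2 X - f_bell 2 Y) \<le> m_idx 2 \<delta> * w"
    unfolding two using uw by (simp add: X_def Y_def)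
  moreover have "f_bell 2 X - f_bell 2 Y = of_real (3 * u * w)"
    by (simp add: f_bell_eq X_def Y_def lessThan_Suc numeral_2_eq_2 algebra_simps)
  ultimately have "3 * u * w \<le> m_idx 2 \<delta> * w" using uw by (simp del: of_real_mult)
  then show "v \<le> m_idx 2 \<delta>" using uw by (simp add: u_def)
qed (use assms in simp)

lemma m_fun_eq: "0 < \<delta> \<Longrightarrow> m_fun n \<delta> = Max ((\<lambda>i. m_idx i \<delta>) ` {2..n})"
  by (simp add: m_fun_def)

lemma m_idx_le_m_fun: "0 < \<delta> \<Longrightarrow> i \<in> {2..n} \<Longrightarrow> m_idx i \<delta> \<le> m_fun n \<delta>"
  by (simp add: m_fun_eq)

lemma m_fun_ge: "n \<ge> 2 \<Longrightarrow> 0 < \<delta> \<Longrightarrow> 3 * \<delta> \<le> m_fun n \<delta>"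
  using m_idx_2_ge[of \<delta>] m_idx_le_m_fun[of \<delta> 2 n] by simp

lemma m_fun_le:
  assumes "n \<ge> 2" "0 < \<delta>"
    "\<And>i X Y. i \<in> {2..n} \<Longrightarrow> X \<in> l1_ball i \<delta> \<Longrightarrow> Y \<in> l1_ball i \<delta> \<Longrightarrow>
        cmod (f_bell i X - f_bell i Y) \<le> C * (\<Sum>k=1..i. cmod (X k - Y k))"
  shows "m_fun n \<delta> \<le> C"
  unfolding m_fun_eq[OF assms(2)] using assms by (intro Max.boundedI) (auto intro!: m_idx_le)

text \<open>\<open>F_op\<close> evaluates f_1, ..., f_(n-1), whereas the maximum defining m starts
  at index 2. For f_1(x) = x^2 the slope is at most 2\<delta>, which lies below 3\<delta> \<le>
  m(\<delta>).\<close>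

lemma f_bell_le_m_fun_open:
  assumes "n \<ge> 2" "i \<in> {1..n}" "X \<in> l1_ball i \<delta>" "Y \<in> l1_ball i \<delta>"
  shows "cmod (f_bell i X - f_bell i Y) \<le> m_fun n \<delta> * (\<Sum>k=1..i. cmod (X k - Y k))"
proof -
  have \<delta>: "0 < \<delta>" using assms(3) le_less_trans[of 0 "\<Sum>k=1..i. cmod (X k)" \<delta>]
    by (auto simp: l1_ball_def sum_nonneg)
  have d0: "0 \<le> (\<Sum>k=1..i. cmod (X k - Y k))" by (simp add: sum_nonneg)
  show ?thesis
  proof (cases "i = 1")
    case True
    have "f_bell i X - f_bell i Y = (X 1 + Y 1) * (X 1 - Y 1)"
      unfolding True by (simp add: f_bell_eq algebra_simps)
    moreover have "cmod (X 1 + Y 1) \<le> 2 * \<delta>"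
      using assms(3,4) norm_triangle_mono[of "X 1" \<delta> "Y 1" \<delta>] unfolding True by (simp add: l1_ball_def)
    moreover have "2 * \<delta> \<le> m_fun n \<delta>" using m_fun_ge[OF assms(1) \<delta>] \<delta> by simp
    ultimately show ?thesis unfolding True by (simp add: norm_mult mult_right_mono)
  next
    case False
    then have "m_idx i \<delta> \<le> m_fun n \<delta>" using assms(2) \<delta> by (intro m_idx_le_m_fun) auto
    from mult_right_mono[OF this d0] f_bell_le_m_idx[OF assms(3,4)] show ?thesis by linarith
  qed
qed

lemma m_fun_mono:
  assumes "n \<ge> 2" "0 < \<delta>" "\<delta> \<le> \<delta>'" shows "m_fun n \<delta> \<le> m_fun n \<delta>'"
  using assms(1,2)
proof (rule m_fun_le)
  fix i X Y assume "i \<in> {2..n}" "X \<in> l1_ball i \<delta>" "Y \<in> l1_ball i \<delta>"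
  then show "cmod (f_bell i X - f_bell i Y) \<le> m_fun n \<delta>' * (\<Sum>k=1..i. cmod (X k - Y k))"
    using assms(3) by (intro f_bell_le_m_fun_open[OF assms(1)]) (auto simp: l1_ball_def)
qed

text \<open>Points of the larger ball are s X' and s Y' with X', Y' in the smaller one. Their
  difference of values is the one at X', Y' plus a mixed increment of order s - 1, while the
  distance only grows, from |X' - Y'| to s |X' - Y'|.\<close>

lemma m_fun_dilate:
  assumes "n \<ge> 2" "0 < R"
  shows "\<exists>K\<ge>0. \<forall>\<delta> s. 0 < \<delta> \<and> \<delta> \<le> R \<and> 1 \<le> s \<and> s \<le> 2 \<longrightarrow> m_fun n (s * \<delta>) \<le> m_fun n \<delta> + K * (s - 1)"
proof -
  have "\<forall>i. \<exists>K. dil_lipschitz i R K (f_bell i)" using dil_lipschitz_f_bell assms(2) by auto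
  then obtain K where K: "\<And>i. dil_lipschitz i R (K i) (f_bell i)" by metis
  then have K0: "\<And>i. 0 \<le> K i" by (auto simp: dil_lipschitz_def)
  let ?C = "\<Sum>i=2..n. K i"
  have "m_fun n (s * \<delta>) \<le> m_fun n \<delta> + ?C * (s - 1)"
    if \<delta>: "0 < \<delta>" "\<delta> \<le> R" and s: "1 \<le> s" "s \<le> 2" for \<delta> s
  proof (rule m_fun_le)
    fix i X Y assume i: "i \<in> {2..n}" and X: "X \<in> l1_ball i (s * \<delta>)" and Y: "Y \<in> l1_ball i (s * \<delta>)"
    define X' where "X' = (\<lambda>k. X k / of_real s)"
    define Y' where "Y' = (\<lambda>k. Y k / of_real s)"
    have XX: "X = (\<lambda>k. of_real s * X' k)" "Y = (\<lambda>k. of_real s * Y' k)"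
      using s by (auto simp: X'_def Y'_def)
    have B: "X' \<in> l1_ball i \<delta>" "Y' \<in> l1_ball i \<delta>"
    proof -
      have "(\<Sum>k=1..i. cmod (X' k)) = (\<Sum>k=1..i. cmod (X k)) / s"
        "(\<Sum>k=1..i. cmod (Y' k)) = (\<Sum>k=1..i. cmod (Y k)) / s"
        using s by (simp_all add: X'_def Y'_def norm_divide sum_divide_distrib)
      then show "X' \<in> l1_ball i \<delta>" "Y' \<in> l1_ball i \<delta>"
        using X Y s by (simp_all add: l1_ball_def X'_def Y'_def divide_less_eq mult.commute)
    qed
    then have R: "(\<Sum>k=1..i. cmod (X' k)) \<le> R" "(\<Sum>k=1..i. cmod (Y' k)) \<le> R"
      using \<delta> by (auto simp: l1_ball_def)
    define d where "d = (\<Sum>k=1..i. cmod (X' k - Y' k))"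
    have d0: "0 \<le> d" by (simp add: d_def sum_nonneg)
    have KC: "K i \<le> ?C" using i K0 by (intro member_le_sum) auto
    have "cmod (f_bell i X - f_bell i Y)
        \<le> cmod (f_bell i X' - f_bell i Y') + cmod (f_bell i X - f_bell i X' - (f_bell i Y - f_bell i Y'))"
      by (rule order_trans[OF _ norm_triangle_ineq]) (simp add: algebra_simps)
    also have "\<dots> \<le> m_fun n \<delta> * d + K i * ((s - 1) * d)"
    proof (rule add_mono)
      show "cmod (f_bell i X' - f_bell i Y') \<le> m_fun n \<delta> * d"
        unfolding d_def using i by (intro f_bell_le_m_fun_open[OF assms(1) _ B]) auto
      show "cmod (f_bell i X - f_bell i X' - (f_bell i Y - f_bell i Y')) \<le> K i * ((s - 1) * d)"
        unfolding d_def XX by (rule dil_lipschitzD(4)[OF K s R])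
    qed
    also have "\<dots> \<le> (m_fun n \<delta> + ?C * (s - 1)) * d"
      using mult_right_mono[OF KC, of "(s - 1) * d"] s d0
        unfolding distrib_right mult.assoc by simp
    also have "\<dots> \<le> (m_fun n \<delta> + ?C * (s - 1)) * (s * d)"
    proof (rule mult_left_mono)
      show "d \<le> s * d" using s d0 by (simp add: mult_le_cancel_right1)
      have "0 \<le> ?C" using K0 by (intro sum_nonneg) auto
      then show "0 \<le> m_fun n \<delta> + ?C * (s - 1)" using m_fun_ge[OF assms(1) \<delta>(1)] \<delta> s by simp
    qed
    also have "s * d = (\<Sum>k=1..i. cmod (X k - Y k))"
      using s by (simp add: d_def sum_distrib_left XX norm_mult flip: right_diff_distrib)
    finally show "cmod (f_bell i X - f_bell i Y) \<le> (m_fun n \<delta> + ?C * (s - 1)) * (\<Sum>k=1..i. cmod (X k - Y k))" .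
  qed (use assms \<delta> s in auto)
  moreover have "0 \<le> ?C" using K0 by (intro sum_nonneg) auto
  ultimately show ?thesis by blast
qed

lemma m_fun_small:
  assumes "n \<ge> 2"
  shows "\<exists>K\<ge>0. \<forall>\<delta>. 0 < \<delta> \<and> \<delta> \<le> 1 \<longrightarrow> m_fun n \<delta> \<le> K * \<delta>"
proof -
  from f_bell_lipschitz_small obtain K where K0: "\<And>i. 0 \<le> K i" and
    K: "\<And>i \<delta> X Y. \<delta> \<le> 1 \<Longrightarrow> (\<Sum>k=1..i. cmod (X k)) \<le> \<delta> \<Longrightarrow> (\<Sum>k=1..i. cmod (Y k)) \<le> \<delta> \<Longrightarrow>
     cmod (f_bell i X - f_bell i Y) \<le> K i * \<delta> * (\<Sum>k=1..i. cmod (X k - Y k))"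
    by metis
  let ?C = "\<Sum>i=2..n. K i"
  have "m_fun n \<delta> \<le> ?C * \<delta>" if \<delta>: "0 < \<delta>" "\<delta> \<le> 1" for \<delta>
  proof (rule m_fun_le[OF assms \<delta>(1)])
    fix i X Y assume i: "i \<in> {2..n}" and X: "X \<in> l1_ball i \<delta>" and Y: "Y \<in> l1_ball i \<delta>"
    have KC: "K i \<le> ?C" using i K0 by (intro member_le_sum) auto
    have "cmod (f_bell i X - f_bell i Y) \<le> K i * \<delta> * (\<Sum>k=1..i. cmod (X k - Y k))"
      using X Y by (intro K \<delta>) (auto simp: l1_ball_def)
    also have "\<dots> \<le> ?C * \<delta> * (\<Sum>k=1..i. cmod (X k - Y k))"
      using KC \<delta> by (intro mult_right_mono) (auto simp: sum_nonneg)
    finally show "cmod (f_bell i X - f_bell i Y) \<le> ?C * \<delta> * (\<Sum>k=1..i. cmod (X k - Y k))" .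
  qed
  moreover have "0 \<le> ?C" using K0 by (intro sum_nonneg) auto
  ultimately show ?thesis by blast
qed

text \<open>At 0 this is \<open>m_fun_small\<close>. Near x > 0 the function m is increasing, and
  the radius v is the dilation of u by v/u, so \<open>m_fun_dilate\<close> makes m Lipschitz
  there.\<close>

lemma continuous_on_m_fun:
  assumes n: "n \<ge> 2" shows "continuous_on {0..} (m_fun n)"
  unfolding continuous_on
proof
  fix x :: real assume "x \<in> {0..}"
  show "(m_fun n \<longlongrightarrow> m_fun n x) (at x within {0..})"
  proof (cases "x = 0")
    case True
    obtain K where "0 \<le> K" and K: "\<And>\<delta>. 0 < \<delta> \<Longrightarrow> \<delta> \<le> 1 \<Longrightarrow> m_fun n \<delta> \<le> K * \<delta>"
      using m_fun_small[OF n] by blast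
    have "\<forall>\<^sub>F \<delta> in at 0 within {0..}. norm (m_fun n \<delta>) \<le> K * \<delta>"
      unfolding eventually_at
    proof (intro exI[of _ 1] conjI ballI impI)
      fix \<delta> :: real assume "\<delta> \<in> {0..}" "\<delta> \<noteq> 0 \<and> dist \<delta> 0 < 1"
      then show "norm (m_fun n \<delta>) \<le> K * \<delta>" using K[of \<delta>] m_fun_ge[OF n, of \<delta>] by auto
    qed simp
    moreover have "((\<lambda>\<delta>. K * \<delta>) \<longlongrightarrow> 0) (at 0 within {0..})"
      by (rule tendsto_eq_intros refl | simp)+
    ultimately show ?thesis unfolding True by (auto simp: m_fun_def[of n 0] intro: Lim_null_comparison)
  next
    case False
    with \<open>x \<in> {0..}\<close> have x: "0 < x" by simp
    obtain K where K0: "0 \<le> K" and K: "\<And>\<delta> s. 0 < \<delta> \<Longrightarrow> \<delta> \<le> x \<Longrightarrow> 1 \<le> s \<Longrightarrow> s \<le> 2 \<Longrightarrow>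
       m_fun n (s * \<delta>) \<le> m_fun n \<delta> + K * (s - 1)"
      using m_fun_dilate[OF n x] by blast
    \<comment> \<open>Here s - 1 = (v - u)/u, and u > x/2 bounds it by 2 (v - u)/x. The condition v
      \<le> 2u is the restriction s \<le> 2.\<close>
    have step: "m_fun n v - m_fun n u \<le> 2 * K / x * (v - u)" if "x / 2 < u" "u \<le> v" "u \<le> x" "v \<le> 2 * u" for u v
    proof -
      have u: "0 < u" using that x by simp
      have "m_fun n v - m_fun n u \<le> K * (v / u - 1)"
        using K[of u "v / u"] u that by (simp add: field_simps)
      also have "v / u - 1 = (v - u) / u" using u by (simp add: field_simps)
      also have "K * ((v - u) / u) \<le> K * ((v - u) / (x / 2))"
        using K0 that x u by (intro mult_left_mono divide_left_mono) auto
      finally show ?thesis by (simp add: mult_ac)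
    qed
    have "\<forall>\<^sub>F \<delta> in at x within {0..}. norm (m_fun n \<delta> - m_fun n x) \<le> 2 * K / x * \<bar>\<delta> - x\<bar>"
      unfolding eventually_at
    proof (intro exI[of _ "x / 2"] conjI ballI impI)
      fix \<delta> :: real assume \<delta>: "\<delta> \<in> {0..}" "\<delta> \<noteq> x \<and> dist \<delta> x < x / 2"
      then have b: "x / 2 < \<delta>" "\<delta> < 3 * x / 2" by (auto simp: dist_real_def abs_if split: if_splits)
      show "norm (m_fun n \<delta> - m_fun n x) \<le> 2 * K / x * \<bar>\<delta> - x\<bar>"
      proof (cases "\<delta> \<le> x")
        case True
        then show ?thesis using step[of \<delta> x] m_fun_mono[OF n _ True] b x by simp
      next
        case False
        then show ?thesis using step[of x \<delta>] m_fun_mono[OF n x, of \<delta>] b x by simp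
      qed
    qed (use x in simp)
    moreover have "((\<lambda>\<delta>. 2 * K / x * \<bar>\<delta> - x\<bar>) \<longlongrightarrow> 0) (at x within {0..})"
      by (rule tendsto_eq_intros refl | simp)+
    ultimately have "((\<lambda>\<delta>. m_fun n \<delta> - m_fun n x) \<longlongrightarrow> 0) (at x within {0..})"
      by (rule Lim_null_comparison)
    then show ?thesis by (simp add: LIM_zero_iff)
  qed
qed

section \<open>The critical radius: the description in \<open>delta_crit\<close> is proper, and the
  maximum is attained\<close>

lemma m_fun_first_hit_ex1:
  assumes n: "n \<ge> 2" and c: "0 < c"
  shows "\<exists>!\<delta>. 0 < \<delta> \<and> (\<forall>d\<in>{0<..<\<delta>}. 0 < m_fun n d \<and> m_fun n d < c) \<and> m_fun n \<delta> = c"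
proof (rule ex_ex1I)
  note cont = continuous_on_subset[OF continuous_on_m_fun[OF n]]
  have IVT: "\<exists>d. 0 < d \<and> d \<le> b \<and> m_fun n d = c" if "0 < b" "c \<le> m_fun n b" for b
  proof -
    have "\<exists>d\<ge>0. d \<le> b \<and> m_fun n d = c"
      using that c by (intro IVT' cont) (auto simp: m_fun_def[of n 0])
    then show ?thesis using c by (metis m_fun_def less_eq_real_def)
  qed
  \<comment> \<open>Since m(c) \<ge> 3c, the level c is reached no later than at the radius
    c.\<close>
  obtain d where d: "0 < d" "m_fun n d = c" using IVT[of c] m_fun_ge[OF n c] c by auto
  \<comment> \<open>The first hit is the minimum of this compact level set; 0 is not in it, because
    m(0) = 0 < c.\<close>
  define S where "S = {x \<in> {0..d}. m_fun n x = c}"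
  have "compact S"
    unfolding S_def
  proof (rule closedin_compact)
    show "closedin (top_of_set {0..d}) {x \<in> {0..d}. m_fun n x = c}"
      by (rule continuous_closedin_preimage_constant[OF cont]) auto
  qed simp
  moreover have "d \<in> S" using d by (simp add: S_def)
  ultimately obtain \<delta> where \<delta>: "\<delta> \<in> S" "\<And>x. x \<in> S \<Longrightarrow> \<delta> \<le> x"
    using compact_attains_inf[of S] by blast
  have \<delta>0: "0 < \<delta>" using \<delta>(1) c by (cases "\<delta> = 0") (auto simp: S_def m_fun_def[of n 0])
  have "m_fun n x < c" if x: "0 < x" "x < \<delta>" for x
  proof (rule ccontr)
    assume "\<not> m_fun n x < c"
    then obtain x' where "0 < x'" "x' \<le> x" "m_fun n x' = c" using IVT[OF x(1)] by auto
    then have "\<delta> \<le> x'" using \<delta>(1) x by (intro \<delta>(2)) (auto simp: S_def)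
    with \<open>x' \<le> x\<close> x show False by simp
  qed
  moreover have "0 < m_fun n x" if "0 < x" for x using m_fun_ge[OF n that] that by simp
  ultimately show "\<exists>\<delta>. 0 < \<delta> \<and> (\<forall>d\<in>{0<..<\<delta>}. 0 < m_fun n d \<and> m_fun n d < c) \<and> m_fun n \<delta> = c"
    using \<delta>0 \<delta>(1) by (intro exI[of _ \<delta>]) (auto simp: S_def)
next
  fix x y
  assume "0 < x \<and> (\<forall>d\<in>{0<..<x}. 0 < m_fun n d \<and> m_fun n d < c) \<and> m_fun n x = c"
    "0 < y \<and> (\<forall>d\<in>{0<..<y}. 0 < m_fun n d \<and> m_fun n d < c) \<and> m_fun n y = c"
  then show "x = y"
    by (metis greaterThanLessThan_iff less_irrefl linorder_neqE_linordered_idom)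
qed

text \<open>The maximum over the compact interval up to \<open>delta_crit\<close> is positive, so it
  is attained away from the end points, where the function is 0. At radii strictly below
  \<open>delta_crit\<close> the contraction constant is less than 1.\<close>

lemma exists_radius:
  assumes n: "n \<ge> 2" and L: "L_const n r lam \<gamma> 0 < 1" and Q: "0 < Q_const n a r lam \<gamma> 0"
    and H: "H \<le> H_bound n a r lam \<gamma>"
  obtains \<delta> where "0 < \<delta>" "L_const n r lam \<gamma> 0 + m_fun n \<delta> * Q_const n a r lam \<gamma> 0 < 1"
    "H \<le> (1 - L_const n r lam \<gamma> 0 - m_fun n \<delta> * Q_const n a r lam \<gamma> 0) * \<delta>"
proof -
  define L' where "L' = L_const n r lam \<gamma> 0"
  define Q' where "Q' = Q_const n a r lam \<gamma> 0"
  define D where "D = delta_crit n a r lam \<gamma>"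
  define h where "h = (\<lambda>\<delta>. (1 - L' - m_fun n \<delta> * Q') * \<delta>)"
  have Q': "0 < Q'" and L': "L' < 1" using L Q by (auto simp: L'_def Q'_def)
  have "0 < (1 - L') / Q'" using L' Q' by simp
  from theI'[OF m_fun_first_hit_ex1[OF n this]]
  have "0 < D \<and> (\<forall>d\<in>{0<..<D}. 0 < m_fun n d \<and> m_fun n d < (1 - L') / Q') \<and> m_fun n D = (1 - L') / Q'"
    unfolding D_def delta_crit_def L'_def Q'_def .
  then have D: "0 < D" "\<And>d. 0 < d \<Longrightarrow> d < D \<Longrightarrow> m_fun n d < (1 - L') / Q'" "m_fun n D = (1 - L') / Q'"
    by auto
  have pos: "0 < h \<delta>" if "0 < \<delta>" "\<delta> < D" for \<delta>
  proof -
    have "m_fun n \<delta> * Q' < 1 - L'" using D(2)[OF that] Q' by (simp add: pos_less_divide_eq)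
    then show ?thesis using that by (simp add: h_def)
  qed
  have "continuous_on {0..D} h"
    unfolding h_def using continuous_on_subset[OF continuous_on_m_fun[OF n], of "{0..D}"]
    by (intro continuous_intros) auto
  then obtain \<delta> where \<delta>: "\<delta> \<in> {0..D}" "\<And>x. x \<in> {0..D} \<Longrightarrow> h x \<le> h \<delta>"
    using continuous_attains_sup[of "{0..D}" h] D(1) by auto
  have "0 < h \<delta>" using pos[of "D / 2"] \<delta>(2)[of "D / 2"] D(1) by auto
  moreover have "h 0 = 0" "h D = 0" using Q' D(3) by (auto simp: h_def)
  ultimately have \<delta>': "0 < \<delta>" "\<delta> < D"
    using \<delta>(1) by (metis atLeastAtMost_iff less_eq_real_def less_irrefl)+
  have "H_bound n a r lam \<gamma> = (SUP \<delta>\<in>{0<..<D}. h \<delta>)"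
    by (simp add: H_bound_def h_def D_def L'_def Q'_def)
  also have "\<dots> \<le> h \<delta>" using D(1) \<delta>(2) by (intro cSUP_least) auto
  finally have "H \<le> h \<delta>" using H by simp
  moreover have "L' + m_fun n \<delta> * Q' < 1" using D(2)[OF \<delta>'] Q' by (simp add: pos_less_divide_eq)
  ultimately show thesis using that \<delta>' unfolding h_def L'_def Q'_def by auto
qed

text \<open>Passage from the open balls of m to closed ones: the estimate holds at every radius
  above \<delta>, and continuity of m allows these to decrease to \<delta>.\<close>

lemma f_bell_le_m_fun:
  assumes n: "n \<ge> 2" and i: "i \<in> {1..n}" and \<delta>: "0 < \<delta>"
    and X: "(\<Sum>k=1..i. cmod (X k)) \<le> \<delta>" and Y: "(\<Sum>k=1..i. cmod (Y k)) \<le> \<delta>"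
  shows "cmod (f_bell i X - f_bell i Y) \<le> m_fun n \<delta> * (\<Sum>k=1..i. cmod (X k - Y k))"
proof -
  \<comment> \<open>\<open>l1_ball\<close> consists of sequences vanishing outside 1, ..., i;
    truncation leaves \<open>f_bell i\<close> unchanged.\<close>
  let ?X = "\<lambda>k. if k \<in> {1..i} then X k else 0" and ?Y = "\<lambda>k. if k \<in> {1..i} then Y k else 0"
  have eq: "f_bell i X = f_bell i ?X" "f_bell i Y = f_bell i ?Y" by (auto intro: f_bell_cong)
  have le: "cmod (f_bell i X - f_bell i Y) \<le> m_fun n \<delta>' * (\<Sum>k=1..i. cmod (X k - Y k))" if "\<delta> < \<delta>'" for \<delta>'
    using f_bell_le_m_fun_open[OF n i, of ?X \<delta>' ?Y] X Y that unfolding eq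
    by (auto simp: l1_ball_def)
  have "(m_fun n \<longlongrightarrow> m_fun n \<delta>) (at \<delta> within {0..})"
    using continuous_on_m_fun[OF n] \<delta> by (auto simp: continuous_on)
  then have "(m_fun n \<longlongrightarrow> m_fun n \<delta>) (at_right \<delta>)"
    by (rule tendsto_within_subset) (use \<delta> in auto)
  then have "((\<lambda>\<delta>'. m_fun n \<delta>' * (\<Sum>k=1..i. cmod (X k - Y k))) \<longlongrightarrow> m_fun n \<delta> * (\<Sum>k=1..i. cmod (X k - Y k))) (at_right \<delta>)"
    by (intro tendsto_intros)
  then show ?thesis
    by (rule tendsto_lowerbound) (auto intro!: eventually_at_rightI[of \<delta> "\<delta> + 1"] le[simplified])
qed

subsection \<open>Almost periodic functions\<close>

lemma AP_continuous: "u \<in> AP \<Longrightarrow> continuous_on A u"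
  by (auto simp: AP_def intro: continuous_on_subset)

lemma AP_subsequence:
  assumes "u \<in> AP"
  obtains \<phi> :: "nat \<Rightarrow> nat" and l where "strict_mono \<phi>" "uniform_limit UNIV (\<lambda>m t. u (t + b (\<phi> m))) l sequentially"
  using assms unfolding AP_def by blast

text \<open>If |u(b_m)| > m for all m, no subsequence of the translates by b_m can converge at t =
  0.\<close>

lemma AP_bounded: assumes "u \<in> AP" obtains B where "0 \<le> B" "\<And>t. cmod (u t) \<le> B"
proof -
  have "\<exists>B. \<forall>t. cmod (u t) \<le> B"
  proof (rule ccontr)
    assume "\<not> ?thesis"
    then have "\<forall>m. \<exists>t. real m < cmod (u t)" by (auto simp: not_le)
    then obtain b where b: "\<And>m. real m < cmod (u (b m))" by metis
    obtain \<phi> :: "nat \<Rightarrow> nat" and l where \<phi>: "strict_mono \<phi>"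
      "uniform_limit UNIV (\<lambda>m t. u (t + b (\<phi> m))) l sequentially" using AP_subsequence[OF assms] .
    have "(\<lambda>m. u (0 + b (\<phi> m))) \<longlonglongrightarrow> l 0" by (rule tendsto_uniform_limitI[OF \<phi>(2)]) simp
    then have "Bseq (\<lambda>m. u (0 + b (\<phi> m)))" by (intro convergent_imp_Bseq convergentI)
    then obtain K where K: "\<And>m. cmod (u (b (\<phi> m))) \<le> K" by (auto simp: Bseq_def)
    obtain m where "K < real m" using reals_Archimedean2 by blast
    also have "\<dots> \<le> real (\<phi> m)" using seq_suble[OF \<phi>(1)] by simp
    also have "\<dots> < cmod (u (b (\<phi> m)))" by (rule b)
    finally show False using K[of m] by simp
  qed
  then obtain B where B: "\<And>t. cmod (u t) \<le> B" by blast
  with order_trans[OF norm_ge_zero B] show thesis by (rule that)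
qed

lemma uniform_limit_subsequence:
  assumes "uniform_limit A f l sequentially" "strict_mono (r :: nat \<Rightarrow> nat)"
  shows "uniform_limit A (\<lambda>m. f (r m)) l sequentially"
  using filterlim_compose[OF assms(1) filterlim_subseq[OF assms(2)]] .

lemma AP_common_subsequence:
  assumes "u \<in> AP" "v \<in> AP"
  obtains \<phi> :: "nat \<Rightarrow> nat" and k l where "strict_mono \<phi>"
    "uniform_limit UNIV (\<lambda>m t. u (t + b (\<phi> m))) k sequentially"
    "uniform_limit UNIV (\<lambda>m t. v (t + b (\<phi> m))) l sequentially"
proof -
  obtain \<phi> :: "nat \<Rightarrow> nat" and k where \<phi>: "strict_mono \<phi>"
    "uniform_limit UNIV (\<lambda>m t. u (t + b (\<phi> m))) k sequentially" using AP_subsequence[OF assms(1)] .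
  obtain \<psi> :: "nat \<Rightarrow> nat" and l where \<psi>: "strict_mono \<psi>"
    "uniform_limit UNIV (\<lambda>m t. v (t + b (\<phi> (\<psi> m)))) l sequentially" using AP_subsequence[OF assms(2)] .
  show thesis
    by (rule that[of "\<phi> \<circ> \<psi>"])
      (use \<phi> \<psi> uniform_limit_subsequence[OF \<phi>(2) \<psi>(1)] in \<open>auto intro: strict_mono_o\<close>)
qed

lemma AP_const: "(\<lambda>_. c) \<in> AP"
  unfolding AP_def by (auto intro!: exI[of _ id] exI[of _ "\<lambda>_. c"] uniform_limit_const simp: strict_mono_def)

lemma AP_add: assumes "u \<in> AP" "v \<in> AP" shows "(\<lambda>t. u t + v t) \<in> AP"
  unfolding AP_def
proof (intro CollectI conjI allI)
  fix b :: "nat \<Rightarrow> real"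
  obtain \<phi> :: "nat \<Rightarrow> nat" and k l where \<phi>: "strict_mono \<phi>"
    "uniform_limit UNIV (\<lambda>m t. u (t + b (\<phi> m))) k sequentially"
    "uniform_limit UNIV (\<lambda>m t. v (t + b (\<phi> m))) l sequentially" using AP_common_subsequence[OF assms] .
  from uniform_limit_add[OF \<phi>(2,3)] \<phi>(1) show "\<exists>\<phi>. strict_mono \<phi> \<and> (\<exists>l. uniform_limit UNIV (\<lambda>m t. u (t + b (\<phi> m)) + v (t + b (\<phi> m))) l sequentially)"
    by blast
qed (intro continuous_intros AP_continuous assms)

lemma AP_mult: assumes "u \<in> AP" "v \<in> AP" shows "(\<lambda>t. u t * v t) \<in> AP"
  unfolding AP_def
proof (intro CollectI conjI allI)
  fix b :: "nat \<Rightarrow> real"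
  obtain \<phi> :: "nat \<Rightarrow> nat" and k l where \<phi>: "strict_mono \<phi>"
    "uniform_limit UNIV (\<lambda>m t. u (t + b (\<phi> m))) k sequentially"
    "uniform_limit UNIV (\<lambda>m t. v (t + b (\<phi> m))) l sequentially" using AP_common_subsequence[OF assms] .
  obtain B C where B: "\<And>t. cmod (u t) \<le> B" and C: "\<And>t. cmod (v t) \<le> C"
    using AP_bounded[OF assms(1)] AP_bounded[OF assms(2)] by metis
  have "cmod (k t) \<le> B" for t
    by (rule tendsto_upperbound[OF tendsto_norm[OF tendsto_uniform_limitI[OF \<phi>(2)]]]) (auto simp: B)
  moreover have "cmod (l t) \<le> C" for t
    by (rule tendsto_upperbound[OF tendsto_norm[OF tendsto_uniform_limitI[OF \<phi>(3)]]]) (auto simp: C)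
  \<comment> \<open>The limits inherit the bounds of u and v; uniform convergence of the products
    relies on this.\<close>
  ultimately have "bounded (k ` UNIV)" "bounded (l ` UNIV)" by (auto simp: bounded_iff)
  from uniform_lim_mult[OF \<phi>(2,3) this] \<phi>(1)
  show "\<exists>\<phi>. strict_mono \<phi> \<and> (\<exists>l. uniform_limit UNIV (\<lambda>m t. u (t + b (\<phi> m)) * v (t + b (\<phi> m))) l sequentially)"
    by blast
qed (intro continuous_intros AP_continuous assms)

lemma AP_cmult: "u \<in> AP \<Longrightarrow> (\<lambda>t. c * u t) \<in> AP"
  by (rule AP_mult[OF AP_const])

lemma AP_sum: "(\<And>i. i \<in> A \<Longrightarrow> u i \<in> AP) \<Longrightarrow> (\<lambda>t. \<Sum>i\<in>A. u i t) \<in> AP"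
  by (induction A rule: infinite_finite_induct) (auto intro: AP_const AP_add)

lemma diagonal_subsequence:
  fixes P :: "nat \<Rightarrow> (nat \<Rightarrow> nat) \<Rightarrow> bool"
  assumes ex: "\<And>n s. strict_mono (s :: nat \<Rightarrow> nat) \<Longrightarrow> \<exists>r'. strict_mono r' \<and> P n (s \<circ> r')"
    and stable: "\<And>n s r. strict_mono r \<Longrightarrow> P n s \<Longrightarrow> P n (s \<circ> r)"
  shows "\<exists>d. strict_mono d \<and> (\<forall>k. P k (d \<circ> (+) (Suc k)))"
proof -
  interpret d: subseqs P using ex by (rule subseqs.intro)
  show ?thesis using d.subseq_diagseq d.diagseq_holds[OF stable] by blast
qed

text \<open>A diagonal choice gives one subsequence along which the translates of every U k converge
  uniformly. Approximating u by a suitable U k then makes its translates uniformly Cauchy.\<close>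

lemma AP_uniform_limit:
  assumes U: "\<And>k. U k \<in> AP" and lim: "uniform_limit UNIV U u sequentially"
  shows "u \<in> AP"
  unfolding AP_def
proof (intro CollectI conjI allI)
  show "continuous_on UNIV u"
    by (rule uniform_limit_theorem[OF _ lim]) (simp_all add: AP_continuous U)
next
  fix b :: "nat \<Rightarrow> real"
  define P where "P = (\<lambda>k (s :: nat \<Rightarrow> nat). \<exists>l. uniform_limit UNIV (\<lambda>m t. U k (t + b (s m))) l sequentially)"
  have "\<exists>r' :: nat \<Rightarrow> nat. strict_mono r' \<and> P n (s \<circ> r')" if "strict_mono s" for n and s :: "nat \<Rightarrow> nat"
  proof -
    obtain r' :: "nat \<Rightarrow> nat" and l where r': "strict_mono r'"
      "uniform_limit UNIV (\<lambda>m t. U n (t + (b \<circ> s) (r' m))) l sequentially" using AP_subsequence[OF U] .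
    have "P n (s \<circ> r')" unfolding P_def using r'(2) by (simp add: o_def exI[of _ l])
    with r'(1) show ?thesis by auto
  qed
  moreover have "P n (s \<circ> r)" if "strict_mono r" "P n s" for n s r
    using that unfolding P_def o_def by (auto dest: uniform_limit_subsequence)
  ultimately obtain diagseq :: "nat \<Rightarrow> nat" where subseq_diagseq: "strict_mono diagseq"
    and P: "\<And>k. P k (diagseq \<circ> (+) (Suc k))"
    using diagonal_subsequence[of P] by blast
  have "uniformly_Cauchy_on UNIV (\<lambda>m t. u (t + b (diagseq m)))"
  proof (rule uniformly_Cauchy_onI)
    fix e :: real assume e: "e > 0"
    then obtain k where k: "\<And>t. dist (U k t) (u t) < e / 4"
      using uniform_limitD[OF lim, of "e / 4"] by (auto simp: eventually_sequentially)
    obtain l where l: "uniform_limit UNIV (\<lambda>m t. U k (t + b (diagseq (Suc k + m)))) l sequentially"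
      using P[of k] by (auto simp: P_def)
    then obtain N where N: "\<And>m t. m \<ge> N \<Longrightarrow> dist (U k (t + b (diagseq (Suc k + m)))) (l t) < e / 4"
      using uniform_limitD[OF l, of "e / 4"] e by (auto simp: eventually_sequentially)
    have near: "dist (u (t + b (diagseq m))) (l t) < e / 2" if "m \<ge> Suc k + N" for m t
    proof -
      have "N \<le> m - Suc k" "Suc k + (m - Suc k) = m" using that by linarith+
      then show ?thesis using N[of "m - Suc k" t] k[of "t + b (diagseq m)"]
        dist_triangle[of "u (t + b (diagseq m))" "l t" "U k (t + b (diagseq m))"]
        by (simp add: dist_commute)
    qed
    have "dist (u (t + b (diagseq m))) (u (t + b (diagseq m'))) < e" if "m \<ge> Suc k + N" "m' \<ge> Suc k + N" for m m' t
      using near[OF that(1), of t] near[OF that(2), of t] by (rule dist_triangle_half_l)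
    then show "\<exists>M. \<forall>t\<in>UNIV. \<forall>m\<ge>M. \<forall>n\<ge>M. dist (u (t + b (diagseq m))) (u (t + b (diagseq n))) < e"
      by blast
  qed
  then have "uniformly_convergent_on UNIV (\<lambda>m t. u (t + b (diagseq m)))"
    by (rule Cauchy_uniformly_convergent)
  then show "\<exists>\<phi>. strict_mono \<phi> \<and> (\<exists>l. uniform_limit UNIV (\<lambda>m t. u (t + b (\<phi> m))) l sequentially)"
    unfolding uniformly_convergent_on_def by (intro exI[of _ diagseq] conjI subseq_diagseq)
qed

text \<open>All late translates are uniformly close to a single one, of index M. That one is close
  to u t0 around t1 = t0 - b (\<phi> M), so near t1 all late translates stay away from 0, with t1,
  \<rho> and \<eta> independent of m.\<close>

lemma AP_recurrence:
  fixes b :: "nat \<Rightarrow> real"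
  assumes "u \<in> AP" "u t0 \<noteq> 0"
  obtains \<phi> :: "nat \<Rightarrow> nat" and t1 \<rho> \<eta> :: real where "strict_mono \<phi>" "0 < \<rho>" "0 < \<eta>"
    "\<And>m s. \<bar>s - t1\<bar> < \<rho> \<Longrightarrow> \<eta> \<le> cmod (u (s + b (\<phi> m)))"
proof -
  define \<eta> where "\<eta> = cmod (u t0) / 2"
  have \<eta>: "0 < \<eta>" using assms(2) by (simp add: \<eta>_def)
  obtain \<phi> :: "nat \<Rightarrow> nat" and l where \<phi>: "strict_mono \<phi>"
    "uniform_limit UNIV (\<lambda>m t. u (t + b (\<phi> m))) l sequentially" using AP_subsequence[OF assms(1)] .
  have "0 < \<eta> / 4" using \<eta> by simp
  from uniform_limitD[OF \<phi>(2) this]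
  obtain M where M: "\<And>m t. m \<ge> M \<Longrightarrow> dist (u (t + b (\<phi> m))) (l t) < \<eta> / 4"
    by (auto simp: eventually_sequentially)
  have "isCont u t0" using AP_continuous[OF assms(1), of UNIV] by (simp add: continuous_on_eq_continuous_at)
  then obtain \<rho> where \<rho>: "0 < \<rho>" "\<And>s. \<bar>s - t0\<bar> < \<rho> \<Longrightarrow> dist (u s) (u t0) < \<eta> / 2"
    using \<eta> unfolding continuous_at_eps_delta dist_real_def by (meson half_gt_zero)
  \<comment> \<open>Continuity at t0 costs \<eta>/2 and the change of translate another \<eta>/2;
    together u moves by less than \<eta>, which is half of |u t0|.\<close>
  have lower: "\<eta> \<le> cmod (u (s + b (\<phi> (M + m))))" if s: "\<bar>s - (t0 - b (\<phi> M))\<bar> < \<rho>" for m s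
  proof -
    have "dist (u (s + b (\<phi> M))) (u t0) < \<eta> / 2" using s by (intro \<rho>(2)) (simp add: algebra_simps)
    moreover have "dist (u (s + b (\<phi> (M + m)))) (u (s + b (\<phi> M))) < \<eta> / 2"
      using dist_triangle2[of "u (s + b (\<phi> (M + m)))" "u (s + b (\<phi> M))" "l s"] M[of "M + m" s] M[of M s]
      by simp
    ultimately have "dist (u (s + b (\<phi> (M + m)))) (u t0) < \<eta>"
      using dist_triangle[of "u (s + b (\<phi> (M + m)))" "u t0" "u (s + b (\<phi> M))"] by simp
    moreover have "cmod (u t0) - cmod (u (s + b (\<phi> (M + m)))) \<le> dist (u (s + b (\<phi> (M + m)))) (u t0)"
      by (metis dist_norm norm_minus_commute norm_triangle_ineq2)
    ultimately show ?thesis by (simp add: \<eta>_def)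
  qed
  show thesis
    by (rule that[of "\<lambda>m. \<phi> (M + m)" \<rho> \<eta> "t0 - b (\<phi> M)"])
      (use \<phi>(1) \<rho>(1) \<eta> lower in \<open>auto simp: strict_mono_def\<close>)
qed

subsection \<open>Green operators\<close>

lemma cmod_green:
  "Re \<omega> \<noteq> 0 \<Longrightarrow> cmod (green \<omega> t s) = (if sgn (Re \<omega>) * (t - s) < 0 then exp (Re \<omega> * (t - s)) else 0)"
  by (simp add: green_def norm_mult)

lemma cmod_green_Re: "Re \<omega> \<noteq> 0 \<Longrightarrow> cmod (green (of_real (Re \<omega>)) t s) = cmod (green \<omega> t s)"
  by (simp add: cmod_green)

lemma I_op_Re: "Re \<omega> \<noteq> 0 \<Longrightarrow> I_op (of_real (Re \<omega>)) f t = I_op \<omega> f t"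
  by (simp add: I_op_def norm_mult cmod_green_Re)

text \<open>Time reversal reduces negative real parts to positive ones.\<close>

lemma green_reflect: "green \<omega> t s = - green (- \<omega>) (- t) (- s)"
  by (auto simp: green_def sgn_minus algebra_simps)

lemma green_translate: "green \<omega> (t + b) (s + b) = green \<omega> t s"
  by (simp add: green_def)

lemma measurable_green [measurable]: "green \<omega> t \<in> borel_measurable borel"
  unfolding green_def by measurable

text \<open>The mass of the kernel bounds G on bounded functions and is the origin of the terms
  |a_i| / |\<alpha>_j| in \<open>Q_const\<close>.\<close>

lemma has_bochner_integral_green:
  assumes "Re \<omega> \<noteq> 0"
  shows "has_bochner_integral lborel (\<lambda>s. cmod (green \<omega> t s)) (1 / \<bar>Re \<omega>\<bar>)"
proof -
  have pos: "has_bochner_integral lborel (\<lambda>s. cmod (green \<omega> t s)) (1 / Re \<omega>)" if "0 < Re \<omega>" for \<omega> t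
  proof -
    define a where "a = Re \<omega>"
    have a: "0 < a" using that by (simp add: a_def)
    have "((\<lambda>s. exp (a * (t - s))) \<longlongrightarrow> 0) at_top"
    proof (rule filterlim_compose[OF exp_at_bot])
      have "filterlim (\<lambda>s. - (a * t) + a * s) at_top at_top"
        by (intro filterlim_tendsto_add_at_top[OF tendsto_const]
            filterlim_tendsto_pos_mult_at_top[OF tendsto_const a filterlim_ident])
      then show "filterlim (\<lambda>s. a * (t - s)) at_bot at_top"
        by (simp add: filterlim_uminus_at_bot algebra_simps)
    qed
    then have lim: "((\<lambda>s. - exp (a * (t - s)) / a) \<longlongrightarrow> 0) at_top"
      using tendsto_divide[OF tendsto_minus tendsto_const[of a]] a by fastforce
    have "(\<integral>\<^sup>+s. ennreal (exp (a * (t - s))) * indicator {t..} s \<partial>lborel) = ennreal (0 - (- exp (a * (t - t)) / a))"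
      using a lim by (intro nn_integral_FTC_atLeast) (auto intro!: derivative_eq_intros)
    moreover have "(\<integral>\<^sup>+s. ennreal (exp (a * (t - s))) * indicator {t..} s \<partial>lborel)
        = (\<integral>\<^sup>+s. ennreal (cmod (green \<omega> t s)) \<partial>lborel)"
      \<comment> \<open>The kernel and the integrand on the closed half-line differ at s = t
        only.\<close>
      using AE_lborel_singleton[of t] that
      by (intro nn_integral_cong_AE) (auto simp: cmod_green a_def indicator_def mult_less_0_iff elim!: eventually_mono)
    ultimately have "(\<integral>\<^sup>+s. ennreal (cmod (green \<omega> t s)) \<partial>lborel) = ennreal (1 / a)" by simp
    then show ?thesis using a unfolding a_def by (intro has_bochner_integral_nn_integral) auto
  qed
  show ?thesis
  proof (cases "0 < Re \<omega>")
    case True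
    then show ?thesis using pos by simp
  next
    case False
    then have neg: "0 < Re (- \<omega>)" using assms by simp
    have "has_bochner_integral lborel (\<lambda>s. cmod (green (- \<omega>) (- t) (0 + (-1) * s))) (1 / Re (- \<omega>) /\<^sub>R \<bar>-1\<bar>)"
      using pos[OF neg, of "- t"] by (subst lborel_has_bochner_integral_real_affine_iff[symmetric]) auto
    then show ?thesis using neg by (simp add: green_reflect[of \<omega> t])
  qed
qed

lemma integrable_green_mult:
  assumes "Re \<omega> \<noteq> 0" "f \<in> borel_measurable borel" "\<And>s. cmod (f s) \<le> M"
  shows "integrable lborel (\<lambda>s. green \<omega> t s * f s)"
proof (rule Bochner_Integration.integrable_bound)
  show "integrable lborel (\<lambda>s. M * cmod (green \<omega> t s))"
    using has_bochner_integral_green[OF assms(1)] by (intro integrable_mult_right) (auto simp: has_bochner_integral_iff)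
  have "0 \<le> M" using order_trans[OF norm_ge_zero assms(3)] .
  then show "AE s in lborel. norm (green \<omega> t s * f s) \<le> norm (M * cmod (green \<omega> t s))"
    by (simp add: norm_mult mult.commute[of M] assms(3) mult_left_mono)
qed (use assms(2) in measurable)

lemma I_op_nonneg: "0 \<le> I_op \<omega> f t"
  by (simp add: I_op_def integral_nonneg_AE)

lemma I_op_le:
  assumes "Re \<omega> \<noteq> 0" "f \<in> borel_measurable borel" "\<And>s. cmod (f s) \<le> M"
  shows "I_op \<omega> f t \<le> M / \<bar>Re \<omega>\<bar>"
proof -
  note g = has_bochner_integral_green[OF assms(1), of t]
  have "I_op \<omega> f t \<le> (\<integral>s. M * cmod (green \<omega> t s) \<partial>lborel)"
    unfolding I_op_def
  proof (rule integral_mono)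
    show "integrable lborel (\<lambda>s. cmod (green \<omega> t s * f s))"
      by (rule integrable_norm[OF integrable_green_mult[OF assms]])
    show "integrable lborel (\<lambda>s. M * cmod (green \<omega> t s))"
      using g by (intro integrable_mult_right) (auto simp: has_bochner_integral_iff)
  qed (simp add: norm_mult mult.commute[of M] assms(3) mult_left_mono)
  also have "\<dots> = M / \<bar>Re \<omega>\<bar>" using g by (simp add: has_bochner_integral_iff)
  finally show ?thesis .
qed

lemma cmod_G_op_le_I_op: "cmod (G_op \<omega> f t) \<le> I_op \<omega> f t"
  unfolding G_op_def I_op_def by (rule integral_norm_bound)

lemma cmod_G_op_le:
  assumes "Re \<omega> \<noteq> 0" "f \<in> borel_measurable borel" "\<And>s. cmod (f s) \<le> M"
  shows "cmod (G_op \<omega> f t) \<le> M / \<bar>Re \<omega>\<bar>"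
  using cmod_G_op_le_I_op I_op_le[OF assms] by (rule order_trans)

lemma G_op_diff:
  assumes "Re \<omega> \<noteq> 0" "f \<in> borel_measurable borel" "\<And>s. cmod (f s) \<le> M"
    "g \<in> borel_measurable borel" "\<And>s. cmod (g s) \<le> N"
  shows "G_op \<omega> f t - G_op \<omega> g t = G_op \<omega> (\<lambda>s. f s - g s) t"
  unfolding G_op_def right_diff_distrib
  by (intro Bochner_Integration.integral_diff[symmetric] integrable_green_mult[OF assms(1-3)]
      integrable_green_mult[OF assms(1,4,5)])

lemma G_op_translate: "G_op \<omega> f (t + b) = G_op \<omega> (\<lambda>s. f (s + b)) t"
  unfolding G_op_def
  by (subst lborel_integral_real_affine[of 1 _ b]) (simp_all add: add.commute[of b] green_translate)

lemma G_op_reflect: "G_op \<omega> f t = - G_op (- \<omega>) (\<lambda>s. f (- s)) (- t)"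
proof -
  have "G_op \<omega> f t = (\<integral>s. - (green (- \<omega>) (- t) (- s) * f s) \<partial>lborel)"
    unfolding G_op_def by (simp add: green_reflect[of \<omega> t])
  also have "\<dots> = - (\<integral>s. green (- \<omega>) (- t) (- s) * f s \<partial>lborel)" by simp
  also have "(\<integral>s. green (- \<omega>) (- t) (- s) * f s \<partial>lborel) = G_op (- \<omega>) (\<lambda>s. f (- s)) (- t)"
    unfolding G_op_def by (subst lborel_integral_real_affine[of "-1" _ 0]) simp_all
  finally show ?thesis .
qed

text \<open>For Re \<omega> > 0, G f(t) is - e^(\<omega> t) times the integral of e^(-\<omega> s)
  f(s) over s > t, to which the product rule applies.\<close>

lemma G_op_has_vector_derivative_pos:
  assumes \<omega>: "0 < Re \<omega>" and f: "continuous_on UNIV f" "\<And>s. cmod (f s) \<le> M"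
  shows "(G_op \<omega> f has_vector_derivative f x + \<omega> * G_op \<omega> f x) (at x)"
proof -
  define h where "h = (\<lambda>s. exp (- \<omega> * of_real s) * f s)"
  have hc: "continuous_on A h" for A
    unfolding h_def by (intro continuous_intros continuous_on_subset[OF f(1)]) auto
  have [measurable]: "f \<in> borel_measurable borel" using f(1) by (rule borel_measurable_continuous_onI)
  have eq: "green \<omega> t s * f s = indicator {t<..} s *\<^sub>R (- exp (\<omega> * of_real t) * h s)" for t s
    using \<omega> by (auto simp: green_def h_def indicator_def mult_less_0_iff exp_diff exp_minus field_simps)
  have int: "set_integrable lborel {t<..} h" for t
  proof -
    have "integrable lborel (\<lambda>s. - exp (- \<omega> * of_real t) * (green \<omega> t s * f s))"
      using \<omega> f by (intro integrable_mult_right integrable_green_mult) auto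
    moreover have "- exp (- \<omega> * of_real t) * (green \<omega> t s * f s) = indicator {t<..} s *\<^sub>R h s" for s
      unfolding eq by (auto simp: indicator_def exp_minus field_simps)
    ultimately show ?thesis unfolding set_integrable_def by (simp only:)
  qed
  have G: "G_op \<omega> f t = - exp (\<omega> * of_real t) * (LBINT s=ereal t..\<infinity>. h s)" for t
  proof -
    have "G_op \<omega> f t = (\<integral>s. - exp (\<omega> * of_real t) * (indicator {t<..} s *\<^sub>R h s) \<partial>lborel)"
      unfolding G_op_def eq by (intro Bochner_Integration.integral_cong) (auto simp: indicator_def)
    then show ?thesis
      unfolding interval_integral_to_infinity_eq set_lebesgue_integral_def
      by (simp only: integral_mult_right_zero)
  qed
  \<comment> \<open>With a fixed base point left of x, the integral over s > u is the constant C
    minus J u for u near x, and J is an integral over a compact interval.\<close>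
  define c where "c = x - 1"
  define J where "J = (\<lambda>u::real. LBINT s=c..u. h s)"
  define C where "C = (LBINT s=ereal c..\<infinity>. h s)"
  have GJ: "G_op \<omega> f u = - exp (\<omega> * of_real u) * (C - J u)" if "c < u" for u
  proof -
    have "(LBINT s=ereal c..ereal u. h s) + (LBINT s=ereal u..\<infinity>. h s) = (LBINT s=ereal c..\<infinity>. h s)"
      using that int[of c] by (intro interval_integral_sum) (auto simp: interval_integrable_to_infinity_eq min_def max_def)
    then show ?thesis unfolding G J_def C_def by (metis add_diff_cancel_left')
  qed
  have "(J has_vector_derivative h x) (at x within {c..x+1})"
    unfolding J_def by (rule interval_integral_FTC2) (auto simp: c_def hc)
  then have J: "(J has_vector_derivative h x) (at x)"
    by (subst (asm) at_within_interior) (auto simp: c_def)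
  have E: "((\<lambda>u. - exp (\<omega> * of_real u)) has_vector_derivative - (\<omega> * exp (\<omega> * of_real x))) (at x)"
    by (rule has_vector_derivative_real_field) (auto intro!: derivative_eq_intros)
  have "((\<lambda>u. - exp (\<omega> * of_real u) * (C - J u)) has_vector_derivative
      (- exp (\<omega> * of_real x) * (0 - h x) + - (\<omega> * exp (\<omega> * of_real x)) * (C - J x))) (at x)"
    by (intro has_vector_derivative_mult E has_vector_derivative_diff J has_vector_derivative_const)
  moreover have "- exp (\<omega> * of_real x) * (0 - h x) + - (\<omega> * exp (\<omega> * of_real x)) * (C - J x)
      = f x + \<omega> * G_op \<omega> f x"
    using GJ[of x] by (simp add: c_def h_def exp_minus)
  ultimately have "((\<lambda>u. - exp (\<omega> * of_real u) * (C - J u)) has_vector_derivative f x + \<omega> * G_op \<omega> f x) (at x)"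
    by simp
  then show ?thesis
    by (rule has_vector_derivative_transform_within_open[where S="{c<..}"]) (auto simp: GJ c_def)
qed

lemma G_op_has_vector_derivative:
  assumes \<omega>: "Re \<omega> \<noteq> 0" and f: "continuous_on UNIV f" "\<And>s. cmod (f s) \<le> M"
  shows "(G_op \<omega> f has_vector_derivative f x + \<omega> * G_op \<omega> f x) (at x)"
proof (cases "0 < Re \<omega>")
  case True
  then show ?thesis using f by (rule G_op_has_vector_derivative_pos)
next
  case False
  let ?g = "\<lambda>s. f (- s)"
  have g: "continuous_on UNIV ?g"
    by (rule continuous_on_compose2[OF f(1)]) (auto intro: continuous_intros)
  have "(G_op (- \<omega>) ?g has_vector_derivative ?g (- x) + - \<omega> * G_op (- \<omega>) ?g (- x)) (at (- x))"
    using False \<omega> g f(2) by (intro G_op_has_vector_derivative_pos) auto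
  moreover have "(uminus has_vector_derivative -1) (at x)"
    using has_vector_derivative_minus[OF has_vector_derivative_id] .
  ultimately have "((G_op (- \<omega>) ?g \<circ> uminus) has_vector_derivative (-1) *\<^sub>R (?g (- x) + - \<omega> * G_op (- \<omega>) ?g (- x))) (at x)"
    by (intro vector_diff_chain_at)
  from has_vector_derivative_minus[OF this]
  have "((\<lambda>t. - G_op (- \<omega>) ?g (- t)) has_vector_derivative f x + - \<omega> * G_op (- \<omega>) ?g (- x)) (at x)"
    by (simp add: o_def)
  moreover have "G_op \<omega> f = (\<lambda>t. - G_op (- \<omega>) ?g (- t))" by (rule ext) (rule G_op_reflect)
  ultimately show ?thesis by simp
qed

text \<open>G commutes with translations and is bounded in the supremum norm. Hence a subsequence
  that serves f also serves G f, and the limit is G l.\<close>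

lemma AP_G_op:
  assumes \<omega>: "Re \<omega> \<noteq> 0" and f: "f \<in> AP" shows "G_op \<omega> f \<in> AP"
  unfolding AP_def
proof (intro CollectI conjI allI)
  obtain M where M: "\<And>s. cmod (f s) \<le> M" using AP_bounded[OF f] by blast
  have m: "g \<in> borel_measurable borel" if "continuous_on UNIV g" for g :: "real \<Rightarrow> complex"
    using that by (rule borel_measurable_continuous_onI)
  note fc = AP_continuous[OF f]
  show "continuous_on UNIV (G_op \<omega> f)"
    using G_op_has_vector_derivative[OF \<omega> fc M]
    by (intro continuous_at_imp_continuous_on ballI has_vector_derivative_continuous)
  fix b :: "nat \<Rightarrow> real"
  obtain \<phi> :: "nat \<Rightarrow> nat" and l where \<phi>: "strict_mono \<phi>"
    "uniform_limit UNIV (\<lambda>m t. f (t + b (\<phi> m))) l sequentially" using AP_subsequence[OF f] .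
  have fs: "continuous_on UNIV (\<lambda>t. f (t + c))" for c
    by (rule continuous_on_compose2[OF fc[of UNIV]]) (auto intro: continuous_intros)
  have lc: "continuous_on UNIV l"
    by (rule uniform_limit_theorem[OF _ \<phi>(2)]) (simp_all add: fs)
  have lM: "cmod (l t) \<le> M" for t
    by (rule tendsto_upperbound[OF tendsto_norm[OF tendsto_uniform_limitI[OF \<phi>(2)]]]) (auto simp: M)
  have "uniform_limit UNIV (\<lambda>m t. G_op \<omega> f (t + b (\<phi> m))) (G_op \<omega> l) sequentially"
  proof (rule uniform_limitI)
    fix e :: real assume e: "0 < e"
    have "0 < e * \<bar>Re \<omega>\<bar> / 2" using e \<omega> by simp
    from uniform_limitD[OF \<phi>(2) this]
    show "\<forall>\<^sub>F m in sequentially. \<forall>t\<in>UNIV. dist (G_op \<omega> f (t + b (\<phi> m))) (G_op \<omega> l t) < e"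
    proof (rule eventually_mono)
      fix m assume *: "\<forall>t\<in>UNIV. dist (f (t + b (\<phi> m))) (l t) < e * \<bar>Re \<omega>\<bar> / 2"
      have "cmod (G_op \<omega> (\<lambda>s. f (s + b (\<phi> m)) - l s) t) \<le> (e * \<bar>Re \<omega>\<bar> / 2) / \<bar>Re \<omega>\<bar>" for t
        using \<omega> m[OF fs] m[OF lc] * by (intro cmod_G_op_le) (auto simp: dist_norm less_imp_le)
      then have "dist (G_op \<omega> f (t + b (\<phi> m))) (G_op \<omega> l t) \<le> e / 2" for t
        using G_op_diff[OF \<omega> m[OF fs] M m[OF lc] lM] \<omega> by (simp add: dist_norm G_op_translate)
      then show "\<forall>t\<in>UNIV. dist (G_op \<omega> f (t + b (\<phi> m))) (G_op \<omega> l t) < e"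
        using e by (smt (verit) field_sum_of_halves)
    qed
  qed
  with \<phi>(1) show "\<exists>\<phi>. strict_mono \<phi> \<and> (\<exists>l. uniform_limit UNIV (\<lambda>m t. G_op \<omega> f (t + b (\<phi> m))) l sequentially)"
    by blast
qed

text \<open>After centring at t, only a window (p, q) is kept, on which the kernel is active, its
  exponential is at least k and |f| is at least \<eta>.\<close>

lemma I_op_lower_bound:
  assumes \<omega>: "Re \<omega> \<noteq> 0" and f: "f \<in> borel_measurable borel" "\<And>s. cmod (f s) \<le> M"
    and \<eta>: "0 \<le> \<eta>" "p \<le> q" "\<And>s. p < s \<Longrightarrow> s < q \<Longrightarrow> \<eta> \<le> cmod (f (s + t))"
    and side: "\<And>s. p < s \<Longrightarrow> s < q \<Longrightarrow> 0 < sgn (Re \<omega>) * s"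
    and e: "\<And>s. p < s \<Longrightarrow> s < q \<Longrightarrow> k \<le> exp (- Re \<omega> * s)" "0 \<le> k"
  shows "(q - p) * (k * \<eta>) \<le> I_op \<omega> f t"
proof -
  have "I_op \<omega> f t = (\<integral>s. cmod (green \<omega> t (t + 1 * s) * f (t + 1 * s)) \<partial>lborel)"
    unfolding I_op_def by (subst lborel_integral_real_affine[of 1 _ t]) simp_all
  moreover have "(\<integral>s. k * \<eta> * indicator {p<..<q} s \<partial>lborel) \<le> (\<integral>s. cmod (green \<omega> t (t + 1 * s) * f (t + 1 * s)) \<partial>lborel)"
  proof (rule integral_mono)
    show "integrable lborel (\<lambda>s. cmod (green \<omega> t (t + 1 * s) * f (t + 1 * s)))"
      using lborel_integrable_real_affine[OF integrable_norm[OF integrable_green_mult[OF \<omega> f]], where c=1 and t=t] by simp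
    fix s
    show "k * \<eta> * indicator {p<..<q} s \<le> cmod (green \<omega> t (t + 1 * s) * f (t + 1 * s))"
    proof (cases "s \<in> {p<..<q}")
      case True
      then show ?thesis using side[of s] e(1)[of s] e(2) \<eta>(1) \<eta>(3)[of s] \<omega>
        by (auto simp: norm_mult cmod_green add.commute[of t] intro!: mult_mono)
    qed simp
  next
    show "integrable lborel (\<lambda>s. k * \<eta> * indicator {p<..<q} s)"
      using emeasure_lborel_Ioo[OF \<eta>(2)] by (intro integrable_mult_right integrable_real_indicator) auto
  qed
  ultimately show ?thesis using \<eta>(2) by (simp add: mult.commute)
qed

text \<open>Almost periodicity forbids the two-sided exponential average of a nonzero function to come
  arbitrarily close to 0, so that the asymptotic estimates reduce to boundedness.\<close>

lemma two_sided_average_lower_bound: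
  assumes u: "u \<in> AP" "u t0 \<noteq> 0" and \<beta>: "0 < \<beta>"
  obtains c where "0 < c" "\<And>t. c \<le> I_op (of_real \<beta>) u t + I_op (of_real (- \<beta>)) u t"
proof -
  let ?g = "\<lambda>t. I_op (of_real \<beta>) u t + I_op (of_real (- \<beta>)) u t"
  have "\<exists>c>0. \<forall>t. c \<le> ?g t"
  proof (rule ccontr)
    assume "\<not> ?thesis"
    then have "\<forall>m. \<exists>t. ?g t < inverse (real (Suc m))" by (metis inverse_positive_iff_positive not_le of_nat_0_less_iff zero_less_Suc)
    then obtain b where b: "\<And>m. ?g (b m) < inverse (real (Suc m))" by metis
    obtain \<phi> :: "nat \<Rightarrow> nat" and t1 \<rho> \<eta> :: real where \<phi>: "strict_mono \<phi>" and pos: "0 < \<rho>" "0 < \<eta>"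
      and low: "\<And>m s. \<bar>s - t1\<bar> < \<rho> \<Longrightarrow> \<eta> \<le> cmod (u (s + b (\<phi> m)))"
      by (rule AP_recurrence[OF u, where b=b]) (rule that)
    obtain M where M: "\<And>s. cmod (u s) \<le> M" using AP_bounded[OF u(1)] by blast
    have m: "u \<in> borel_measurable borel" by (rule borel_measurable_continuous_onI[OF AP_continuous[OF u(1)]])
    \<comment> \<open>A lower bound for both exponentials on every window used below, all of which
      lie within |s| \<le> |t1| + \<rho>.\<close>
    define k where "k = exp (- \<beta> * (\<bar>t1\<bar> + \<rho>))"
    have k: "k \<le> exp (v * s)" if "\<bar>s\<bar> \<le> \<bar>t1\<bar> + \<rho>" "\<bar>v\<bar> = \<beta>" for s v
    proof -
      have "\<bar>v * s\<bar> \<le> \<beta> * (\<bar>t1\<bar> + \<rho>)"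
        using that \<beta> by (simp add: abs_mult mult_left_mono)
      then show ?thesis by (simp add: k_def)
    qed
    \<comment> \<open>The half of the neighbourhood of t1 that points away from 0 lies on one side
      of 0, where one of the two kernels is active. The sign of t1 is not under control, so the
      average has to be two-sided.\<close>
    have "\<rho> * (k * \<eta>) \<le> ?g (b (\<phi> m))" for m
    proof (cases "0 \<le> t1")
      case True
      have "(t1 + \<rho> - t1) * (k * \<eta>) \<le> I_op (of_real \<beta>) u (b (\<phi> m))"
        using pos True \<beta> by (intro I_op_lower_bound[OF _ m M] low k) (auto simp: k_def)
      then show ?thesis using I_op_nonneg[of "of_real (- \<beta>)" u "b (\<phi> m)"] by simp
    next
      case False
      have "(t1 - (t1 - \<rho>)) * (k * \<eta>) \<le> I_op (of_real (- \<beta>)) u (b (\<phi> m))"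
        using pos False \<beta> by (intro I_op_lower_bound[OF _ m M] low k) (auto simp: k_def)
      then show ?thesis using I_op_nonneg[of "of_real \<beta>" u "b (\<phi> m)"] by simp
    qed
    then have le: "\<rho> * (k * \<eta>) \<le> inverse (real (Suc (\<phi> m)))" for m
      using b[of "\<phi> m"] by (meson less_imp_le order_trans)
    have "0 < \<rho> * (k * \<eta>)" using pos by (simp add: k_def)
    then obtain N where N: "inverse (real (Suc N)) < \<rho> * (k * \<eta>)" using reals_Archimedean by blast
    have "inverse (real (Suc (\<phi> N))) \<le> inverse (real (Suc N))"
      using seq_suble[OF \<phi>, of N] by (intro le_imp_inverse_le) auto
    with le[of N] N show False by linarith
  qed
  then show thesis using that by blast
qed

subsection \<open>Contraction estimate\<close>

text \<open>Regrouping by l = i + j. With p = 2 the coefficients of \<open>F_op\<close> take the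
  shape of those in \<open>Q_const\<close>; with p = 0 the expansion of y^(i)/y is sorted by the
  index of the Bell polynomial.\<close>

lemma sum_triangle_shift:
  fixes g :: "nat \<Rightarrow> nat \<Rightarrow> 'a::comm_monoid_add"
  shows "(\<Sum>i=p..n. \<Sum>j=0..n-i. g (i + j) j) = (\<Sum>l=p..n. \<Sum>j=0..l-p. g l j)"
  unfolding sum.Sigma[OF finite_atLeastAtMost ballI[OF finite_atLeastAtMost]]
  by (rule sum.reindex_bij_witness[of _ "\<lambda>(l, j). (l - j, j)" "\<lambda>(i, j). (i + j, j)"]) auto

text \<open>Stated for an arbitrary finite index set, since it is applied to single orders, to pairs
  of indices, and with \<open>bool\<close> to two summands.\<close>

lemma I_op_sum_le:
  assumes \<omega>: "Re \<omega> \<noteq> 0" and A: "finite A"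
    and u: "\<And>x. x \<in> A \<Longrightarrow> u x \<in> borel_measurable borel" "\<And>x s. x \<in> A \<Longrightarrow> cmod (u x s) \<le> M x"
    and f: "f \<in> borel_measurable borel" "\<And>s. cmod (f s) \<le> (\<Sum>x\<in>A. c x * cmod (u x s))"
    and c: "\<And>x. x \<in> A \<Longrightarrow> 0 \<le> c x"
  shows "I_op \<omega> f t \<le> (\<Sum>x\<in>A. c x * I_op \<omega> (u x) t)"
proof -
  have int: "integrable lborel (\<lambda>s. cmod (green \<omega> t s * u x s))" if "x \<in> A" for x
    using that u by (intro integrable_norm integrable_green_mult[OF \<omega>]) auto
  have fM: "cmod (f s) \<le> (\<Sum>x\<in>A. c x * M x)" for s
    using f(2)[of s] by (rule order_trans) (intro sum_mono mult_left_mono u c)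
  have "I_op \<omega> f t \<le> (\<integral>s. (\<Sum>x\<in>A. c x * cmod (green \<omega> t s * u x s)) \<partial>lborel)"
    unfolding I_op_def
  proof (rule integral_mono)
    show "integrable lborel (\<lambda>s. cmod (green \<omega> t s * f s))"
      by (rule integrable_norm, rule integrable_green_mult[OF \<omega> f(1) fM])
    show "integrable lborel (\<lambda>s. \<Sum>x\<in>A. c x * cmod (green \<omega> t s * u x s))"
      by (intro Bochner_Integration.integrable_sum integrable_mult_right int)
    fix s
    show "cmod (green \<omega> t s * f s) \<le> (\<Sum>x\<in>A. c x * cmod (green \<omega> t s * u x s))"
      using mult_left_mono[OF f(2)[of s] norm_ge_zero[of "green \<omega> t s"]]
      by (simp add: norm_mult sum_distrib_left mult_ac)
  qed
  also have "\<dots> = (\<Sum>x\<in>A. c x * I_op \<omega> (u x) t)"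
    unfolding I_op_def by (subst Bochner_Integration.integral_sum) (auto intro: int)
  finally show ?thesis .
qed

lemma I_op_le_supnorm:
  assumes "Re \<omega> \<noteq> 0" "f \<in> borel_measurable borel" "\<And>s. cmod (f s) \<le> M"
  shows "I_op \<omega> f t \<le> supnorm (I_op \<omega> f)"
proof -
  have "norm (I_op \<omega> f t) \<le> supnorm (I_op \<omega> f)"
    unfolding supnorm_def using I_op_le[OF assms] I_op_nonneg
    by (intro cSUP_upper bdd_aboveI2) auto
  then show ?thesis by simp
qed

lemma AP_measurable: "u \<in> AP \<Longrightarrow> u \<in> borel_measurable borel"
  by (rule borel_measurable_continuous_onI[OF AP_continuous])

lemma AP_bell: "(\<And>k. k \<in> {1..i} \<Longrightarrow> X k \<in> AP) \<Longrightarrow> (\<lambda>t. bell i (\<lambda>k. X k t)) \<in> AP"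
proof (induction i rule: less_induct)
  case (less i)
  show ?case
  proof (cases i)
    case 0
    then show ?thesis by (simp add: AP_const)
  next
    case (Suc m)
    then show ?thesis
      using less unfolding Suc bell.simps by (intro AP_sum AP_mult AP_const) auto
  qed
qed

lemma AP_f_bell: "(\<And>k. k \<in> {1..i} \<Longrightarrow> X k \<in> AP) \<Longrightarrow> (\<lambda>t. f_bell i (\<lambda>k. X k t)) \<in> AP"
  unfolding f_bell_eq by (intro AP_sum AP_mult AP_const AP_bell) auto

lemma AP_norm_bounded_measurable:
  assumes "u \<in> AP"
  shows "(\<lambda>s. of_real (c + cmod (u s)) :: complex) \<in> borel_measurable borel"
    and "\<exists>M. \<forall>s. cmod (of_real (c + cmod (u s))) \<le> M"
proof -
  show "(\<lambda>s. of_real (c + cmod (u s)) :: complex) \<in> borel_measurable borel"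
    using AP_measurable[OF assms] by measurable
  obtain B where B: "\<And>s. cmod (u s) \<le> B" using AP_bounded[OF assms] by blast
  have "cmod (of_real (c + cmod (u s))) \<le> \<bar>c\<bar> + B" for s
    using B[of s] abs_triangle_ineq[of c "cmod (u s)"] by (simp del: of_real_add)
  then show "\<exists>M. \<forall>s. cmod (of_real (c + cmod (u s))) \<le> M" by blast
qed

section \<open>The equation and its integral operator on states\<close>

locale perturbed_equation =
  fixes n :: nat and a :: "nat \<Rightarrow> complex" and r :: "nat \<Rightarrow> real \<Rightarrow> complex"
    and lam :: complex and \<gamma> :: "nat \<Rightarrow> complex"
  assumes n3: "n \<ge> 3"
    and an: "a n = 1"
    and r_less_AP: "\<And>i. i < n \<Longrightarrow> r i \<in> AP"
    and rn: "\<And>t. r n t = 0"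
    and root: "poly (Ppoly n a) lam = 0"
    and charpoly: "D_charpoly n a lam = (\<Prod>j=1..n-1. [:- \<gamma> j, 1:])"
    and inj: "inj_on \<gamma> {1..n-1}"
    and Re_nz: "\<And>j. j \<in> {1..n-1} \<Longrightarrow> Re (\<gamma> j) \<noteq> 0"
begin

text \<open>The state W stands for the tuple of derivatives (z, z', ...) of order up to n - 2, treated as
  independent functions: in these coordinates the integral operator involves no derivatives, and its
  fixed points turn out to be towers of derivatives.\<close>

definition state_forcing :: "(nat \<Rightarrow> real \<Rightarrow> complex) \<Rightarrow> real \<Rightarrow> complex" where
  "state_forcing W t = Pr n r lam t + (\<Sum>k=1..n-1. 1 / fact k * dPr k n r lam t * W (k - 1) t)
     + (\<Sum>i=2..n. \<Sum>j=0..n-i. of_nat ((i + j) choose j) * (a (i + j) + r (i + j) t) * lam ^ j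
        * f_bell (i - 1) (\<lambda>k. W (k - 1) t))"

text \<open>For almost periodic \<phi> and i \<le> n - 2 this is the derivative of order i of
  G[\<phi>], written without differentiation. At i = n - 1 the derivative is this expression plus
  \<phi>.\<close>

definition Gd :: "(real \<Rightarrow> complex) \<Rightarrow> nat \<Rightarrow> real \<Rightarrow> complex" where
  "Gd \<phi> i t = (\<Sum>j=1..n-1. \<gamma> j ^ i / Gam n \<gamma> j * G_op (\<gamma> j) \<phi> t)"

lemma forcing_eq: "forcing n a r lam z = state_forcing (\<lambda>i. nderiv i z)"
  by (simp add: fun_eq_iff forcing_def state_forcing_def L_op_def F_op_def)

text \<open>L reads the orders up to n - 2, and f_(i-1) with i \<le> n reads the orders up to i - 2.
  Components of the state beyond n - 2 may therefore be arbitrary.\<close>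

lemma state_forcing_cong:
  assumes "\<And>i. i \<le> n - 2 \<Longrightarrow> W i = V i" shows "state_forcing W = state_forcing V"
proof
  fix t
  have "(\<Sum>k=1..n-1. 1 / fact k * dPr k n r lam t * W (k - 1) t)
      = (\<Sum>k=1..n-1. 1 / fact k * dPr k n r lam t * V (k - 1) t)"
    by (intro sum.cong refl) (subst assms, auto)
  moreover have "f_bell (i - 1) (\<lambda>k. W (k - 1) t) = f_bell (i - 1) (\<lambda>k. V (k - 1) t)" if "i \<in> {2..n}" for i
    using that assms by (intro f_bell_cong) auto
  ultimately show "state_forcing W t = state_forcing V t"
    unfolding state_forcing_def by simp
qed

lemma r_AP: assumes "i \<le> n" shows "r i \<in> AP"
proof (cases "i = n")
  case True
  then have "r i = (\<lambda>_. 0)" using rn by auto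
  then show ?thesis by (simp add: AP_const)
qed (use assms r_less_AP in auto)

lemma dPr_AP: assumes "k \<le> n" shows "dPr k n r lam \<in> AP"
proof -
  have "dPr k n r lam = (\<lambda>t. fact k * (\<Sum>j=0..n-k. of_nat ((k + j) choose j) * r (k + j) t * lam ^ j))"
    using dP_over_fact[OF assms] by (simp add: fun_eq_iff dPr_def field_simps)
  then show ?thesis using assms by (auto intro!: AP_cmult AP_sum AP_mult AP_const r_AP)
qed

lemma state_forcing_AP:
  assumes "\<And>i. i \<le> n - 2 \<Longrightarrow> W i \<in> AP" shows "state_forcing W \<in> AP"
  unfolding state_forcing_def
  using assms n3 by (intro AP_add AP_sum AP_mult AP_const dPr_AP r_AP AP_f_bell) auto

lemma Gd_AP: "\<phi> \<in> AP \<Longrightarrow> Gd \<phi> i \<in> AP"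
  unfolding Gd_def[abs_def] using Re_nz by (intro AP_sum AP_cmult AP_G_op) auto

lemma sum_power_over_Gam:
  "i \<le> n - 2 \<Longrightarrow> (\<Sum>j=1..n-1. \<gamma> j ^ i / Gam n \<gamma> j) = (if i = n - 2 then 1 else 0)"
proof -
  assume "i \<le> n - 2"
  then have "i < card {1..n-1}" "Suc i = card {1..n-1} \<longleftrightarrow> i = n - 2" using n3 by auto
  with sum_power_over_lagrange[OF finite_atLeastAtMost inj this(1)] show ?thesis
    by (simp only: Gam_def)
qed

text \<open>Each Green operator contributes \<phi> + \<gamma>_j G_j \<phi>; the weights of \<phi>
  sum to 0 for i < n - 2 and to 1 for i = n - 2.\<close>

lemma Gd_has_vector_derivative:
  assumes \<phi>: "\<phi> \<in> AP" and i: "i \<le> n - 2"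
  shows "(Gd \<phi> i has_vector_derivative Gd \<phi> (Suc i) t + (if i = n - 2 then \<phi> t else 0)) (at t)"
proof -
  obtain M where M: "\<And>s. cmod (\<phi> s) \<le> M" using AP_bounded[OF \<phi>] by blast
  have "((\<lambda>t. \<Sum>j=1..n-1. \<gamma> j ^ i / Gam n \<gamma> j * G_op (\<gamma> j) \<phi> t) has_vector_derivative
      (\<Sum>j=1..n-1. \<gamma> j ^ i / Gam n \<gamma> j * (\<phi> t + \<gamma> j * G_op (\<gamma> j) \<phi> t))) (at t)"
    using Re_nz by (intro has_vector_derivative_sum has_vector_derivative_mult_right
        G_op_has_vector_derivative[where M=M] AP_continuous[OF \<phi>] M) auto
  moreover have "Gd \<phi> i = (\<lambda>t. \<Sum>j=1..n-1. \<gamma> j ^ i / Gam n \<gamma> j * G_op (\<gamma> j) \<phi> t)"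
    by (rule ext) (rule Gd_def)
  moreover have "(\<Sum>j=1..n-1. \<gamma> j ^ i / Gam n \<gamma> j * (\<phi> t + \<gamma> j * G_op (\<gamma> j) \<phi> t))
      = Gd \<phi> (Suc i) t + (\<Sum>j=1..n-1. \<gamma> j ^ i / Gam n \<gamma> j) * \<phi> t"
    unfolding Gd_def sum_distrib_right sum.distrib[symmetric]
    by (intro sum.cong refl) (simp add: algebra_simps)
  moreover have "(if i = n - 2 then 1 else 0) * \<phi> t = (if i = n - 2 then \<phi> t else 0)" by simp
  ultimately show ?thesis by (simp only: sum_power_over_Gam[OF i])
qed

lemma Gd_diff:
  assumes "\<phi> \<in> AP" "\<psi> \<in> AP"
  shows "Gd \<phi> i t - Gd \<psi> i t = Gd (\<lambda>s. \<phi> s - \<psi> s) i t"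
proof -
  obtain M N where "\<And>s. cmod (\<phi> s) \<le> M" "\<And>s. cmod (\<psi> s) \<le> N"
    using AP_bounded[OF assms(1)] AP_bounded[OF assms(2)] by metis
  then have "G_op (\<gamma> j) \<phi> t - G_op (\<gamma> j) \<psi> t = G_op (\<gamma> j) (\<lambda>s. \<phi> s - \<psi> s) t" if "j \<in> {1..n-1}" for j
    using that Re_nz assms by (intro G_op_diff) (auto intro: AP_measurable)
  then show ?thesis
    unfolding Gd_def sum_subtractf[symmetric] right_diff_distrib[symmetric] by (intro sum.cong refl) auto
qed

text \<open>Summation over i gathers the powers of |\<gamma>_j| into \<open>alpha_tilde\<close>, the
  weight occurring in both \<open>L_const\<close> and \<open>Q_const\<close>.\<close>

lemma sum_cmod_Gd_le:
  "(\<Sum>i=0..n-2. cmod (Gd \<phi> i t)) \<le> (\<Sum>j=1..n-1. alpha_tilde n \<gamma> j / cmod (Gam n \<gamma> j) * I_op (\<gamma> j) \<phi> t)"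
proof -
  have "(\<Sum>i=0..n-2. cmod (Gd \<phi> i t))
      \<le> (\<Sum>i=0..n-2. \<Sum>j=1..n-1. cmod (\<gamma> j) ^ i / cmod (Gam n \<gamma> j) * I_op (\<gamma> j) \<phi> t)"
    unfolding Gd_def
    by (intro sum_mono sum_norm_le) (auto simp: norm_mult norm_divide norm_power cmod_G_op_le_I_op intro!: mult_left_mono divide_right_mono)
  also have "\<dots> = (\<Sum>j=1..n-1. alpha_tilde n \<gamma> j / cmod (Gam n \<gamma> j) * I_op (\<gamma> j) \<phi> t)"
    unfolding alpha_tilde_def sum_divide_distrib sum_distrib_right by (rule sum.swap)
  finally show ?thesis .
qed

lemma shifted_0: "shifted \<gamma> 0 j = Re (\<gamma> j)"
  by (simp add: shifted_def)

lemma I_op_abs_coeff_le: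
  assumes j: "j \<in> {1..n-1}" and l: "l \<le> n"
  shows "I_op (\<gamma> j) (\<lambda>s. of_real (cmod (a l) + cmod (r l s))) t
    \<le> cmod (a l) / \<bar>shifted \<gamma> 0 j\<bar> + supnorm (I_op (of_real (shifted \<gamma> 0 j)) (\<lambda>s. of_real (cmod (r l s))))"
proof -
  note Rj = Re_nz[OF j]
  obtain M where M: "\<And>s. cmod (of_real (0 + cmod (r l s))) \<le> M"
    using AP_norm_bounded_measurable(2)[OF r_AP[OF l], of 0] by blast
  note rm = AP_norm_bounded_measurable(1)[OF r_AP[OF l], of 0, simplified]
  \<comment> \<open>Two summands indexed by \<open>bool\<close>: \<open>True\<close> is the constant
    function 1, to be weighted by |a_l|, and \<open>False\<close> is |r_l|.\<close>
  let ?u = "\<lambda>b s. if b then 1 else of_real (cmod (r l s)) :: complex"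
  have "I_op (\<gamma> j) (\<lambda>s. of_real (cmod (a l) + cmod (r l s))) t
      \<le> (\<Sum>b\<in>UNIV. (if b then cmod (a l) else 1) * I_op (\<gamma> j) (?u b) t)"
    using M Rj AP_norm_bounded_measurable(1)[OF r_AP[OF l], of "cmod (a l)"] rm
    by (intro I_op_sum_le[where M="\<lambda>b. if b then 1 else M"])
      (auto simp: UNIV_bool simp del: of_real_add)
  also have "\<dots> = cmod (a l) * I_op (\<gamma> j) (\<lambda>_. 1) t + I_op (\<gamma> j) (\<lambda>s. of_real (cmod (r l s))) t"
    by (simp add: UNIV_bool)
  also have "\<dots> \<le> cmod (a l) * (1 / \<bar>Re (\<gamma> j)\<bar>)
      + supnorm (I_op (of_real (Re (\<gamma> j))) (\<lambda>s. of_real (cmod (r l s))))"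
  proof (intro add_mono mult_left_mono)
    show "I_op (\<gamma> j) (\<lambda>_. 1) t \<le> 1 / \<bar>Re (\<gamma> j)\<bar>" using Rj by (intro I_op_le) auto
    show "I_op (\<gamma> j) (\<lambda>s. of_real (cmod (r l s))) t
        \<le> supnorm (I_op (of_real (Re (\<gamma> j))) (\<lambda>s. of_real (cmod (r l s))))"
      unfolding I_op_Re[OF Rj, symmetric] using Rj rm M by (intro I_op_le_supnorm[of _ _ M]) auto
  qed simp
  finally show ?thesis by (simp add: shifted_0)
qed

text \<open>The difference of the forcings splits into a linear part h1, whose estimate is L_0, and
  a Bell part h2. In h2 the Lipschitz bound supplies m(\<delta>), and the coefficients integrated
  against the kernels add up to Q_0.\<close>

lemma state_contraction:
  assumes W: "\<And>i. i \<le> n - 2 \<Longrightarrow> W i \<in> AP" and V: "\<And>i. i \<le> n - 2 \<Longrightarrow> V i \<in> AP" and \<delta>: "0 < \<delta>"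
    and Wb: "\<And>s. (\<Sum>i=0..n-2. cmod (W i s)) \<le> \<delta>" and Vb: "\<And>s. (\<Sum>i=0..n-2. cmod (V i s)) \<le> \<delta>"
    and D: "\<And>s. (\<Sum>i=0..n-2. cmod (W i s - V i s)) \<le> D"
  shows "(\<Sum>i=0..n-2. cmod (Gd (state_forcing W) i t - Gd (state_forcing V) i t))
    \<le> (L_const n r lam \<gamma> 0 + m_fun n \<delta> * Q_const n a r lam \<gamma> 0) * D"
proof -
  have D0: "0 \<le> D" by (rule order_trans[OF _ D[of 0]]) (simp add: sum_nonneg)
  have m0: "0 \<le> m_fun n \<delta>" using m_fun_ge[of n \<delta>] n3 \<delta> by simp
  let ?m = "m_fun n \<delta>"
  define h1 where "h1 = (\<lambda>s. \<Sum>k=1..n-1. 1 / fact k * dPr k n r lam s * (W (k - 1) s - V (k - 1) s))"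
  define h2 where "h2 = (\<lambda>s. \<Sum>i=2..n. \<Sum>j=0..n-i. of_nat ((i + j) choose j) * (a (i + j) + r (i + j) s) * lam ^ j
        * (f_bell (i - 1) (\<lambda>k. W (k - 1) s) - f_bell (i - 1) (\<lambda>k. V (k - 1) s)))"
  have h: "state_forcing W s - state_forcing V s = h1 s + h2 s" for s
    unfolding state_forcing_def h1_def h2_def right_diff_distrib sum_subtractf by simp
  have diffAP: "(\<lambda>s. W i s - V i s) \<in> AP" if "i \<le> n - 2" for i
    using AP_add[OF W[OF that] AP_cmult[OF V[OF that], of "-1"]] by simp
  have h1AP: "h1 \<in> AP" unfolding h1_def
    using n3 by (intro AP_sum AP_mult AP_const dPr_AP diffAP) auto
  have h2AP: "h2 \<in> AP"
  proof -
    have "(\<lambda>s. f_bell (i - 1) (\<lambda>k. W (k - 1) s) - f_bell (i - 1) (\<lambda>k. V (k - 1) s)) \<in> AP" if "i \<in> {2..n}" for i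
    proof -
      have "(\<lambda>s. f_bell (i - 1) (\<lambda>k. W (k - 1) s)) \<in> AP" "(\<lambda>s. f_bell (i - 1) (\<lambda>k. V (k - 1) s)) \<in> AP"
        using that W V by (auto intro!: AP_f_bell)
      from AP_add[OF this(1) AP_cmult[OF this(2), of "-1"]] show ?thesis by simp
    qed
    then show ?thesis unfolding h2_def by (intro AP_sum AP_mult AP_const AP_add r_AP) auto
  qed
  have W1: "cmod (W i s - V i s) \<le> D" if "i \<le> n - 2" for i s
    using member_le_sum[of i "{0..n-2}" "\<lambda>i. cmod (W i s - V i s)"] D[of s] that by simp
  \<comment> \<open>The i - 1 variables of f_(i-1) are the components of order 0, ..., i - 2, so
    their l1-norm is part of the norm of the state.\<close>
  have part: "(\<Sum>k=1..i-1. g (k - 1)) \<le> (\<Sum>k=0..n-2. g k)" if "i \<in> {2..n}" "\<And>k. 0 \<le> g k" for i and g :: "nat \<Rightarrow> real"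
  proof -
    have "(\<Sum>k=1..i-1. g (k - 1)) = (\<Sum>k=0..i-2. g k)"
      using that(1) by (intro sum.reindex_bij_witness[of _ Suc "\<lambda>k. k - 1"]) auto
    also have "\<dots> \<le> (\<Sum>k=0..n-2. g k)" using that by (intro sum_mono2) auto
    finally show ?thesis .
  qed
  have fb: "cmod (f_bell (i - 1) (\<lambda>k. W (k - 1) s) - f_bell (i - 1) (\<lambda>k. V (k - 1) s)) \<le> ?m * D"
    if i: "i \<in> {2..n}" for i s
  proof -
    have "cmod (f_bell (i - 1) (\<lambda>k. W (k - 1) s) - f_bell (i - 1) (\<lambda>k. V (k - 1) s))
        \<le> ?m * (\<Sum>k=1..i-1. cmod (W (k - 1) s - V (k - 1) s))"
      using i n3 \<delta> part[OF i, of "\<lambda>k. cmod (W k s)"] part[OF i, of "\<lambda>k. cmod (V k s)"] Wb[of s] Vb[of s]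
      by (intro f_bell_le_m_fun) auto
    also have "\<dots> \<le> ?m * D"
      using part[OF i, of "\<lambda>k. cmod (W k s - V k s)"] D[of s] m0 by (intro mult_left_mono) auto
    finally show ?thesis .
  qed
  have I1: "I_op (\<gamma> j) h1 t \<le> D * (\<Sum>k=1..n-1. 1 / fact k * supnorm (I_op (of_real (shifted \<gamma> 0 j)) (dPr k n r lam)))"
    if j: "j \<in> {1..n-1}" for j
  proof -
    note Rj = Re_nz[OF j]
    have "\<forall>k. \<exists>M. k \<le> n \<longrightarrow> (\<forall>s. cmod (dPr k n r lam s) \<le> M)" using AP_bounded[OF dPr_AP] by metis
    then obtain M where M: "\<And>k s. k \<le> n \<Longrightarrow> cmod (dPr k n r lam s) \<le> M k" by metis
    have "cmod (h1 s) \<le> (\<Sum>k=1..n-1. D / fact k * cmod (dPr k n r lam s))" for s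
      unfolding h1_def
    proof (rule sum_norm_le)
      fix k assume "k \<in> {1..n-1}"
      then have "cmod (W (k - 1) s - V (k - 1) s) \<le> D" by (intro W1) auto
      from mult_left_mono[OF this, of "cmod (dPr k n r lam s) / fact k"]
      show "cmod (1 / fact k * dPr k n r lam s * (W (k - 1) s - V (k - 1) s)) \<le> D / fact k * cmod (dPr k n r lam s)"
        by (simp add: norm_mult norm_divide mult_ac)
    qed
    then have "I_op (\<gamma> j) h1 t \<le> (\<Sum>k=1..n-1. D / fact k * I_op (\<gamma> j) (dPr k n r lam) t)"
      using D0 M Rj by (intro I_op_sum_le[where M=M] AP_measurable dPr_AP h1AP) auto
    also have "\<dots> \<le> (\<Sum>k=1..n-1. D / fact k * supnorm (I_op (of_real (shifted \<gamma> 0 j)) (dPr k n r lam)))"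
      unfolding shifted_0 I_op_Re[OF Rj, symmetric]
      using D0 Rj by (intro sum_mono mult_left_mono I_op_le_supnorm[OF _ AP_measurable[OF dPr_AP] M]) auto
    finally show ?thesis by (simp add: sum_distrib_left)
  qed
  have I2: "I_op (\<gamma> j) h2 t \<le> ?m * D * (\<Sum>l=2..n. \<Sum>k=0..l-2. of_nat (l choose k) * cmod lam ^ k *
        (cmod (a l) / \<bar>shifted \<gamma> 0 j\<bar> + supnorm (I_op (of_real (shifted \<gamma> 0 j)) (\<lambda>s. of_real (cmod (r l s))))))"
    (is "_ \<le> _ * D * (\<Sum>l=2..n. \<Sum>k=0..l-2. _ l k * ?X l)")
    if j: "j \<in> {1..n-1}" for j
  proof -
    \<comment> \<open>The index pairs (l, k) of \<open>Q_const\<close>, flattened; in terms of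
      \<open>F_op\<close> they are l = i + j and k = j.\<close>
    let ?A = "Sigma {2..n} (\<lambda>l. {0..l-2})"
    let ?u = "\<lambda>l s. of_real (cmod (a l) + cmod (r l s)) :: complex"
    let ?c = "\<lambda>(l, k). ?m * D * (real (l choose k) * cmod lam ^ k)"
    have c0: "0 \<le> ?c x" for x using m0 D0 by (auto split: prod.split)
    have "\<forall>l. \<exists>M. l \<le> n \<longrightarrow> (\<forall>s. cmod (?u l s) \<le> M)"
      using AP_norm_bounded_measurable(2)[OF r_AP] by blast
    then obtain M where M: "\<And>l s. l \<le> n \<Longrightarrow> cmod (?u l s) \<le> M l" by metis
    have "cmod (h2 s) \<le> (\<Sum>x\<in>?A. ?c x * cmod (?u (fst x) s))" for s
    proof -
      have "cmod (h2 s) \<le> (\<Sum>i=2..n. \<Sum>k=0..n-i. ?m * D * (real ((i + k) choose k) * cmod lam ^ k) * cmod (?u (i + k) s))"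
        unfolding h2_def
      proof (intro sum_norm_le)
        fix i k assume i: "i \<in> {2..n}"
        have "cmod (a (i + k) + r (i + k) s) \<le> cmod (?u (i + k) s)"
          using norm_triangle_ineq[of "a (i + k)" "r (i + k) s"] by (simp del: of_real_add)
        then have "real ((i + k) choose k) * cmod (a (i + k) + r (i + k) s) * cmod lam ^ k
            * cmod (f_bell (i - 1) (\<lambda>k. W (k - 1) s) - f_bell (i - 1) (\<lambda>k. V (k - 1) s))
          \<le> real ((i + k) choose k) * cmod (?u (i + k) s) * cmod lam ^ k * (?m * D)"
          using fb[OF i] by (intro mult_mono) auto
        then show "cmod (of_nat ((i + k) choose k) * (a (i + k) + r (i + k) s) * lam ^ k
            * (f_bell (i - 1) (\<lambda>k. W (k - 1) s) - f_bell (i - 1) (\<lambda>k. V (k - 1) s)))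
          \<le> ?m * D * (real ((i + k) choose k) * cmod lam ^ k) * cmod (?u (i + k) s)"
          by (simp only: norm_mult norm_power norm_of_nat mult_ac)
      qed
      also have "\<dots> = (\<Sum>x\<in>?A. ?c x * cmod (?u (fst x) s))"
        unfolding sum_triangle_shift[of "\<lambda>l k. ?m * D * (real (l choose k) * cmod lam ^ k) * cmod (?u l s)"]
        by (subst sum.Sigma) (auto intro!: sum.cong)
      finally show ?thesis .
    qed
    then have "I_op (\<gamma> j) h2 t \<le> (\<Sum>x\<in>?A. ?c x * I_op (\<gamma> j) (?u (fst x)) t)"
      using c0 M Re_nz[OF j] AP_norm_bounded_measurable(1)[OF r_AP]
      by (intro I_op_sum_le[where M="\<lambda>x. M (fst x)"] AP_measurable[OF h2AP]) auto
    also have "\<dots> \<le> (\<Sum>x\<in>?A. ?c x * ?X (fst x))"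
      using j by (intro sum_mono mult_left_mono c0 I_op_abs_coeff_le) auto
    also have "\<dots> = ?m * D * (\<Sum>l=2..n. \<Sum>k=0..l-2. of_nat (l choose k) * cmod lam ^ k * ?X l)"
      unfolding sum_distrib_left by (subst sum.Sigma) (auto intro!: sum.cong)
    finally show ?thesis .
  qed
  have I12: "I_op (\<gamma> j) (\<lambda>s. state_forcing W s - state_forcing V s) t \<le> I_op (\<gamma> j) h1 t + I_op (\<gamma> j) h2 t"
    if j: "j \<in> {1..n-1}" for j
  proof -
    obtain M1 M2 where M: "\<And>s. cmod (h1 s) \<le> M1" "\<And>s. cmod (h2 s) \<le> M2"
      using AP_bounded[OF h1AP] AP_bounded[OF h2AP] by metis
    have "I_op (\<gamma> j) (\<lambda>s. h1 s + h2 s) t \<le> (\<Sum>b\<in>UNIV. 1 * I_op (\<gamma> j) (if b then h1 else h2) t)"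
      using M Re_nz[OF j] AP_measurable[OF h1AP] AP_measurable[OF h2AP]
      by (intro I_op_sum_le[where M="\<lambda>b. if b then M1 else M2"]) (auto simp: UNIV_bool norm_triangle_ineq add.commute)
    then show ?thesis by (simp add: UNIV_bool h)
  qed
  have at0: "0 \<le> alpha_tilde n \<gamma> j / cmod (Gam n \<gamma> j)" for j
    by (simp add: alpha_tilde_def sum_nonneg)
  have "(\<Sum>i=0..n-2. cmod (Gd (state_forcing W) i t - Gd (state_forcing V) i t))
    \<le> (\<Sum>j=1..n-1. alpha_tilde n \<gamma> j / cmod (Gam n \<gamma> j) * I_op (\<gamma> j) (\<lambda>s. state_forcing W s - state_forcing V s) t)"
  proof -
    have "state_forcing W \<in> AP" "state_forcing V \<in> AP" by (intro state_forcing_AP W V; assumption)+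
    then show ?thesis by (simp only: Gd_diff sum_cmod_Gd_le)
  qed
  also have "\<dots> \<le> (\<Sum>j=1..n-1. alpha_tilde n \<gamma> j / cmod (Gam n \<gamma> j) *
      (D * (\<Sum>k=1..n-1. 1 / fact k * supnorm (I_op (of_real (shifted \<gamma> 0 j)) (dPr k n r lam)))
       + ?m * D * (\<Sum>l=2..n. \<Sum>k=0..l-2. of_nat (l choose k) * cmod lam ^ k *
        (cmod (a l) / \<bar>shifted \<gamma> 0 j\<bar> + supnorm (I_op (of_real (shifted \<gamma> 0 j)) (\<lambda>s. of_real (cmod (r l s))))))))"
    by (intro sum_mono mult_left_mono at0 order_trans[OF I12 add_mono[OF I1 I2]])
  also have "\<dots> = (L_const n r lam \<gamma> 0 + ?m * Q_const n a r lam \<gamma> 0) * D"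
  proof -
    have "0 \<le> alpha_tilde n \<gamma> j" for j by (simp add: alpha_tilde_def sum_nonneg)
    then have "L_const n r lam \<gamma> 0 = (\<Sum>j=1..n-1. alpha_tilde n \<gamma> j / cmod (Gam n \<gamma> j) *
        (\<Sum>k=1..n-1. 1 / fact k * supnorm (I_op (of_real (shifted \<gamma> 0 j)) (dPr k n r lam))))"
      unfolding L_const_def sum_distrib_left by (simp add: norm_divide norm_mult)
    moreover have "Q_const n a r lam \<gamma> 0 = (\<Sum>j=1..n-1. alpha_tilde n \<gamma> j / cmod (Gam n \<gamma> j) *
      (\<Sum>l=2..n. \<Sum>k=0..l-2. of_nat (l choose k) * cmod lam ^ k *
        (cmod (a l) / \<bar>shifted \<gamma> 0 j\<bar> + supnorm (I_op (of_real (shifted \<gamma> 0 j)) (\<lambda>s. of_real (cmod (r l s)))))))"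
      unfolding Q_const_def sum_distrib_left by (simp only: mult.assoc)
    ultimately show ?thesis
      by (simp only: distrib_left distrib_right sum.distrib sum_distrib_right sum_distrib_left mult_ac)
  qed
  finally show ?thesis .
qed

end

subsection \<open>Towers of derivatives\<close>

text \<open>Keeps the derivatives as explicit functions, so that the calculus is done with
  \<open>has_vector_derivative\<close>; \<open>deriv_tower_nderiv\<close> and
  \<open>deriv_tower_times_differentiable\<close> translate the result.\<close>

definition deriv_tower :: "nat \<Rightarrow> (nat \<Rightarrow> real \<Rightarrow> complex) \<Rightarrow> bool" where
  "deriv_tower N Z \<longleftrightarrow> (\<forall>i<N. \<forall>t. (Z i has_vector_derivative Z (Suc i) t) (at t))"

lemma deriv_tower_nderiv: "deriv_tower N Z \<Longrightarrow> i \<le> N \<Longrightarrow> nderiv i (Z 0) = Z i"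
proof (induction i)
  case (Suc i)
  then have "nderiv i (Z 0) = Z i" by simp
  then have "nderiv (Suc i) (Z 0) = (\<lambda>t. vector_derivative (Z i) (at t))" by (simp add: nderiv_def)
  then show ?case using Suc.prems by (auto simp: deriv_tower_def fun_eq_iff vector_derivative_at)
qed (simp add: nderiv_def)

lemma deriv_tower_times_differentiable: "deriv_tower N Z \<Longrightarrow> times_differentiable N (Z 0)"
  unfolding times_differentiable_def
  by (metis deriv_tower_def deriv_tower_nderiv differentiableI_vector less_imp_le)

text \<open>The Leibniz rule; each level differentiates to the next by Pascal's identity.\<close>

lemma deriv_tower_mult:
  assumes "deriv_tower N U" "deriv_tower N V"
  shows "deriv_tower N (\<lambda>k t. \<Sum>j\<le>k. of_nat (k choose j) * U j t * V (k - j) t)"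
  unfolding deriv_tower_def
proof (intro allI impI)
  fix k t assume k: "k < N"
  have "((\<lambda>t. \<Sum>j\<le>k. of_nat (k choose j) * U j t * V (k - j) t) has_vector_derivative
    (\<Sum>j\<le>k. (of_nat (k choose j) * U j t) * V (Suc (k - j)) t + (of_nat (k choose j) * U (Suc j) t) * V (k - j) t)) (at t)"
    using assms k unfolding deriv_tower_def
    by (intro has_vector_derivative_sum has_vector_derivative_mult has_vector_derivative_mult_right) auto
  also have "(\<Sum>j\<le>k. (of_nat (k choose j) * U j t) * V (Suc (k - j)) t + (of_nat (k choose j) * U (Suc j) t) * V (k - j) t)
    = (\<Sum>j\<le>Suc k. of_nat (Suc k choose j) * U j t * V (Suc k - j) t)"
  proof -
    have "(\<Sum>j\<le>Suc k. of_nat (Suc k choose j) * U j t * V (Suc k - j) t)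
      = U 0 t * V (Suc k) t + (\<Sum>j\<le>k. of_nat (Suc k choose Suc j) * U (Suc j) t * V (k - j) t)"
      by (subst sum.atMost_Suc_shift) simp
    also have "\<dots> = (U 0 t * V (Suc k) t + (\<Sum>j\<le>k. of_nat (k choose Suc j) * U (Suc j) t * V (k - j) t))
        + (\<Sum>j\<le>k. of_nat (k choose j) * U (Suc j) t * V (k - j) t)"
      by (simp add: algebra_simps sum.distrib)
    also have "U 0 t * V (Suc k) t + (\<Sum>j\<le>k. of_nat (k choose Suc j) * U (Suc j) t * V (k - j) t)
        = (\<Sum>j\<le>Suc k. of_nat (k choose j) * U j t * V (Suc k - j) t)"
      by (subst sum.atMost_Suc_shift) simp
    also have "\<dots> = (\<Sum>j\<le>k. of_nat (k choose j) * U j t * V (Suc (k - j)) t)"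
      by (simp add: binomial_eq_0 Suc_diff_le)
    finally show ?thesis by (simp add: sum.distrib)
  qed
  finally show "((\<lambda>t. \<Sum>j\<le>k. of_nat (k choose j) * U j t * V (k - j) t) has_vector_derivative
      (\<Sum>j\<le>Suc k. of_nat (Suc k choose j) * U j t * V (Suc k - j) t)) (at t)" .
qed

lemma deriv_tower_mono: "deriv_tower N Z \<Longrightarrow> M \<le> N \<Longrightarrow> deriv_tower M Z"
  by (auto simp: deriv_tower_def)

text \<open>Since w' = z w, the Leibniz rule turns the recursion of the Bell polynomials into the
  formula for the derivatives of w = exp (integral of z).\<close>

lemma deriv_tower_bell:
  assumes Z: "deriv_tower N Z" and w: "\<And>t. (w has_vector_derivative Z 0 t * w t) (at t)"
  shows "deriv_tower (Suc N) (\<lambda>k t. w t * bell k (\<lambda>j. Z (j - 1) t))"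
proof -
  define V where "V = (\<lambda>k t. w t * bell k (\<lambda>j. Z (j - 1) t))"
  \<comment> \<open>Level k + 1 of V is level k of the Leibniz product of Z and V. A tower V of
    height k thus extends itself by one level.\<close>
  have V_Suc: "V (Suc k) = (\<lambda>t. \<Sum>j\<le>k. of_nat (k choose j) * Z j t * V (k - j) t)" for k
    by (simp add: V_def fun_eq_iff sum_distrib_left mult_ac)
  have "k \<le> Suc N \<Longrightarrow> deriv_tower k V" for k
  proof (induction k)
    case (Suc k)
    have "(V k has_vector_derivative V (Suc k) t) (at t)" for t
    proof (cases k)
      case 0
      have "(V 0 has_vector_derivative Z 0 t * w t) (at t)" using w[of t] by (simp add: V_def)
      then show ?thesis by (simp add: 0 V_Suc) (simp add: V_def)
    next
      case (Suc m)
      have "deriv_tower (Suc m) V" "deriv_tower (Suc m) Z"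
        using Suc.IH Suc.prems Suc deriv_tower_mono[OF Z] by auto
      from deriv_tower_mult[OF this(2,1)] show ?thesis
        unfolding Suc V_Suc deriv_tower_def by blast
    qed
    then show ?case using Suc by (auto simp: deriv_tower_def less_Suc_eq)
  qed (simp add: deriv_tower_def)
  then show ?thesis by (simp add: V_def)
qed

lemma deriv_tower_exp: "deriv_tower N (\<lambda>k t. c ^ k * exp (c * of_real t))"
  unfolding deriv_tower_def
  by (auto intro!: has_vector_derivative_real_field derivative_eq_intros)

subsection \<open>Fixed point of the integral operator\<close>

context perturbed_equation
begin

abbreviation "state_map W i t \<equiv> - Gd (state_forcing W) i t"

lemma state_map_AP: "(\<And>i. i \<le> n - 2 \<Longrightarrow> W i \<in> AP) \<Longrightarrow> state_map W i \<in> AP"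
  using AP_cmult[OF Gd_AP[OF state_forcing_AP], of W "-1"] by simp

lemma state_forcing_0: "state_forcing (\<lambda>_ _. 0) = Pr n r lam"
  by (simp add: fun_eq_iff state_forcing_def f_bell_zero)

lemma sum_cmod_Gd_Pr_le: "(\<Sum>i=0..n-2. cmod (Gd (Pr n r lam) i t)) \<le> H_const n r lam \<gamma>"
proof -
  let ?P = "Pr n r lam"
  have P: "?P \<in> AP" using dPr_AP by simp
  \<comment> \<open>Identifies the derivatives in \<open>H_const\<close> with explicit, bounded
    functions.\<close>
  have "deriv_tower (n - 2) (Gd ?P)"
    unfolding deriv_tower_def
  proof (intro allI impI)
    fix i t assume "i < n - 2"
    then show "(Gd ?P i has_vector_derivative Gd ?P (Suc i) t) (at t)"
      using Gd_has_vector_derivative[OF P, of i t] by simp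
  qed
  note nd = deriv_tower_nderiv[OF this]
  have G: "G_tot n \<gamma> ?P = Gd ?P 0" by (simp add: fun_eq_iff G_tot_def Gd_def)
  have H: "H_const n r lam \<gamma> = supnorm (\<lambda>t. \<Sum>i=0..n-2. cmod (Gd ?P i t))"
    unfolding H_const_def G by (simp add: nd)
  have "\<forall>i. \<exists>B. \<forall>t. cmod (Gd ?P i t) \<le> B" using AP_bounded[OF Gd_AP[OF P]] by metis
  then obtain B where B: "\<And>i t. cmod (Gd ?P i t) \<le> B i" by metis
  have "norm (\<Sum>i=0..n-2. cmod (Gd ?P i t)) \<le> (\<Sum>i=0..n-2. B i)" for t
    using B by (auto intro!: sum_mono simp: sum_nonneg)
  then have "norm (\<Sum>i=0..n-2. cmod (Gd ?P i t)) \<le> H_const n r lam \<gamma>"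
    unfolding H supnorm_def by (intro cSUP_upper bdd_aboveI2) auto
  then show ?thesis by (simp add: sum_nonneg)
qed

text \<open>The summand j = 1, i = n, k = 0 is positive because a_n = 1. Positivity makes (1 -
  L_0)/Q_0 a genuine level for m.\<close>

lemma Q_const_pos: "0 < Q_const n a r lam \<gamma> 0"
proof -
  have at: "1 \<le> alpha_tilde n \<gamma> j" for j
    using member_le_sum[of 0 "{0..n-2}" "\<lambda>i. cmod (\<gamma> j) ^ i"] by (simp add: alpha_tilde_def)
  have Gnz: "Gam n \<gamma> j \<noteq> 0" if "j \<in> {1..n-1}" for j
    using inj that by (auto simp: Gam_def inj_on_def)
  let ?X = "\<lambda>j i. cmod (a i) / \<bar>shifted \<gamma> 0 j\<bar> + supnorm (I_op (of_real (shifted \<gamma> 0 j)) (\<lambda>s. of_real (cmod (r i s))))"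
  \<comment> \<open>The bracket in \<open>Q_const\<close> is an upper bound of this nonnegative
    integral, which settles its sign without examining the supremum.\<close>
  have X0: "0 \<le> I_op (\<gamma> j) (\<lambda>s. of_real (cmod (a i) + cmod (r i s))) 0" for i j by (rule I_op_nonneg)
  have X: "0 \<le> ?X j i" if "j \<in> {1..n-1}" "i \<le> n" for j i
    using order_trans[OF X0 I_op_abs_coeff_le[OF that]] .
  have s0: "0 \<le> supnorm (I_op \<omega> (\<lambda>s. of_real (cmod (r n s))))" for \<omega>
    unfolding rn supnorm_def by (simp add: I_op_def)
  have Xn: "0 < ?X 1 n" 
    using Re_nz[of 1] n3 s0 by (intro add_pos_nonneg) (auto simp: an shifted_0)
  let ?g = "\<lambda>j i k. alpha_tilde n \<gamma> j / cmod (Gam n \<gamma> j) * of_nat (i choose k) * cmod lam ^ k * ?X j i"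
  have g0: "0 \<le> ?g j i k" if "j \<in> {1..n-1}" "i \<in> {2..n}" for j i k
    using that X[of j i] at[of j] by (intro mult_nonneg_nonneg divide_nonneg_nonneg) auto
  have "0 < ?g 1 n 0"
    using Xn at[of 1] Gnz[of 1] n3 by (intro mult_pos_pos divide_pos_pos) auto
  then show ?thesis
    unfolding Q_const_def using g0 n3
    by (intro sum_pos2[where i=1] sum_pos2[where i=n] sum_pos2[where i=0] sum_nonneg) auto
qed

text \<open>Picard iteration from the zero state. The norm \<open>nrm\<close> is pointwise in t and
  all bounds are uniform in t, so the components read by the forcing converge uniformly.\<close>

lemma fixed_point_exists_nontrivial:
  assumes L: "L_const n r lam \<gamma> 0 < 1" and H: "H_const n r lam \<gamma> \<le> H_bound n a r lam \<gamma>"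
  obtains W where "\<And>i. W i \<in> AP" "\<And>i. W i = state_map W i"
proof -
  obtain \<delta> where \<delta>: "0 < \<delta>" and q1: "L_const n r lam \<gamma> 0 + m_fun n \<delta> * Q_const n a r lam \<gamma> 0 < 1"
    and H\<delta>: "H_const n r lam \<gamma> \<le> (1 - L_const n r lam \<gamma> 0 - m_fun n \<delta> * Q_const n a r lam \<gamma> 0) * \<delta>"
    using exists_radius[OF _ L Q_const_pos H] n3 by auto
  define q where "q = L_const n r lam \<gamma> 0 + m_fun n \<delta> * Q_const n a r lam \<gamma> 0"
  define T where "T = (\<lambda>W i t. state_map W i t)"
  define nrm where "nrm = (\<lambda>(W :: nat \<Rightarrow> real \<Rightarrow> complex) t. \<Sum>i=0..n-2. cmod (W i t))"
  have nrm0: "0 \<le> nrm W t" for W t by (simp add: nrm_def sum_nonneg)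
  have comp: "cmod (W i t) \<le> nrm W t" if "i \<le> n - 2" for W i t
    unfolding nrm_def using that member_le_sum[of i "{0..n-2}" "\<lambda>i. cmod (W i t)"] by simp
  have TAP: "T W i \<in> AP" if "\<And>i. i \<le> n - 2 \<Longrightarrow> W i \<in> AP" for W i
    unfolding T_def using that by (rule state_map_AP)
  have contr: "nrm (\<lambda>i t. T W i t - T V i t) t \<le> q * D"
    if "\<And>i. i \<le> n - 2 \<Longrightarrow> W i \<in> AP" "\<And>i. i \<le> n - 2 \<Longrightarrow> V i \<in> AP" "\<And>s. nrm W s \<le> \<delta>" "\<And>s. nrm V s \<le> \<delta>"
      "\<And>s. nrm (\<lambda>i t. W i t - V i t) s \<le> D" for W V D t
  proof -
    have "nrm (\<lambda>i t. T W i t - T V i t) t = (\<Sum>i=0..n-2. cmod (Gd (state_forcing W) i t - Gd (state_forcing V) i t))"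
      unfolding nrm_def T_def by (intro sum.cong refl) (metis minus_diff_minus norm_minus_cancel)
    also have "\<dots> \<le> q * D"
      unfolding q_def using that unfolding nrm_def by (intro state_contraction \<delta>) auto
    finally show ?thesis .
  qed
  define Z0 where "Z0 = (\<lambda>(_::nat) (_::real). 0 :: complex)"
  have Z0: "Z0 i \<in> AP" "nrm Z0 s = 0" for i s by (simp_all add: Z0_def nrm_def AP_const)
  \<comment> \<open>The hypothesis on H leaves exactly the room that the triangle inequality against
    the zero state needs: q\<delta> + (1 - q)\<delta> = \<delta>.\<close>
  have T0: "nrm (T Z0) t \<le> (1 - q) * \<delta>" for t
    using sum_cmod_Gd_Pr_le[of t] H\<delta> by (simp add: nrm_def T_def Z0_def state_forcing_0 q_def algebra_simps)
  \<comment> \<open>The contraction estimate for the zero state and itself, with D = 1, reads 0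
    \<le> q.\<close>
  have "nrm (\<lambda>i t. T Z0 i t - T Z0 i t) 0 \<le> q * 1"
    using Z0 \<delta> by (intro contr) (auto simp: nrm_def)
  then have q0: "0 \<le> q" by (simp add: nrm_def)
  have ball: "nrm (T W) t \<le> \<delta>" if W: "\<And>i. i \<le> n - 2 \<Longrightarrow> W i \<in> AP" "\<And>s. nrm W s \<le> \<delta>" for W t
  proof -
    have "nrm (T W) t \<le> nrm (\<lambda>i t. T W i t - T Z0 i t) t + nrm (T Z0) t"
      unfolding nrm_def sum.distrib[symmetric] by (intro sum_mono) (metis diff_add_cancel norm_triangle_ineq)
    also have "nrm (\<lambda>i t. T W i t - T Z0 i t) t \<le> q * \<delta>"
      using W Z0 \<delta> by (intro contr) (auto simp: Z0_def)
    finally show ?thesis using T0[of t] by (simp add: algebra_simps)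
  qed
  define Wk where "Wk = rec_nat Z0 (\<lambda>_. T)"
  have Wk: "Wk 0 = Z0" "\<And>m. Wk (Suc m) = T (Wk m)" by (simp_all add: Wk_def)
  have Wk_AP: "Wk m i \<in> AP" for m i
    by (induction m arbitrary: i) (auto simp: Wk Z0 intro: TAP)
  have Wk_ball: "nrm (Wk m) t \<le> \<delta>" for m t
  proof (induction m arbitrary: t)
    case (Suc m)
    then show ?case unfolding Wk by (intro ball Wk_AP)
  qed (use Wk Z0 \<delta> in simp)
  have Wk_diff: "nrm (\<lambda>i t. Wk (Suc m) i t - Wk m i t) t \<le> q ^ m * \<delta>" for m t
  proof (induction m arbitrary: t)
    case 0
    show ?case using Wk_ball[of "Suc 0" t] by (simp add: Wk Z0_def)
  next
    case (Suc m)
    have "nrm (\<lambda>i t. T (Wk (Suc m)) i t - T (Wk m) i t) t \<le> q * (q ^ m * \<delta>)"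
      by (intro contr Wk_AP Wk_ball Suc.IH)
    then show ?case by (simp add: Wk)
  qed
  \<comment> \<open>The limit as a telescoping series starting from the zero state, so that the
    geometric bound feeds the Weierstrass test.\<close>
  define W' where "W' = (\<lambda>i t. \<Sum>m. Wk (Suc m) i t - Wk m i t)"
  have lim: "uniform_limit UNIV (\<lambda>m. Wk m i) (W' i) sequentially" if i: "i \<le> n - 2" for i
  proof -
    have "uniform_limit UNIV (\<lambda>N t. \<Sum>m<N. Wk (Suc m) i t - Wk m i t) (W' i) sequentially"
      unfolding W'_def
    proof (rule Weierstrass_m_test)
      show "norm (Wk (Suc m) i t - Wk m i t) \<le> q ^ m * \<delta>" for m t
        using comp[OF i, of "\<lambda>i t. Wk (Suc m) i t - Wk m i t" t] Wk_diff[of m t] by simp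
      show "summable (\<lambda>m. q ^ m * \<delta>)"
        using q0 q1 by (intro summable_mult2 summable_geometric) (simp add: q_def)
    qed
    moreover have "(\<Sum>m<N. Wk (Suc m) i t - Wk m i t) = Wk N i t" for N t
      using sum_lessThan_telescope[of "\<lambda>m. Wk m i t" N] by (simp add: Wk Z0_def)
    ultimately show ?thesis by simp
  qed
  have W'_AP: "W' i \<in> AP" if "i \<le> n - 2" for i
    by (rule AP_uniform_limit[OF Wk_AP lim[OF that]])
  have W'_lim: "(\<lambda>m. Wk m i t) \<longlonglongrightarrow> W' i t" if "i \<le> n - 2" for i t
    by (rule tendsto_uniform_limitI[OF lim[OF that]]) simp
  have W'_ball: "nrm W' t \<le> \<delta>" for t
  proof (rule tendsto_upperbound)
    show "(\<lambda>m. nrm (Wk m) t) \<longlonglongrightarrow> nrm W' t"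
      unfolding nrm_def by (intro tendsto_intros W'_lim) auto
  qed (simp_all add: Wk_ball)
  have W'_fix: "W' i t = T W' i t" if i: "i \<le> n - 2" for i t
  proof (rule LIMSEQ_unique)
    show "(\<lambda>m. Wk (Suc m) i t) \<longlonglongrightarrow> W' i t" using W'_lim[OF i] by (rule LIMSEQ_Suc)
    show "(\<lambda>m. Wk (Suc m) i t) \<longlonglongrightarrow> T W' i t"
    proof (rule metric_LIMSEQ_I)
      fix e :: real assume e: "0 < e"
      \<comment> \<open>The n - 1 components, each off by less than e/(2n), add up to at most
        e/2.\<close>
      have "\<forall>\<^sub>F m in sequentially. \<forall>k\<in>{0..n-2}. \<forall>s\<in>UNIV. dist (Wk m k s) (W' k s) < e / real (2 * n)"
        using e n3 by (intro eventually_ball_finite ballI uniform_limitD[OF lim]) auto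
      then obtain M where "\<forall>m\<ge>M. \<forall>k\<in>{0..n-2}. \<forall>s\<in>UNIV. dist (Wk m k s) (W' k s) < e / real (2 * n)"
        unfolding eventually_sequentially by blast
      then have M: "dist (Wk m k s) (W' k s) < e / real (2 * n)" if "m \<ge> M" "k \<le> n - 2" for m k s
        using that by simp
      have "dist (Wk (Suc m) i t) (T W' i t) < e" if m: "m \<ge> M" for m
      proof -
        have "nrm (\<lambda>i t. Wk m i t - W' i t) s \<le> e / 2" for s
        proof -
          have "nrm (\<lambda>i t. Wk m i t - W' i t) s \<le> (\<Sum>i=0..n-2. e / real (2 * n))"
            unfolding nrm_def using M[OF m] by (intro sum_mono less_imp_le) (auto simp: dist_norm)
          also have "\<dots> \<le> real n * (e / real (2 * n))"
            unfolding sum_constant using n3 e by (intro mult_right_mono) auto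
          also have "\<dots> = e / 2" using n3 by simp
          finally show ?thesis .
        qed
        then have "nrm (\<lambda>i t. T (Wk m) i t - T W' i t) t \<le> q * (e / 2)"
          by (intro contr Wk_AP W'_AP Wk_ball W'_ball)
        also have "\<dots> \<le> e / 2" using q0 q1 e by (intro mult_left_le_one_le) (auto simp: q_def)
        finally show ?thesis
          using comp[OF i, of "\<lambda>i t. T (Wk m) i t - T W' i t" t] e by (simp add: Wk dist_norm)
      qed
      then show "\<exists>M. \<forall>m\<ge>M. dist (Wk (Suc m) i t) (T W' i t) < e" by blast
    qed
  qed
  \<comment> \<open>W' is controlled only in the components up to n - 2. T W' agrees with it there,
    and the forcing reads nothing else, so T W' is a fixed point in all components.\<close>
  have "T (T W') = T W'"
    unfolding T_def by (subst state_forcing_cong[of _ W']) (use W'_fix in \<open>auto simp: T_def fun_eq_iff\<close>)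
  then have "T W' i = (\<lambda>t. state_map (T W') i t)" for i unfolding T_def by (simp add: fun_eq_iff)
  moreover have "T W' i \<in> AP" for i by (rule TAP) (rule W'_AP)
  ultimately show thesis by (intro that[of "T W'"])
qed

text \<open>If P(r; lam) vanishes identically, the estimates compare with the zero function and can
  hold only for z = 0. The zero state is then a fixed point and is chosen explicitly.\<close>

lemma fixed_point_exists:
  assumes "L_const n r lam \<gamma> 0 < 1" "H_const n r lam \<gamma> \<le> H_bound n a r lam \<gamma>"
  obtains W where "\<And>i. W i \<in> AP" "\<And>i. W i = state_map W i"
    "Pr n r lam = (\<lambda>_. 0) \<Longrightarrow> W = (\<lambda>_ _. 0)"
proof (cases "Pr n r lam = (\<lambda>_. 0)")
  case True
  have "Gd (\<lambda>_. 0) i = (\<lambda>_. 0)" for i by (simp add: fun_eq_iff Gd_def G_op_def)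
  then show ?thesis
    by (intro that[of "\<lambda>_ _. 0"]) (auto simp: True state_forcing_0 AP_const)
next
  case False
  with fixed_point_exists_nontrivial[OF assms] that show ?thesis by metis
qed

end

lemma bell_eq_f_bell: "1 \<le> i \<Longrightarrow> bell i x = x i + f_bell (i - 1) x"
  by (simp add: f_bell_def)

subsection \<open>Construction of the solution\<close>

context perturbed_equation
begin

lemma is_bigO_two_sided_average:
  assumes u: "u \<in> AP" "Pr n r lam = (\<lambda>_. 0) \<Longrightarrow> u = (\<lambda>_. 0)" and \<beta>: "0 < \<beta>"
  shows "is_bigO u (\<lambda>t. I_op (of_real \<beta>) (Pr n r lam) t + I_op (of_real (- \<beta>)) (Pr n r lam) t)"
proof (cases "Pr n r lam = (\<lambda>_. 0)")
  case True
  then show ?thesis using u(2) by (auto simp: is_bigO_def intro: exI[of _ 0])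
next
  case False
  then obtain t0 where "Pr n r lam t0 \<noteq> 0" by auto
  then obtain c where c: "0 < c"
    "\<And>t. c \<le> I_op (of_real \<beta>) (Pr n r lam) t + I_op (of_real (- \<beta>)) (Pr n r lam) t"
    using two_sided_average_lower_bound[OF dPr_AP _ \<beta>] by blast
  obtain B where B: "0 \<le> B" "\<And>t. cmod (u t) \<le> B" using AP_bounded[OF u(1)] by blast
  have "cmod (u t) \<le> B / c * (I_op (of_real \<beta>) (Pr n r lam) t + I_op (of_real (- \<beta>)) (Pr n r lam) t)" for t
  proof -
    have "cmod (u t) \<le> B / c * c" using B c(1) by simp
    also have "\<dots> \<le> B / c * (I_op (of_real \<beta>) (Pr n r lam) t + I_op (of_real (- \<beta>)) (Pr n r lam) t)"
      using B(1) c by (intro mult_left_mono) auto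
    finally show ?thesis .
  qed
  then show ?thesis unfolding is_bigO_def by blast
qed

text \<open>The leading coefficient of D is 1, so the extra term at order n - 1 contributes -
  \<phi>. The rest regroups into the values of the characteristic polynomial at its roots
  \<gamma>_j.\<close>

lemma D_op_Gd_tower:
  assumes "\<And>k. k \<in> {1..n} \<Longrightarrow> nderiv (k - 1) z t = - Gd \<phi> (k - 1) t - (if k = n then \<phi> t else 0)"
  shows "D_op n a lam z t = - \<phi> t"
proof -
  let ?d = "\<lambda>k. 1 / fact k * dP k n a lam"
  have dn: "?d n = 1" using dP_over_fact[of n n a lam] by (simp add: an)
  have "D_op n a lam z t = (\<Sum>k=1..n. ?d k * (- Gd \<phi> (k - 1) t - (if k = n then \<phi> t else 0)))"
    unfolding D_op_def by (intro sum.cong refl arg_cong2[where f="(*)"] assms)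
  also have "\<dots> = - (\<Sum>k=1..n. ?d k * Gd \<phi> (k - 1) t) - (\<Sum>k=1..n. if k = n then ?d n * \<phi> t else 0)"
    unfolding sum_negf[symmetric] sum_subtractf[symmetric]
    by (intro sum.cong refl) (auto simp: right_diff_distrib diff_divide_distrib)
  also have "(\<Sum>k=1..n. if k = n then ?d n * \<phi> t else 0) = \<phi> t" unfolding dn using n3 by simp
  also have "(\<Sum>k=1..n. ?d k * Gd \<phi> (k - 1) t)
      = (\<Sum>j=1..n-1. (\<Sum>k=1..n. ?d k * \<gamma> j ^ (k - 1)) * (1 / Gam n \<gamma> j * G_op (\<gamma> j) \<phi> t))"
    unfolding Gd_def sum_distrib_left sum_distrib_right
    by (subst sum.swap) (intro sum.cong refl, simp)
  also have "\<dots> = 0" using D_charpoly_root[OF _ charpoly] n3 by (intro sum.neutral) auto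
  finally show ?thesis by simp
qed

lemma has_vector_derivative_integral_0:
  fixes \<phi> :: "real \<Rightarrow> complex"
  assumes "continuous_on UNIV \<phi>"
  shows "((\<lambda>t. LBINT s=ereal 0..ereal t. \<phi> s) has_vector_derivative \<phi> t) (at t)"
proof -
  let ?a = "min 0 t - 1" and ?b = "max 0 t + 1"
  have "((\<lambda>t. LBINT s=ereal 0..ereal t. \<phi> s) has_vector_derivative \<phi> t) (at t within {?a..?b})"
    by (rule interval_integral_FTC2) (auto intro: continuous_on_subset[OF assms])
  then show ?thesis by (subst (asm) at_within_interior) auto
qed

text \<open>The sum of Green terms differentiates to - G[\<phi>] minus \<phi> times the sum of 1 /
  (\<Gamma>_j \<gamma>_j). By \<open>sum_inverse_over_lagrange\<close> the integral cancels the
  latter. For a fixed point the exponent is therefore a primitive of z.\<close>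

lemma exponent_has_vector_derivative:
  assumes \<phi>: "\<phi> \<in> AP"
  shows "((\<lambda>t. (-1) ^ n * (\<Prod>j=1..n-1. inverse (\<gamma> j)) * (LBINT s=ereal 0..ereal t. \<phi> s)
      + - (\<Sum>j=1..n-1. 1 / (Gam n \<gamma> j * \<gamma> j) * G_op (\<gamma> j) \<phi> t)) has_vector_derivative - Gd \<phi> 0 t) (at t)"
proof -
  have \<gamma>0: "\<gamma> j \<noteq> 0" if "j \<in> {1..n-1}" for j using Re_nz[OF that] by auto
  obtain M where M: "\<And>s. cmod (\<phi> s) \<le> M" using AP_bounded[OF \<phi>] by blast
  let ?p = "(-1) ^ n * (\<Prod>j=1..n-1. inverse (\<gamma> j))"
  have p: "(\<Sum>j=1..n-1. 1 / (Gam n \<gamma> j * \<gamma> j)) = ?p"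
    unfolding Gam_def using sum_inverse_over_lagrange[OF finite_atLeastAtMost inj _ \<gamma>0] n3 by simp
  have "(\<Sum>j=1..n-1. 1 / (Gam n \<gamma> j * \<gamma> j) * (\<phi> t + \<gamma> j * G_op (\<gamma> j) \<phi> t)) = ?p * \<phi> t + Gd \<phi> 0 t"
    unfolding p[symmetric] Gd_def sum_distrib_right sum.distrib[symmetric]
    using \<gamma>0 by (intro sum.cong refl) (simp add: distrib_left add_divide_distrib)
  then have e: "- Gd \<phi> 0 t = ?p * \<phi> t + - (\<Sum>j=1..n-1. 1 / (Gam n \<gamma> j * \<gamma> j) * (\<phi> t + \<gamma> j * G_op (\<gamma> j) \<phi> t))"
    by simp
  show ?thesis unfolding e
    using Re_nz by (intro has_vector_derivative_add has_vector_derivative_minus has_vector_derivative_sum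
        has_vector_derivative_mult_right has_vector_derivative_integral_0
        G_op_has_vector_derivative[where M=M] AP_continuous[OF \<phi>] M) auto
qed

text \<open>The left side is the equation divided by y. The coefficient S i of B_i is the Taylor
  coefficient of P(a + r; .) at lam, and B_i = x_i + f_(i-1) separates the linear operators from F.
  As lam is a root, S 0 reduces to P(r; lam).\<close>

lemma characteristic_sum_bell:
  fixes x :: "nat \<Rightarrow> complex"
  assumes x: "\<And>k. k \<in> {1..n} \<Longrightarrow> x k = nderiv (k - 1) z t"
  shows "(\<Sum>i=0..n. (a i + r i t) * (\<Sum>j\<le>i. of_nat (i choose j) * lam ^ j * bell (i - j) x))
    = D_op n a lam z t + Pr n r lam t + L_op n r lam z t + F_op n a r lam z t"
proof -
  define S where "S = (\<lambda>i. \<Sum>j=0..n-i. of_nat ((i + j) choose j) * (a (i + j) + r (i + j) t) * lam ^ j)"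
  have S: "S i = 1 / fact i * dP i n a lam + 1 / fact i * dPr i n r lam t" if "i \<le> n" for i
    unfolding dPr_def dP_over_fact[OF that] S_def sum.distrib[symmetric]
    by (intro sum.cong refl) (simp add: algebra_simps)
  have S0: "S 0 = Pr n r lam t" using root S[of 0] by (simp add: dP_def)
  have dPrn: "dPr n n r lam t = 0"
    using dP_over_fact[of n n "\<lambda>i. r i t" lam] by (simp add: dPr_def rn)
  have n1: "{1..n} = insert n {1..n-1}" "{1..n} = insert 1 {2..n}" "{0..n} = insert 0 {1..n}" using n3 by auto
  have "(\<Sum>i=0..n. (a i + r i t) * (\<Sum>j\<le>i. of_nat (i choose j) * lam ^ j * bell (i - j) x))
      = (\<Sum>i=0..n. \<Sum>j=0..i-0. of_nat (i choose j) * (a i + r i t) * lam ^ j * bell (i - j) x)"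
    unfolding sum_distrib_left atMost_atLeast0 by (simp add: mult_ac)
  also have "\<dots> = (\<Sum>i=0..n. \<Sum>j=0..n-i. of_nat ((i + j) choose j) * (a (i + j) + r (i + j) t) * lam ^ j * bell i x)"
    unfolding sum_triangle_shift[of "\<lambda>l j. of_nat (l choose j) * (a l + r l t) * lam ^ j * bell (l - j) x", symmetric]
    by simp
  also have "\<dots> = (\<Sum>i=0..n. S i * bell i x)" by (simp add: S_def sum_distrib_right)
  also have "\<dots> = S 0 + (\<Sum>i=1..n. S i * bell i x)" unfolding n1(3) by simp
  also have "(\<Sum>i=1..n. S i * bell i x) = (\<Sum>i=1..n. S i * x i) + (\<Sum>i=1..n. S i * f_bell (i - 1) x)"
    unfolding sum.distrib[symmetric] by (intro sum.cong refl) (simp add: bell_eq_f_bell algebra_simps)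
  also have "(\<Sum>i=1..n. S i * x i) = (\<Sum>i=1..n. 1 / fact i * dP i n a lam * nderiv (i - 1) z t)
      + (\<Sum>i=1..n. 1 / fact i * dPr i n r lam t * nderiv (i - 1) z t)"
    unfolding sum.distrib[symmetric] by (intro sum.cong refl) (simp add: S x algebra_simps)
  \<comment> \<open>L stops at order n - 1 because r_n = 0 makes the term i = n vanish.\<close>
  also have "(\<Sum>i=1..n. 1 / fact i * dPr i n r lam t * nderiv (i - 1) z t) = L_op n r lam z t"
    unfolding L_op_def n1(1) using n3 by (subst sum.insert) (auto simp: dPrn)
  also have "(\<Sum>i=1..n. S i * f_bell (i - 1) x) = F_op n a r lam z t"
  proof -
    have "f_bell (i - 1) x = f_bell (i - 1) (\<lambda>k. nderiv (k - 1) z t)" if "i \<in> {2..n}" for i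
      using that x by (intro f_bell_cong) auto
    moreover have "f_bell 0 x = 0" by (simp add: f_bell_eq)
    ultimately show ?thesis unfolding F_op_def n1(2) S_def sum_distrib_right by simp
  qed
  finally show ?thesis by (simp add: S0 D_op_def)
qed

lemma solution_exists:
  assumes L: "L_const n r lam \<gamma> 0 < 1" and H: "H_const n r lam \<gamma> \<le> H_bound n a r lam \<gamma>"
  shows "\<exists>y z.
     solves_E n a r y
   \<and> (\<forall>t. y t =
        exp (lam * of_real t)
        * exp ((-1) ^ n * (\<Prod>j=1..n-1. inverse (\<gamma> j))
               * (LBINT s=ereal 0..ereal t. forcing n a r lam z s))
        * exp (- (\<Sum>j=1..n-1. 1 / (Gam n \<gamma> j * \<gamma> j) * G_op (\<gamma> j) (forcing n a r lam z) t)))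
   \<and> z \<in> AP_diff (n - 2)
   \<and> times_differentiable (n - 1) z
   \<and> (\<forall>t. D_op n a lam z t + Pr n r lam t + L_op n r lam z t + F_op n a r lam z t = 0)
   \<and> (\<forall>t. z t = - G_tot n \<gamma> (forcing n a r lam z) t)
   \<and> (\<forall>\<beta>::real. 0 < \<beta> \<longrightarrow>
        (\<forall>i\<in>{0..n-2}. is_bigO (nderiv i z)
            (\<lambda>t. I_op (of_real \<beta>) (Pr n r lam) t + I_op (of_real (- \<beta>)) (Pr n r lam) t))
      \<and> (\<forall>i\<in>{1..n-1}. is_bigO (\<lambda>t. nderiv i y t / y t - lam ^ i)
            (\<lambda>t. I_op (of_real \<beta>) (Pr n r lam) t + I_op (of_real (- \<beta>)) (Pr n r lam) t)))"
proof -
  obtain W where W: "\<And>i. W i \<in> AP" "\<And>i. W i = state_map W i"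
    and W0: "Pr n r lam = (\<lambda>_. 0) \<Longrightarrow> W = (\<lambda>_ _. 0)"
    by (rule fixed_point_exists[OF L H]) (rule that)
  define \<phi> where "\<phi> = state_forcing W"
  have \<phi>: "\<phi> \<in> AP" unfolding \<phi>_def by (rule state_forcing_AP) (rule W(1))
  have WG: "W i t = - Gd \<phi> i t" for i t using fun_cong[OF W(2)[of i], of t] by (simp add: \<phi>_def)
  \<comment> \<open>Z agrees with the state W except at index n - 1, where the actual derivative of
    z contains the additional term - \<phi>.\<close>
  define Z where "Z = (\<lambda>i t. - Gd \<phi> i t - (if i = n - 1 then \<phi> t else 0))"
  have ZW: "Z i = W i" if "i \<le> n - 2" for i using that n3 by (auto simp: Z_def WG fun_eq_iff)
  have Ztower: "deriv_tower (n - 1) Z"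
    unfolding deriv_tower_def
  proof (intro allI impI)
    fix i t assume i: "i < n - 1"
    then have "Z i = (\<lambda>t. - Gd \<phi> i t)" by (auto simp: Z_def)
    moreover have "((\<lambda>t. - Gd \<phi> i t) has_vector_derivative - (Gd \<phi> (Suc i) t + (if i = n - 2 then \<phi> t else 0))) (at t)"
      using i by (intro has_vector_derivative_minus Gd_has_vector_derivative \<phi>) auto
    moreover have "- (Gd \<phi> (Suc i) t + (if i = n - 2 then \<phi> t else 0)) = Z (Suc i) t"
      using i by (auto simp: Z_def)
    ultimately show "(Z i has_vector_derivative Z (Suc i) t) (at t)" by simp
  qed
  define z where "z = Z 0"
  have nd: "nderiv i z = Z i" if "i \<le> n - 1" for i
    unfolding z_def by (rule deriv_tower_nderiv[OF Ztower that])
  have fz: "forcing n a r lam z = \<phi>"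
    unfolding forcing_eq \<phi>_def by (rule state_forcing_cong) (simp add: nd ZW)
  have eqD: "D_op n a lam z t + Pr n r lam t + L_op n r lam z t + F_op n a r lam z t = 0" for t
  proof -
    have "D_op n a lam z t = - \<phi> t"
      by (rule D_op_Gd_tower) (auto simp: nd Z_def)
    moreover have "Pr n r lam t + L_op n r lam z t + F_op n a r lam z t = \<phi> t"
      using fun_cong[OF fz, of t] by (simp add: forcing_def)
    ultimately show ?thesis by (simp only: add.assoc) simp
  qed
  define E where "E = (\<lambda>t. (-1) ^ n * (\<Prod>j=1..n-1. inverse (\<gamma> j)) * (LBINT s=ereal 0..ereal t. \<phi> s)
      + - (\<Sum>j=1..n-1. 1 / (Gam n \<gamma> j * \<gamma> j) * G_op (\<gamma> j) \<phi> t))"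
  define w where "w = (\<lambda>t. exp (E t))"
  have wd: "(w has_vector_derivative Z 0 t * w t) (at t)" for t
  proof -
    have "(E has_vector_derivative Z 0 t) (at t)"
      using exponent_has_vector_derivative[OF \<phi>, of t] n3 unfolding E_def by (simp add: Z_def)
    from field_vector_diff_chain_at[OF this DERIV_exp] show ?thesis by (simp add: w_def o_def)
  qed
  define y where "y = (\<lambda>t. exp (lam * of_real t) * w t)"
  have y0: "y t \<noteq> 0" for t by (simp add: y_def w_def)
  \<comment> \<open>The variable x_j is z^(j-1), and R i turns out to be y^(i)/y.\<close>
  define x where "x = (\<lambda>t j. Z (j - 1) t)"
  define R where "R = (\<lambda>i t. \<Sum>j\<le>i. of_nat (i choose j) * lam ^ j * bell (i - j) (x t))"
  have n1: "Suc (n - 1) = n" using n3 by simp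
  \<comment> \<open>The Leibniz product of the towers of exp (lam t) and of w.\<close>
  have "deriv_tower n (\<lambda>k t. \<Sum>j\<le>k. of_nat (k choose j) * (lam ^ j * exp (lam * of_real t)) * (w t * bell (k - j) (\<lambda>j. Z (j - 1) t)))"
    using deriv_tower_bell[OF Ztower wd] unfolding n1 by (intro deriv_tower_mult deriv_tower_exp)
  also have "(\<lambda>k t. \<Sum>j\<le>k. of_nat (k choose j) * (lam ^ j * exp (lam * of_real t)) * (w t * bell (k - j) (\<lambda>j. Z (j - 1) t)))
      = (\<lambda>k t. y t * R k t)"
    by (simp add: fun_eq_iff y_def R_def x_def sum_distrib_left mult_ac)
  finally have Ytower: "deriv_tower n (\<lambda>k t. y t * R k t)" .
  have R0: "(\<lambda>t. y t * R 0 t) = y" by (simp add: R_def)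
  have ndy: "nderiv i y t = y t * R i t" if "i \<le> n" for i t
    using fun_cong[OF deriv_tower_nderiv[OF Ytower that], of t] unfolding R0 .
  have E: "solves_E n a r y"
    unfolding solves_E_def
  proof (intro conjI allI)
    show "times_differentiable n y"
      using deriv_tower_times_differentiable[OF Ytower] unfolding R0 .
    fix t
    \<comment> \<open>Since a_n = 1 and r_n = 0, the leading derivative joins the sum as its term i
      = n.\<close>
    have "nderiv n y t + (\<Sum>i=0..n-1. (a i + r i t) * nderiv i y t) = (\<Sum>i=0..n. (a i + r i t) * nderiv i y t)"
      using sum.atLeast0_atMost_Suc[of "\<lambda>i. (a i + r i t) * nderiv i y t" "n - 1"] unfolding n1
      by (simp add: an rn)
    also have "\<dots> = y t * (\<Sum>i=0..n. (a i + r i t) * R i t)"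
      unfolding sum_distrib_left by (intro sum.cong refl) (simp add: ndy)
    also have "(\<Sum>i=0..n. (a i + r i t) * R i t) = 0"
      unfolding R_def using eqD[of t] by (subst characteristic_sum_bell[where z=z]) (auto simp: x_def nd)
    finally show "nderiv n y t + (\<Sum>i=0..n-1. (a i + r i t) * nderiv i y t) = 0" by simp
  qed
  have z0: "nderiv i z \<in> AP" "Pr n r lam = (\<lambda>_. 0) \<Longrightarrow> nderiv i z = (\<lambda>_. 0)" if "i \<le> n - 2" for i
    using that W(1)[of i] W0 by (simp_all add: nd ZW)
  \<comment> \<open>The summand j = i of R i is lam^i. The rest consists of Bell polynomials of
    positive index in z, ..., z^(n-2): almost periodic, and zero when these functions are.\<close>
  have quot: "nderiv i y t / y t - lam ^ i = (\<Sum>j<i. of_nat (i choose j) * lam ^ j * bell (i - j) (x t))"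
    if "i \<in> {1..n-1}" for i t
  proof -
    have "R i t = (\<Sum>j<i. of_nat (i choose j) * lam ^ j * bell (i - j) (x t)) + lam ^ i"
      by (simp add: R_def flip: lessThan_Suc_atMost)
    moreover have "nderiv i y t = y t * R i t" using that by (intro ndy) auto
    ultimately show ?thesis using y0[of t] by simp
  qed
  have xAP: "(\<lambda>t. bell (i - j) (x t)) \<in> AP" if "i \<in> {1..n-1}" for i j
    unfolding x_def using that W(1) by (intro AP_bell) (auto simp: ZW)
  have x0: "bell (i - j) (x t) = 0" if "i \<in> {1..n-1}" "j < i" "Pr n r lam = (\<lambda>_. 0)" for i j t
  proof -
    have "bell (i - j) (x t) = bell (i - j) (\<lambda>_. 0)"
      unfolding x_def using that W0 by (intro bell_cong) (auto simp: ZW)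
    then show ?thesis using that by (simp add: bell_zero)
  qed
  have "\<forall>i\<in>{1..n-1}. is_bigO (\<lambda>t. nderiv i y t / y t - lam ^ i)
       (\<lambda>t. I_op (of_real \<beta>) (Pr n r lam) t + I_op (of_real (- \<beta>)) (Pr n r lam) t)" if "0 < \<beta>" for \<beta>
  proof
    fix i assume i: "i \<in> {1..n-1}"
    have "(\<lambda>t. \<Sum>j<i. of_nat (i choose j) * lam ^ j * bell (i - j) (x t)) = (\<lambda>_. 0)"
      if "Pr n r lam = (\<lambda>_. 0)"
      using x0[OF i _ that] by (simp add: fun_eq_iff)
    then show "is_bigO (\<lambda>t. nderiv i y t / y t - lam ^ i)
       (\<lambda>t. I_op (of_real \<beta>) (Pr n r lam) t + I_op (of_real (- \<beta>)) (Pr n r lam) t)"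
      unfolding quot[OF i] using i that by (intro is_bigO_two_sided_average AP_sum AP_mult AP_const xAP) auto
  qed
  moreover have "\<forall>i\<in>{0..n-2}. is_bigO (nderiv i z)
       (\<lambda>t. I_op (of_real \<beta>) (Pr n r lam) t + I_op (of_real (- \<beta>)) (Pr n r lam) t)" if "0 < \<beta>" for \<beta>
    using that z0 by (intro ballI is_bigO_two_sided_average) auto
  \<comment> \<open>D has order n - 1, one more than membership in \<open>AP_diff (n - 2)\<close>
    guarantees.\<close>
  moreover have "times_differentiable (n - 1) z"
    unfolding z_def by (rule deriv_tower_times_differentiable[OF Ztower])
  moreover have "z \<in> AP_diff (n - 2)"
    unfolding AP_diff_def z_def
    using deriv_tower_times_differentiable[OF deriv_tower_mono[OF Ztower, of "n - 2"]] z0(1) by (simp add: z_def)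
  moreover have "z t = - G_tot n \<gamma> (forcing n a r lam z) t" for t
    unfolding fz using n3 by (simp add: z_def Z_def Gd_def G_tot_def)
  moreover have "y t = exp (lam * of_real t)
        * exp ((-1) ^ n * (\<Prod>j=1..n-1. inverse (\<gamma> j)) * (LBINT s=ereal 0..ereal t. forcing n a r lam z s))
        * exp (- (\<Sum>j=1..n-1. 1 / (Gam n \<gamma> j * \<gamma> j) * G_op (\<gamma> j) (forcing n a r lam z) t))" for t
    unfolding fz y_def w_def E_def exp_add by (simp only: mult.assoc)
  ultimately show ?thesis using E eqD by (intro exI[of _ y] exI[of _ z]) blast
qed

end

theorem theorem3p2:
  fixes n :: nat
    and a :: "nat \<Rightarrow> complex"
    and r :: "nat \<Rightarrow> real \<Rightarrow> complex"
    and lam :: complex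
    and \<gamma> :: "nat \<Rightarrow> complex"
  assumes "n \<ge> 3"
    and "a n = 1"
    and "\<And>i. i < n \<Longrightarrow> r i \<in> AP"
    and "\<And>t. r n t = 0"
    and "poly (Ppoly n a) lam = 0"
    and "D_charpoly n a lam = (\<Prod>j=1..n-1. [:- \<gamma> j, 1:])"
    and "inj_on \<gamma> {1..n-1}"
    and "\<And>j. j \<in> {1..n-1} \<Longrightarrow> Re (\<gamma> j) \<noteq> 0"
    and "L_const n r lam \<gamma> 0 < 1"
    and "H_const n r lam \<gamma> \<le> H_bound n a r lam \<gamma>"
  shows "\<exists>y z.
     solves_E n a r y
   \<and> (\<forall>t. y t =
        exp (lam * of_real t)
        * exp ((-1) ^ n * (\<Prod>j=1..n-1. inverse (\<gamma> j))
               * (LBINT s=ereal 0..ereal t. forcing n a r lam z s))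
        * exp (- (\<Sum>j=1..n-1. 1 / (Gam n \<gamma> j * \<gamma> j) * G_op (\<gamma> j) (forcing n a r lam z) t)))
   \<and> z \<in> AP_diff (n - 2)
   \<and> times_differentiable (n - 1) z
   \<and> (\<forall>t. D_op n a lam z t + Pr n r lam t + L_op n r lam z t + F_op n a r lam z t = 0)
   \<and> (\<forall>t. z t = - G_tot n \<gamma> (forcing n a r lam z) t)
   \<and> (\<forall>\<beta>::real. 0 < \<beta> \<and> \<beta> < Min ((\<lambda>j. \<bar>Re (\<gamma> j)\<bar>) ` {1..n-1}) \<and> L_const n r lam \<gamma> \<beta> < 1 / 2 \<longrightarrow>
        (\<forall>i\<in>{0..n-2}. is_bigO (nderiv i z)
            (\<lambda>t. I_op (of_real \<beta>) (Pr n r lam) t + I_op (of_real (- \<beta>)) (Pr n r lam) t))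
      \<and> (\<forall>i\<in>{1..n-1}. is_bigO (\<lambda>t. nderiv i y t / y t - lam ^ i)
            (\<lambda>t. I_op (of_real \<beta>) (Pr n r lam) t + I_op (of_real (- \<beta>)) (Pr n r lam) t)))"
proof -
  interpret perturbed_equation n a r lam \<gamma>
    by unfold_locales (fact assms)+
  show ?thesis using solution_exists[OF assms(9,10)] by blast
qed

end
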